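(* Let $k=3$, and for all sufficiently large integers $j$ let $t_j>0$ be the unique zero of $V_-$ with $|\Theta(t_j)-\pi(j+1/2)|<\pi/4$. Put $$h=j+\frac12,\qquad t_j^*=\frac{\pi}{h\sqrt{h^2+7/4}}.$$ Then, as $j\to\infty$, $$t_j=t_j^*+O\!\left(h^{-3}e^{-(\sqrt3-1)\pi h}\right),$$ and, more precisely, $$(t_j-t_j^* )h^3e^{(\sqrt3-1)\pi h}=2(-1)^{j+1}\cos(\sqrt3\pi h)+O(h^{-1}).$$ The set of limit points (as $j\to\infty$) of the left side is $[-2,2]$. In particular, $$\limsup_{j\to\infty}|t_j-t_j^*|h^3e^{(\sqrt3-1)\pi h}=2,$$ so no bound $t_j-t_j^*=O(h^{-3}e^{-ch})$ with $c>(\sqrt3-1)\pi$ can hold for all sufficiently large $j$. Moreover, $$\Theta(t_j)=\pi\left(h+\frac7{16h}+O(h^{-3})\right).$$ For every integer $a\ge2$ and every even $d\ge2$, the corresponding poles of the section $q\mapsto W_{a,d}(q,3)$ are $q_j=e^{-t_j/a}$.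
   Context: $\Phi(q)=\prod_{n\ge1}(1-q^n)$. With $k=3$: for $t>0$ and $Q=e^{-t}$, $$V_-(t)=Q\sum_{m\ge0}(-1)^mQ^m\Phi(Q^{m+1})^3,\qquad \Theta(t)=\pi^{3/2}t^{-1/2}.$$ For every sufficiently large integer $j$ there is exactly one zero of $V_-$ in the window $|\Theta(t)-\pi(j+1/2)|<\pi/4$. For $0<|q|<1$, $$W_{a,d}(q,3)=\frac1d\sum_{z^d=1}\frac{\sum_{m\ge0}z^mq^{am+1}\Phi(q^{am+1})^3}{\sum_{m\ge0}z^mq^{a(m+1)}\Phi(q^{a(m+1)})^3},$$ a meromorphic function of $q$; the denominator at $z=-1$, $q=e^{-t/a}$ is $V_-(t)$. *)

theory Defs
  imports "HOL-Complex_Analysis.Complex_Analysis"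
begin

definition Phi :: "'a::{real_normed_field} \<Rightarrow> 'a" where
  "Phi q = (\<Prod>n. 1 - q ^ Suc n)"

definition V_minus :: "real \<Rightarrow> real" where
  "V_minus t = (let Q = exp (- t) in
     Q * (\<Sum>m. (- 1) ^ m * Q ^ m * Phi (Q ^ (m + 1)) ^ 3))"

definition Theta :: "real \<Rightarrow> real" where
  "Theta t = pi powr (3 / 2) * t powr (- (1 / 2))"

definition hh :: "nat \<Rightarrow> real" where
  "hh j = real j + 1 / 2"

definition t_star :: "nat \<Rightarrow> real" where
  "t_star j = pi / (hh j * sqrt ((hh j)\<^sup>2 + 7 / 4))"

definition in_window :: "nat \<Rightarrow> real \<Rightarrow> bool" where
  "in_window j t \<longleftrightarrow> \<bar>Theta t - pi * (real j + 1 / 2)\<bar> < pi / 4"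

definition unique_zero_in_window :: "nat \<Rightarrow> real \<Rightarrow> bool" where
  "unique_zero_in_window j t \<longleftrightarrow>
     t > 0 \<and> V_minus t = 0 \<and> in_window j t \<and>
     (\<forall>s>0. V_minus s = 0 \<and> in_window j s \<longrightarrow> s = t)"

(* The section k = 3 of W_{a,d}(q,k), meaningful for 0 < norm q < 1.  The value at a zero of a
   denominator is a convention (x / 0 = 0); it does not affect isolated_singularity_at or is_pole. *)
definition W3 :: "nat \<Rightarrow> nat \<Rightarrow> complex \<Rightarrow> complex" where
  "W3 a d q = 1 / of_nat d * (\<Sum>z | z ^ d = 1.
     (\<Sum>m. z ^ m * q ^ (a * m + 1) * Phi (q ^ (a * m + 1)) ^ 3) /
     (\<Sum>m. z ^ m * q ^ (a * (m + 1)) * Phi (q ^ (a * (m + 1))) ^ 3))"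

definition limit_points :: "(nat \<Rightarrow> real) \<Rightarrow> real set" where
  "limit_points X = {l. \<exists>r. strict_mono (r :: nat \<Rightarrow> nat) \<and> (X \<circ> r) \<longlonglongrightarrow> l}"

end

theory Submission
  imports Defs "HOL-Library.Nat_Bijection" "HOL-Real_Asymp.Real_Asymp"
begin

text \<open>Jacobi's identity \<open>\<Phi>(q)\<^sup>3 = \<Sum>k. (-1)\<^sup>k (2k+1) q\<^bsup>k(k+1)/2\<^esup>\<close> turns \<open>V\<^sub>-\<close> into the Fermi-type sum
  \<open>\<Sum>k. (-1)\<^sup>k (2k+1) / (e\<^bsup>tE\<^esup> + 1)\<close> with \<open>2 E = (k + 1/2)\<^sup>2 + 7/4\<close>.  Integrating against \<open>\<pi> / cos \<pi>u\<close> over a wide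
  rectangle replaces it by the sum of \<open>-(\<pi>/t) / cos \<pi>u\<close> over all poles \<open>u\<^sup>2 = 2 \<pi> \<i> \<mu> / t - 7/4\<close>, \<open>\<mu>\<close> odd.  The pair
  \<open>\<mu> = \<plusminus>1\<close> dominates and its contribution vanishes exactly when \<open>Re u\<close> is a half-integer \<open>h\<close>, that is at
  \<open>t\<^sup>* = \<pi> / (h sqrt (h\<^sup>2 + 7/4))\<close>; the pair \<open>\<mu> = \<plusminus>3\<close>, smaller by a factor of order \<open>e\<^bsup>-(sqrt 3 - 1)\<pi>h\<^esup>\<close>, displaces the
  zero by the stated leading term.  The limit points come from Kronecker's theorem for the irrational
  number \<open>(sqrt 3 + 1) / 2\<close>.  In \<open>W\<close>, the denominators for \<open>z \<noteq> -1\<close> are dominated by a single pole and so do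
  not vanish for small \<open>t\<close>, while in the numerator for \<open>z = -1\<close> the phase of the dominant pair is shifted by \<open>\<pi>/a\<close>,
  which keeps it away from zero.\<close>

section \<open>Jacobi's identity\<close>

text \<open>The displacement of the zero is exponentially small in h, beyond all powers of t, so the
  algebraic dependence on t has to be handled exactly. The pole equation allows this: with x = Re u
  for \<mu> = 1 one has pi / t = x sqrt (x^2 + 7/4), and every power correction is contained in the
  change of variable from t to x.

  The height of the rectangle decides which poles are counted. With s = sqrt (pi / t), the pole of
  index \<mu> has Im u of about sqrt |\<mu>| s and contributes a term of order exp (- pi sqrt
  |\<mu>| s), up to the common prefactor. A rectangle of half-height c s keeps |\<mu>| < c^2 and
  leaves an error of order exp (- pi c s). For z = - 1 the choice c = 2 lies between sqrt 3 and sqrt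
  5; relative to the leading pair the error is of order exp (- pi s), smaller than the effect exp (-
  (sqrt 3 - 1) pi s) to be measured. For the other z, c = 1 isolates a single pole.

  In the rescaled variable v = u / s the poles depend on s only through \<epsilon> = 7 / (4 s^2),
  which tends to 0; hence the bounds on the contour lines can be made uniform in large s.\<close>

definition qpoch :: "'a::comm_ring_1 \<Rightarrow> nat \<Rightarrow> 'a" where
  "qpoch q n = (\<Prod>i<n. 1 - q ^ Suc i)"

lemma qpoch_0 [simp]: "qpoch q 0 = 1"
  and qpoch_Suc: "qpoch q (Suc n) = qpoch q n * (1 - q ^ Suc n)"
  by (simp_all add: qpoch_def)

context
  fixes q :: "'a::{real_normed_field,banach}"
  assumes q: "norm q < 1"
begin

lemma one_minus_power_nonzero: "1 - q ^ Suc n \<noteq> 0"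
proof
  assume "1 - q ^ Suc n = 0"
  then have "norm (q ^ Suc n) = 1"
    by simp
  moreover have "norm q ^ Suc n < 1"
    using q by (simp only: power_less_one_iff norm_ge_zero) simp
  ultimately show False
    by (simp add: norm_power del: power_Suc)
qed

lemma qpoch_nonzero: "qpoch q n \<noteq> 0"
  unfolding qpoch_def using one_minus_power_nonzero by (simp del: power_Suc)

lemma convergent_prod_Phi: "convergent_prod (\<lambda>n. 1 - q ^ Suc n)"
proof -
  have "summable (\<lambda>n. norm q ^ Suc n)"
    using q by (subst summable_Suc_iff) (simp add: summable_geometric)
  then have "summable (\<lambda>n. norm ((1 - q ^ Suc n) - 1))"
    by (simp add: norm_power norm_mult)
  then show ?thesis
    by (intro abs_convergent_prod_imp_convergent_prod summable_imp_abs_convergent_prod)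
qed

lemma qpoch_LIMSEQ: "qpoch q \<longlonglongrightarrow> Phi q"
proof -
  have "(\<lambda>n. qpoch q (Suc n)) \<longlonglongrightarrow> Phi q"
    using convergent_prod_LIMSEQ[OF convergent_prod_Phi]
    by (simp add: Phi_def qpoch_def lessThan_Suc_atMost del: power_Suc)
  then show ?thesis
    by (rule LIMSEQ_imp_Suc)
qed

lemma Phi_nonzero: "Phi q \<noteq> 0"
  unfolding Phi_def
  using prodinf_nonzero[OF convergent_prod_Phi one_minus_power_nonzero] .

text \<open>\<open>jacobi_coeff n\<close> lists the coefficients with nonnegative index of the Laurent polynomial
  \<open>f = (1 - 1/x) (\<Prod>i=1..n. (1 - x q\<^sup>i) (1 - q\<^sup>i / x))\<close>; those with negative index follow from
  \<open>f (1/x) = - x f (x)\<close>.\<close>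

definition jacobi_coeff :: "nat \<Rightarrow> nat \<Rightarrow> 'a" where
  "jacobi_coeff n k = (if k \<le> n
     then (- 1) ^ k * q ^ triangle k * qpoch q (2 * n + 1) / (qpoch q (n - k) * qpoch q (n + k + 1))
     else 0)"

text \<open>Passing from n to n + 1 multiplies the Laurent polynomial by (1 - x Q)(1 - Q / x) = 1 +
  Q^2 - Q (x + 1 / x) with Q = q^(n+1); this is the comparison of the coefficients of x^(k+1). The
  cases separate the indices at which some of the three coefficients on the right vanish, where the
  closed form with truncated subtraction would be wrong.\<close>

lemma jacobi_coeff_Suc_Suc:
  "jacobi_coeff (Suc n) (Suc k) = (1 + (q ^ Suc n)\<^sup>2) * jacobi_coeff n (Suc k)
     - q ^ Suc n * (jacobi_coeff n k + jacobi_coeff n (Suc (Suc k)))"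
proof -
  consider d where "n = k + d + 2" | "n = k + 1" | "n = k" | "n < k"
  proof -
    have "n = k + (n - k - 2) + 2 \<or> n = k + 1 \<or> n = k \<or> n < k" by linarith
    then show ?thesis using that by blast
  qed
  then show ?thesis
  proof cases
    case (1 d)
    define x y where "x = q ^ k" and "y = q ^ d"
    define p r w where "p = qpoch q d" and "r = qpoch q (2*k+d+3)" and "w = qpoch q (2*n+1)"
    have nz: "p \<noteq> 0" "r \<noteq> 0" "qpoch q (d+2) \<noteq> 0" "qpoch q (2*k+d+5) \<noteq> 0"
      by (simp_all add: p_def r_def qpoch_nonzero)
    have P: "qpoch q (Suc d) = p * (1 - q * y)" "qpoch q (Suc (Suc d)) = p * (1 - q * y) * (1 - q^2 * y)"
      "qpoch q (2*k+d+4) = r * (1 - q^4*x^2*y)"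
      "qpoch q (2*k+d+5) = r * (1 - q^4*x^2*y) * (1 - q^5*x^2*y)"
      "qpoch q (2*Suc n+1) = w * (1 - q^6*x^2*y^2) * (1 - q^7*x^2*y^2)"
      by (simp_all add: p_def r_def w_def x_def y_def 1 qpoch_Suc eval_nat_numeral power_add algebra_simps)
    have f: "1 - q * y \<noteq> 0" "1 - q^2 * y \<noteq> 0" "1 - q^4*x^2*y \<noteq> 0" "1 - q^5*x^2*y \<noteq> 0"
      using nz P by auto
    have idx: "Suc n - Suc k = Suc (Suc d)" "Suc n + Suc k + 1 = 2*k+d+5" "n - Suc k = Suc d"
      "n + Suc k + 1 = 2*k+d+4" "n - k = Suc (Suc d)" "n + k + 1 = 2*k+d+3"
      "n - Suc (Suc k) = d" "n + Suc (Suc k) + 1 = 2*k+d+5"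
      and le: "Suc k \<le> Suc n" "Suc k \<le> n" "k \<le> n" "Suc (Suc k) \<le> n"
      using 1 by auto
    have T: "q ^ triangle (Suc k) = q ^ triangle k * x * q" "q ^ triangle (Suc (Suc k)) = q ^ triangle k * x^2 * q^3"
      by (simp_all add: x_def power_add eval_nat_numeral mult_ac)
    have A: "jacobi_coeff (Suc n) (Suc k) = - ((-1)^k * q^triangle k) * x * q * (w * (1 - q^6*x^2*y^2) * (1 - q^7*x^2*y^2))
         / ((p * (1 - q * y) * (1 - q^2 * y)) * (r * (1 - q^4*x^2*y) * (1 - q^5*x^2*y)))"
      unfolding jacobi_coeff_def idx P T using le by simp
    have B: "jacobi_coeff n (Suc k) = - ((-1)^k * q^triangle k) * x * q * w / ((p * (1 - q * y)) * (r * (1 - q^4*x^2*y)))"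
      unfolding jacobi_coeff_def idx P T w_def[symmetric] using le by simp
    have C: "jacobi_coeff n k = ((-1)^k * q^triangle k) * w / ((p * (1 - q * y) * (1 - q^2 * y)) * r)"
      unfolding jacobi_coeff_def idx P T w_def[symmetric] r_def[symmetric] using le by simp
    have D: "jacobi_coeff n (Suc (Suc k)) = ((-1)^k * q^triangle k) * x^2 * q^3 * w / (p * (r * (1 - q^4*x^2*y) * (1 - q^5*x^2*y)))"
      unfolding jacobi_coeff_def idx P T w_def[symmetric] p_def[symmetric] using le by simp
    have Q: "q ^ Suc n = q^3 * x * y"
      by (simp add: 1 x_def y_def power_add eval_nat_numeral mult_ac)
    define s where "s = (-1)^k * q^triangle k"
    \<comment> \<open>Once the common factor \<open>G\<close> below is removed, the recurrence is
      exactly this polynomial identity in q, x = q^k and y = q^d.\<close>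
    have key: "- x * q * ((1 - q^6*x^2*y^2) * (1 - q^7*x^2*y^2)) =
        (1 + (q^3 * x * y)^2) * (- x * q * ((1 - q^2 * y) * (1 - q^5*x^2*y)))
        - q^3 * x * y * ((1 - q^4*x^2*y) * (1 - q^5*x^2*y) + x^2 * q^3 * ((1 - q * y) * (1 - q^2 * y)))"
      by algebra
    define u1 u2 u3 u4 where "u1 = 1 - q * y" and "u2 = 1 - q^2 * y" and "u3 = 1 - q^4*x^2*y" and "u4 = 1 - q^5*x^2*y"
    note u = u1_def[symmetric] u2_def[symmetric] u3_def[symmetric] u4_def[symmetric]
    define G where "G = s * w / (p * u1 * u2 * r * u3 * u4)"
    have nz': "u1 \<noteq> 0" "u2 \<noteq> 0" "u3 \<noteq> 0" "u4 \<noteq> 0"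
      using f by (simp_all add: u)
    have A': "jacobi_coeff (Suc n) (Suc k) = - x * q * ((1 - q^6*x^2*y^2) * (1 - q^7*x^2*y^2)) * G"
      unfolding A s_def[symmetric] u G_def by (simp add: mult_ac)
    have B': "jacobi_coeff n (Suc k) = - x * q * (u2 * u4) * G"
      unfolding B s_def[symmetric] u G_def using nz' by (simp add: mult_ac)
    have C': "jacobi_coeff n k = u3 * u4 * G"
      unfolding C s_def[symmetric] u G_def using nz' by (simp add: mult_ac)
    have D': "jacobi_coeff n (Suc (Suc k)) = x^2 * q^3 * (u1 * u2) * G"
      unfolding D s_def[symmetric] u G_def using nz' by (simp add: mult_ac)
    show ?thesis
      unfolding A' B' C' D' Q using key[unfolded u] by algebra
  next
    case 2
    define x s r where "x = q ^ k" and "s = (- 1) ^ k * q ^ triangle k" and "r = qpoch q (2*k+2)"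
    have P: "qpoch q (2*k+3) = r * (1 - q^3*x^2)" "qpoch q (2*k+4) = r * (1 - q^3*x^2) * (1 - q^4*x^2)"
      "qpoch q (2*k+5) = r * (1 - q^3*x^2) * (1 - q^4*x^2) * (1 - q^5*x^2)" "qpoch q 1 = 1 - q"
      by (simp_all add: r_def x_def qpoch_Suc eval_nat_numeral power_add algebra_simps)
    have "r \<noteq> 0" "qpoch q (2*k+4) \<noteq> 0" "qpoch q 1 \<noteq> 0"
      by (simp_all add: r_def qpoch_nonzero)
    then have nz: "r \<noteq> 0" "1 - q \<noteq> 0" "1 - q^3*x^2 \<noteq> 0" "1 - q^4*x^2 \<noteq> 0"
      unfolding P by auto
    have idx: "Suc n - Suc k = 1" "Suc n + Suc k + 1 = 2*k+4" "n - Suc k = 0" "n + Suc k + 1 = 2*k+3"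
      "n - k = 1" "n + k + 1 = 2*k+2" "2 * Suc n + 1 = 2*k+5" "2 * n + 1 = 2*k+3"
      and le: "Suc k \<le> Suc n" "Suc k \<le> n" "k \<le> n" "\<not> Suc (Suc k) \<le> n"
      using 2 by auto
    have A: "jacobi_coeff (Suc n) (Suc k) = - s * x * q * (1 - q^5*x^2) / (1 - q)"
      unfolding jacobi_coeff_def idx P s_def x_def[symmetric] using le nz
      by (simp add: power_add mult_ac flip: x_def)
    have B: "jacobi_coeff n (Suc k) = - s * x * q"
      unfolding jacobi_coeff_def idx P s_def using le nz
      by (simp add: power_add mult_ac flip: x_def)
    have C: "jacobi_coeff n k = s * (1 - q^3*x^2) / (1 - q)"
      unfolding jacobi_coeff_def idx P s_def r_def[symmetric] using le nz by (simp add: mult_ac)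
    have D: "jacobi_coeff n (Suc (Suc k)) = 0"
      using le by (simp add: jacobi_coeff_def)
    have Q: "q ^ Suc n = q^2 * x"
      by (simp add: 2 x_def eval_nat_numeral mult_ac)
    show ?thesis
      unfolding A B C D Q using nz(2) by (simp add: divide_simps) algebra
  next
    case 3
    show ?thesis
      by (simp add: jacobi_coeff_def 3 power_add qpoch_nonzero mult_2)
  qed (simp add: jacobi_coeff_def)
qed

text \<open>By the antisymmetry f (1/x) = - x f (x) the coefficient of 1/x is minus the constant
  coefficient. The general recurrence at index 0 therefore acquires the extra term Q times
  \<open>jacobi_coeff n 0\<close>.\<close>

lemma jacobi_coeff_Suc_0:
  "jacobi_coeff (Suc n) 0 = (1 + q ^ Suc n + (q ^ Suc n)\<^sup>2) * jacobi_coeff n 0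
     - q ^ Suc n * jacobi_coeff n 1"
proof (cases n)
  case 0
  have "1 - q \<noteq> 0" "1 - q ^ 2 \<noteq> 0" "1 - q ^ 3 \<noteq> 0"
    using one_minus_power_nonzero[of 0] one_minus_power_nonzero[of 1] one_minus_power_nonzero[of 2]
    by (simp_all add: eval_nat_numeral)
  then show ?thesis
    unfolding 0
    by (simp add: jacobi_coeff_def qpoch_Suc eval_nat_numeral) (simp add: divide_simps, algebra)
next
  case (Suc m)
  define x w p r where "x = q ^ m" and "w = qpoch q (2*n+1)" and "p = qpoch q m" and "r = qpoch q (m+2)"
  have nz: "p \<noteq> 0" "r \<noteq> 0" "1 - q * x \<noteq> 0" "1 - q^2 * x \<noteq> 0" "1 - q^3 * x \<noteq> 0" "w \<noteq> 0"
    using one_minus_power_nonzero[of m] one_minus_power_nonzero[of "m+1"] one_minus_power_nonzero[of "m+2"]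
    by (simp_all add: p_def r_def w_def x_def qpoch_nonzero eval_nat_numeral power_add algebra_simps)
  have P: "qpoch q (Suc m) = p * (1 - q * x)" "qpoch q (Suc (Suc m)) = r" "r = p * (1 - q * x) * (1 - q^2 * x)"
    "qpoch q (m+3) = r * (1 - q^3 * x)" "qpoch q (2*Suc n+1) = w * (1 - q^4*x^2) * (1 - q^5*x^2)"
    by (simp_all add: p_def r_def w_def x_def Suc qpoch_Suc eval_nat_numeral power_add algebra_simps)
  have A: "jacobi_coeff (Suc n) 0 = w * (1 - q^4*x^2) * (1 - q^5*x^2) / (r * (r * (1 - q^3 * x)))"
    using P by (simp add: jacobi_coeff_def Suc eval_nat_numeral)
  have B: "jacobi_coeff n 0 = w / (p * (1 - q * x) * r)"
    using P by (simp add: jacobi_coeff_def Suc eval_nat_numeral w_def)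
  have C: "jacobi_coeff n 1 = - q * w / (p * (r * (1 - q^3 * x)))"
    using P by (simp add: jacobi_coeff_def Suc w_def p_def eval_nat_numeral)
  have Q: "q ^ Suc n = q^2 * x"
    by (simp add: Suc x_def eval_nat_numeral mult_ac)
  have r: "r * (w * (1 - q^4*x^2) * (1 - q^5*x^2) / (r * (r * (1 - q^3 * x)))) =
     r * ((1 + q^2 * x + (q^2 * x)^2) * (w / (p * (1 - q * x) * r)) - q^2 * x * (- q * w / (p * (r * (1 - q^3 * x)))))"
    unfolding P(3) using nz
    by (simp add: divide_simps) algebra
  show ?thesis
    unfolding A B C Q using r nz(2) by (metis mult_cancel_left)
qed

text \<open>The weight 2k + 1 is an eigenvector of the recurrence: (1 + Q^2)(2k + 1) - Q ((2k - 1) +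
  (2k + 3)) = (1 - Q)^2 (2k + 1), and the modified relation at index 0 is compatible with it. Only
  boundary terms at N remain.\<close>

lemma sum_three_term:
  fixes a b :: "nat \<Rightarrow> 'a"
  assumes "b 0 = (1 + Q + Q\<^sup>2) * a 0 - Q * a 1"
    and "\<And>k. b (Suc k) = (1 + Q\<^sup>2) * a (Suc k) - Q * (a k + a (Suc (Suc k)))"
  shows "(\<Sum>k\<le>N. (2 * of_nat k + 1) * b k) = (1 - Q)\<^sup>2 * (\<Sum>k\<le>N. (2 * of_nat k + 1) * a k)
     + Q * ((2 * of_nat N + 3) * a N - (2 * of_nat N + 1) * a (Suc N))"
proof (induction N)
  case 0
  show ?case
    unfolding atMost_0 by (simp add: assms(1) power2_eq_square algebra_simps)
next
  case (Suc N)
  show ?case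
    by (simp add: Suc.IH assms(2)) algebra
qed

text \<open>By antisymmetry the left side is f'(1) for the Laurent polynomial f. Its factor 1 - 1/x
  vanishes at 1 with derivative 1, so only the product of the (1 - q^i)^2 is left. The induction
  reproduces this one factor at a time; with N >= n the boundary terms of
  \<open>sum_three_term\<close> vanish.\<close>

lemma sum_jacobi_coeff:
  assumes "n \<le> N"
  shows "(\<Sum>k\<le>N. (2 * of_nat k + 1) * jacobi_coeff n k) = (qpoch q n)\<^sup>2"
  using assms
proof (induction n)
  case 0
  have "(\<Sum>k\<le>N. (2 * of_nat k + 1) * jacobi_coeff 0 k) = (\<Sum>k\<in>{0}. (2 * of_nat k + 1) * jacobi_coeff 0 k)"
    by (intro sum.mono_neutral_right) (auto simp: jacobi_coeff_def)
  then show ?case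
    using qpoch_nonzero[of 1] by (simp add: jacobi_coeff_def)
next
  case (Suc n)
  have "jacobi_coeff n N = 0" "jacobi_coeff n (Suc N) = 0"
    using Suc.prems by (auto simp: jacobi_coeff_def)
  then show ?case
    using sum_three_term[of "jacobi_coeff (Suc n)" "q ^ Suc n" "jacobi_coeff n" N,
        OF jacobi_coeff_Suc_0 jacobi_coeff_Suc_Suc] Suc
    by (simp add: qpoch_Suc power_mult_distrib mult.commute del: power_Suc)
qed

end

lemma le_triangle: "n \<le> triangle n"
  by (induction n) auto

lemma summable_odd_powers:
  assumes "0 \<le> r" "r < (1::real)"
  shows "summable (\<lambda>k. (2 * of_nat k + 1) * r ^ k)"
proof -
  have "summable (\<lambda>k. r ^ k)" "summable (\<lambda>k. of_nat (Suc k) * r ^ k)"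
    using assms geometric_deriv_sums[of r] by (auto simp: summable_geometric sums_iff)
  then have "summable (\<lambda>k. 2 * (of_nat (Suc k) * r ^ k) - r ^ k)"
    by (intro summable_diff summable_mult)
  then show ?thesis
    by (simp add: algebra_simps)
qed

lemma norm_2k1:
  "norm (2 * of_nat k + 1 :: 'a::real_normed_field) = 2 * real k + 1"
  "norm (of_nat k * 2 + 1 :: 'a) = 2 * real k + 1"
proof -
  have "(2 * of_nat k + 1 :: 'a) = of_nat (2 * k + 1)"
    by simp
  then show *: "norm (2 * of_nat k + 1 :: 'a) = 2 * real k + 1"
    by (metis norm_of_nat of_nat_1 of_nat_add of_nat_mult of_nat_numeral)
  then show "norm (of_nat k * 2 + 1 :: 'a) = 2 * real k + 1"
    by (simp add: mult.commute)
qed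

text \<open>Let n tend to infinity in \<open>sum_jacobi_coeff\<close>. The coefficients converge to
  those of the series divided by \<open>Phi q\<close>, the right side to the square of
  \<open>Phi q\<close>; multiplying by \<open>Phi q\<close> yields the cube. Tannery's theorem
  justifies the interchange of limit and sum.\<close>

theorem jacobi_Phi_cube:
  fixes q :: "'a::{real_normed_field,banach}"
  assumes q: "norm q < 1"
  shows "summable (\<lambda>k. norm ((- 1) ^ k * (2 * of_nat k + 1) * q ^ triangle k))"
    and "Phi q ^ 3 = (\<Sum>k. (- 1) ^ k * (2 * of_nat k + 1) * q ^ triangle k)"
proof -
  note lim = qpoch_LIMSEQ[OF q] and nz = qpoch_nonzero[OF q] and Phi_nz = Phi_nonzero[OF q]
  have "Bseq (qpoch q)"
    using lim by (intro convergent_imp_Bseq convergentI)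
  then obtain A where A: "A > 0" "\<And>n. norm (qpoch q n) \<le> A"
    by (auto simp: Bseq_def)
  have "(\<lambda>n. inverse (qpoch q n)) \<longlonglongrightarrow> inverse (Phi q)"
    by (intro tendsto_inverse lim Phi_nz)
  then have "Bseq (\<lambda>n. inverse (qpoch q n))"
    by (intro convergent_imp_Bseq convergentI)
  then obtain B where B: "B > 0" "\<And>n. norm (inverse (qpoch q n)) \<le> B"
    by (auto simp: Bseq_def)
  define a where "a = (\<lambda>k n. (2 * of_nat k + 1) * jacobi_coeff q n k)"
  define b where "b = (\<lambda>k. ((- 1) ^ k * (2 * of_nat k + 1) * q ^ triangle k) * inverse (Phi q))"
  \<comment> \<open>The majorant: A and B bound the partial products and their inverses, and
    \<open>triangle k\<close> >= k replaces the quadratic exponent by a linear one.\<close>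
  define M where "M = (\<lambda>k. (2 * of_nat k + 1) * norm q ^ k * (A * (B * B)))"
  have "(a k \<longlongrightarrow> b k) sequentially" for k
  proof -
    have 1: "(\<lambda>n. qpoch q (2 * n + 1)) \<longlonglongrightarrow> Phi q"
      by (rule filterlim_compose[OF lim]) real_asymp
    have 2: "(\<lambda>n. qpoch q (n - k)) \<longlonglongrightarrow> Phi q"
      by (rule filterlim_compose[OF lim]) (rule filterlim_minus_const_nat_at_top)
    have 3: "(\<lambda>n. qpoch q (n + k + 1)) \<longlonglongrightarrow> Phi q"
      by (rule filterlim_compose[OF lim]) real_asymp
    have "(\<lambda>n. (2 * of_nat k + 1) * ((- 1) ^ k * q ^ triangle k * qpoch q (2 * n + 1) / (qpoch q (n - k) * qpoch q (n + k + 1))))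
       \<longlonglongrightarrow> (2 * of_nat k + 1) * ((- 1) ^ k * q ^ triangle k * Phi q / (Phi q * Phi q))"
      by (intro tendsto_intros 1 2 3) (use Phi_nz in auto)
    also have "(2 * of_nat k + 1) * ((- 1) ^ k * q ^ triangle k * Phi q / (Phi q * Phi q)) = b k"
      using Phi_nz by (simp add: b_def field_simps)
    finally show ?thesis
      by (rule Lim_transform_eventually)
         (use eventually_ge_at_top[of k] in eventually_elim, simp add: a_def jacobi_coeff_def[OF q])
  qed
  moreover have "norm (a k n) \<le> M k" for k n
  proof (cases "k \<le> n")
    case True
    have "norm (a k n) = (2 * of_nat k + 1) * norm q ^ triangle k * (norm (qpoch q (2 * n + 1)) *
        (norm (inverse (qpoch q (n - k))) * norm (inverse (qpoch q (n + k + 1)))))"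
      using True by (simp add: a_def jacobi_coeff_def[OF q] norm_mult norm_power norm_divide norm_inverse norm_2k1 divide_inverse mult_ac)
    also have "\<dots> \<le> (2 * of_nat k + 1) * norm q ^ k * (A * (B * B))"
      using q A B le_triangle by (intro mult_mono power_decreasing) auto
    finally show ?thesis
      by (simp add: M_def)
  next
    case False
    then show ?thesis
      using A(1) B(1) by (simp add: a_def jacobi_coeff_def[OF q] M_def)
  qed
  moreover have "summable M"
    unfolding M_def using q by (intro summable_mult2 summable_odd_powers) auto
  ultimately have T: "summable (\<lambda>n. norm (b n))" "(\<lambda>n. \<Sum>k. a k n) \<longlonglongrightarrow> suminf b"
    using tannerys_theorem[of a b sequentially M] by (auto simp: case_prod_unfold)
  have "(\<Sum>k. a k n) = (qpoch q n)\<^sup>2" for n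
    unfolding sum_jacobi_coeff[OF q order.refl, symmetric]
    unfolding a_def by (rule suminf_finite) (auto simp: jacobi_coeff_def[OF q])
  then have "(\<lambda>n. (qpoch q n)\<^sup>2) \<longlonglongrightarrow> suminf b"
    using T(2) by simp
  then have sb: "suminf b = (Phi q)\<^sup>2"
    using lim by (intro LIMSEQ_unique[OF _ tendsto_power])
  have b_mult: "b n * Phi q = (- 1) ^ n * (2 * of_nat n + 1) * q ^ triangle n" for n
    using Phi_nz by (simp add: b_def mult.assoc)
  have "summable (\<lambda>n. norm (b n * Phi q))"
    unfolding norm_mult by (intro summable_mult2 T(1))
  then show "summable (\<lambda>k. norm ((- 1) ^ k * (2 * of_nat k + 1) * q ^ triangle k))"
    unfolding b_mult .
  have "Phi q ^ 3 = suminf b * Phi q"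
    unfolding sb by (simp add: power2_eq_square power3_eq_cube)
  also have "\<dots> = (\<Sum>k. b k * Phi q)"
    by (rule suminf_mult2[OF summable_norm_cancel[OF T(1)]])
  finally show "Phi q ^ 3 = (\<Sum>k. (- 1) ^ k * (2 * of_nat k + 1) * q ^ triangle k)"
    unfolding b_mult .
qed

section \<open>Lambert series\<close>

text \<open>Here \<open>Suc (triangle k)\<close> is 1 + k (k + 1) / 2. The term results from
  inserting Jacobi's series into the sums that define \<open>W3\<close> and summing over m first; b
  = 1 belongs to the numerators and b = a to the denominators.\<close>

definition lambert_term :: "'a::{real_normed_field,banach} \<Rightarrow> nat \<Rightarrow> nat \<Rightarrow> 'a \<Rightarrow> nat \<Rightarrow> 'a" where
  "lambert_term z a b q k = (- 1) ^ k * (2 * of_nat k + 1) * q ^ (b * Suc (triangle k)) /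
      (1 - z * q ^ (a * Suc (triangle k)))"

lemma lambert_denominator:
  fixes q z :: "'a::real_normed_field"
  assumes "norm q < 1" "norm z \<le> 1" "0 < n"
  shows "norm (z * q ^ n) \<le> norm q" "1 - norm q \<le> norm (1 - z * q ^ n)" "1 - z * q ^ n \<noteq> 0"
proof -
  have "norm q ^ n \<le> norm q ^ 1"
    using assms by (intro power_decreasing) auto
  then show *: "norm (z * q ^ n) \<le> norm q"
    using mult_mono[OF assms(2) \<open>norm q ^ n \<le> norm q ^ 1\<close>] by (simp add: norm_mult norm_power)
  have "norm (1::'a) \<le> norm (1 - z * q ^ n) + norm (z * q ^ n)"
    by (rule norm_triangle_sub[of 1 "z * q ^ n", THEN order_trans]) (simp add: add.commute)
  with * show "1 - norm q \<le> norm (1 - z * q ^ n)"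
    by simp
  with assms show "1 - z * q ^ n \<noteq> 0"
    by auto
qed

lemma norm_lambert_term_le:
  fixes q z :: "'a::{real_normed_field,banach}"
  assumes "norm q \<le> r" "r < 1" "norm z \<le> 1" "0 < a" "0 < b"
  shows "norm (lambert_term z a b q k) \<le> (2 * of_nat k + 1) * r ^ k * (1 / (1 - r))"
proof -
  have "0 \<le> r"
    using assms(1) norm_ge_zero[of q] by linarith
  have "norm q ^ (b * Suc (triangle k)) \<le> r ^ (b * Suc (triangle k))"
    using assms by (intro power_mono) auto
  also have "\<dots> \<le> r ^ k"
    using assms \<open>0 \<le> r\<close> mult_le_mono[of 1 b k "Suc (triangle k)"] le_triangle[of k]
    by (intro power_decreasing) auto
  finally have 1: "norm q ^ (b * Suc (triangle k)) \<le> r ^ k" .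
  have "1 - r \<le> norm (1 - z * q ^ (a * Suc (triangle k)))"
    using lambert_denominator(2)[of q z "a * Suc (triangle k)"] assms by simp
  then have "1 / norm (1 - z * q ^ (a * Suc (triangle k))) \<le> 1 / (1 - r)"
    using assms by (intro divide_left_mono) (auto intro!: mult_pos_pos)
  then have "(2 * of_nat k + 1) * norm q ^ (b * Suc (triangle k)) * (1 / norm (1 - z * q ^ (a * Suc (triangle k))))
     \<le> (2 * of_nat k + 1) * r ^ k * (1 / (1 - r))"
    using 1 assms \<open>0 \<le> r\<close> by (intro mult_mono) auto
  then show ?thesis
    by (simp add: lambert_term_def norm_mult norm_divide norm_power norm_2k1)
qed

text \<open>Expand each cube by Jacobi's identity and interchange the summations; for fixed k the
  sum over m is geometric.\<close>

lemma lambert_identity: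
  fixes q z :: "'a::{real_normed_field,banach}"
  assumes q: "norm q < 1" and z: "norm z \<le> 1" and ab: "0 < a" "0 < b"
  shows "(\<Sum>m. z ^ m * q ^ (a * m + b) * Phi (q ^ (a * m + b)) ^ 3) = (\<Sum>k. lambert_term z a b q k)"
    and "summable (\<lambda>m. z ^ m * q ^ (a * m + b) * Phi (q ^ (a * m + b)) ^ 3)"
proof -
  define f where "f = (\<lambda>m k. z ^ m * ((- 1) ^ k * (2 * of_nat k + 1) * q ^ ((a * m + b) * Suc (triangle k))))"
  have bound: "norm (f m k) \<le> norm q ^ m * ((2 * of_nat k + 1) * norm q ^ k)" for m k
  proof -
    \<comment> \<open>This inequality decouples the two indices, so that the double series is
      dominated by a product of two convergent series.\<close>
    have "m + k \<le> (a * m + b) * Suc (triangle k)"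
    proof -
      have "m * 1 \<le> (a * m) * Suc (triangle k)"
        using ab by (intro mult_le_mono) auto
      moreover have "1 * k \<le> b * Suc (triangle k)"
        using ab le_triangle[of k] by (intro mult_le_mono) auto
      ultimately show ?thesis
        by (simp add: algebra_simps)
    qed
    then have "norm q ^ ((a * m + b) * Suc (triangle k)) \<le> norm q ^ (m + k)"
      using q by (intro power_decreasing) auto
    moreover have "norm z ^ m \<le> 1"
      using z by (simp add: power_le_one)
    ultimately have "norm z ^ m * ((2 * of_nat k + 1) * norm q ^ ((a * m + b) * Suc (triangle k)))
       \<le> 1 * ((2 * of_nat k + 1) * norm q ^ (m + k))"
      by (intro mult_mono) auto
    then show ?thesis
      unfolding f_def by (simp add: norm_mult norm_power norm_2k1 power_add[of "norm q" m] mult_ac)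
  qed
  have so: "summable (\<lambda>k. (2 * of_nat k + 1) * norm q ^ k)"
    using q by (intro summable_odd_powers) auto
  define C where "C = (\<Sum>k. (2 * of_nat k + 1) * norm q ^ k)"
  have "((\<lambda>k. (2 * of_nat k + 1) * norm q ^ k) has_sum C) UNIV"
    using norm_summable_imp_has_sum[of "\<lambda>k. (2 * of_nat k + 1) * norm q ^ k" C] so
    by (simp add: C_def summable_sums norm_2k1 abs_mult norm_power)
  then have "(\<lambda>(m, k). norm q ^ m * ((2 * of_nat k + 1) * norm q ^ k)) summable_on (UNIV \<times> UNIV)"
  proof (intro summable_on_SigmaI[where g = "\<lambda>m. norm q ^ m * C"], goal_cases)
    case (1 m)
    then show ?case
      by (auto intro: has_sum_cmult_right)
  next
    case 2
    have "C \<ge> 0"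
      unfolding C_def using so by (intro suminf_nonneg) auto
    then show ?case
      using q by (subst summable_on_UNIV_nonneg_real_iff) (auto intro!: summable_mult2 summable_geometric)
  qed auto
  then have "(\<lambda>x. norm ((\<lambda>(m, k). f m k) x)) summable_on (UNIV \<times> UNIV)"
    by (rule Infinite_Sum.abs_summable_on_comparison_test') (use bound in auto)
  then have so2: "(\<lambda>(m, k). f m k) summable_on (UNIV \<times> UNIV)"
    by (rule abs_summable_summable)
  have inner1: "infsum (f m) UNIV = z ^ m * q ^ (a * m + b) * Phi (q ^ (a * m + b)) ^ 3" for m
  proof -
    have qm: "norm (q ^ (a * m + b)) < 1"
      using q ab by (simp add: norm_power power_less_one_iff)
    note J = jacobi_Phi_cube[OF qm]
    have eq: "f m k = z ^ m * q ^ (a * m + b) * ((- 1) ^ k * (2 * of_nat k + 1) * (q ^ (a * m + b)) ^ triangle k)" for k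
      unfolding f_def power_mult power_Suc by (simp only: mult_ac)
    have "((\<lambda>k. (- 1) ^ k * (2 * of_nat k + 1) * (q ^ (a * m + b)) ^ triangle k) has_sum Phi (q ^ (a * m + b)) ^ 3) UNIV"
      using J by (intro norm_summable_imp_has_sum) (auto simp: summable_norm_cancel sums_iff)
    then show ?thesis
      unfolding eq by (intro infsumI has_sum_cmult_right)
  qed
  have inner2: "infsum (\<lambda>m. f m k) UNIV = lambert_term z a b q k" for k
  proof -
    let ?x = "z * q ^ (a * Suc (triangle k))"
    have x: "norm ?x < 1"
      using lambert_denominator(1)[OF q z, of "a * Suc (triangle k)"] ab q by simp
    have "q ^ ((a * m + b) * S) = q ^ (b * S) * (q ^ (a * S)) ^ m" for m S
    proof -
      have "(a * m + b) * S = b * S + a * S * m"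
        by (simp add: algebra_simps)
      then show ?thesis
        by (metis power_add power_mult)
    qed
    then have eq: "f m k = ((- 1) ^ k * (2 * of_nat k + 1) * q ^ (b * Suc (triangle k))) * ?x ^ m" for m
      by (simp only: f_def power_mult_distrib mult_ac)
    have "summable (\<lambda>m. norm (?x ^ m))"
      using x by (simp add: norm_power summable_geometric)
    then have "((\<lambda>m. ?x ^ m) has_sum (1 / (1 - ?x))) UNIV"
      using x by (intro norm_summable_imp_has_sum geometric_sums)
    then show ?thesis
      unfolding eq lambert_term_def by (subst infsumI[OF has_sum_cmult_right]) auto
  qed
  have "infsum (\<lambda>m. infsum (f m) UNIV) UNIV = infsum (\<lambda>k. infsum (\<lambda>m. f m k) UNIV) UNIV"
    by (rule infsum_swap_banach) (use so2 in simp)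
  then have *: "infsum (\<lambda>m. z ^ m * q ^ (a * m + b) * Phi (q ^ (a * m + b)) ^ 3) UNIV = infsum (lambert_term z a b q) UNIV"
    by (simp add: inner1 inner2)
  have 1: "(\<lambda>m. z ^ m * q ^ (a * m + b) * Phi (q ^ (a * m + b)) ^ 3) summable_on UNIV"
    using summable_on_Sigma_banach[OF so2] by (simp add: inner1)
  then show "summable (\<lambda>m. z ^ m * q ^ (a * m + b) * Phi (q ^ (a * m + b)) ^ 3)"
    by (rule summable_on_imp_summable)
  have "(\<lambda>(k, m). f m k) summable_on (UNIV \<times> UNIV)"
    using so2 by (subst product_swap[symmetric], subst summable_on_reindex) (auto simp: o_def case_prod_unfold inj_on_def)
  then have 2: "lambert_term z a b q summable_on UNIV"
    using summable_on_Sigma_banach[of "\<lambda>k m. f m k" UNIV "\<lambda>_. UNIV"] by (simp add: inner2)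
  show "(\<Sum>m. z ^ m * q ^ (a * m + b) * Phi (q ^ (a * m + b)) ^ 3) = (\<Sum>k. lambert_term z a b q k)"
    using * has_sum_imp_sums[OF has_sum_infsum[OF 1]] has_sum_imp_sums[OF has_sum_infsum[OF 2]]
    by (simp add: sums_iff)
qed

lemma lambert_holomorphic:
  assumes z: "norm z \<le> 1" and ab: "0 < a" "0 < b"
  shows "(\<lambda>q. \<Sum>k. lambert_term z a b q k) holomorphic_on ball (0::complex) 1"
proof (rule holomorphic_uniform_sequence[where f = "\<lambda>n q. \<Sum>k<n. lambert_term z a b q k"])
  show "(\<lambda>q. \<Sum>k<n. lambert_term z a b q k) holomorphic_on ball (0::complex) 1" for n
    unfolding lambert_term_def using lambert_denominator(3)[OF _ z] ab
    by (intro holomorphic_intros) auto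
  show "\<exists>d>0. cball x d \<subseteq> ball 0 1 \<and> uniform_limit (cball x d) (\<lambda>n q. \<Sum>k<n. lambert_term z a b q k)
      (\<lambda>q. \<Sum>k. lambert_term z a b q k) sequentially" if "x \<in> ball 0 1" for x :: complex
  proof (intro exI[of _ "(1 - norm x) / 2"] conjI)
    define r where "r = (1 + norm x) / 2"
    have r: "0 \<le> r" "r < 1" and sub: "norm q \<le> r" if "q \<in> cball x ((1 - norm x) / 2)" for q
      using that \<open>x \<in> ball 0 1\<close> norm_triangle_sub[of q x]
      by (auto simp: r_def dist_norm norm_minus_commute field_simps)
    have r: "0 \<le> r" "r < 1"
      using \<open>x \<in> ball 0 1\<close> by (auto simp: r_def)
    show "0 < (1 - norm x) / 2"
      using that by auto
    show "cball x ((1 - norm x) / 2) \<subseteq> ball 0 1"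
      using sub r by fastforce
    show "uniform_limit (cball x ((1 - norm x) / 2)) (\<lambda>n q. \<Sum>k<n. lambert_term z a b q k)
      (\<lambda>q. \<Sum>k. lambert_term z a b q k) sequentially"
      by (rule Weierstrass_m_test[where M = "\<lambda>k. (2 * of_nat k + 1) * r ^ k * (1 / (1 - r))"])
         (use norm_lambert_term_le[OF sub r(2) z ab] r in \<open>auto intro!: summable_mult2 summable_odd_powers\<close>)
  qed
qed auto

section \<open>The contour integral\<close>

text \<open>The contour integrand in the rescaled variable \<open>v = u / s\<close>: at \<open>v = (k + 1/2) / s\<close> with
  \<open>\<epsilon> = 7 / (4 s\<^sup>2)\<close> the phase equals \<open>t (k\<^sup>2 + k + 2) / 2\<close> where \<open>t = \<pi> / s\<^sup>2\<close>.\<close>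

definition phase :: "real \<Rightarrow> complex \<Rightarrow> complex" where
  "phase \<epsilon> v = of_real (pi / 2) * (v\<^sup>2 + of_real \<epsilon>)"

text \<open>The k-th Lambert term without its factor (-1)^k (2 k + 1), continued to complex
  arguments, with \<beta> = b / a. The values z = - 1 and z = 1 give the Fermi and the Bose
  denominator.\<close>

definition fermi :: "complex \<Rightarrow> real \<Rightarrow> real \<Rightarrow> complex \<Rightarrow> complex" where
  "fermi z \<beta> \<epsilon> v = exp (- (of_real \<beta> * phase \<epsilon> v)) / (1 - z * exp (- phase \<epsilon> v))"

text \<open>The factor 1 / cos has its poles at the half-integers divided by s and supplies the
  signs (-1)^k, while v supplies the weights 2 k + 1. Up to the factor pi, v is also the derivative
  of the phase, which keeps the residues at the remaining poles free of algebraic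
  prefactors.\<close>

definition kernel :: "complex \<Rightarrow> real \<Rightarrow> real \<Rightarrow> real \<Rightarrow> complex \<Rightarrow> complex" where
  "kernel z \<beta> \<epsilon> s v = v * exp (- (of_real \<beta> * phase \<epsilon> v)) /
     ((1 - z * exp (- phase \<epsilon> v)) * cos (of_real (pi * s) * v))"

section \<open>Bounds for the integrand on the horizontal lines\<close>

lemma phase_minus [simp]: "phase \<epsilon> (- v) = phase \<epsilon> v"
  by (simp add: phase_def)

lemma Re_phase: "Re (phase \<epsilon> v) = pi / 2 * ((Re v)\<^sup>2 - (Im v)\<^sup>2 + \<epsilon>)"
  by (simp add: phase_def power2_eq_square)

lemma Im_phase: "Im (phase \<epsilon> v) = pi * (Re v * Im v)"
  by (simp add: phase_def power2_eq_square)

lemma phase_eq_0_plus: "phase \<epsilon> v = phase 0 v + of_real (pi * \<epsilon> / 2)"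
  by (simp add: phase_def algebra_simps)

lemma norm_exp_phase: "norm (exp (- (of_real b * phase \<epsilon> v))) = exp (- (b * Re (phase \<epsilon> v)))"
  by (simp add: norm_exp_eq_Re)

text \<open>The denominator can vanish only where the exponential has modulus 1, which on this line
  means \<rho> = c or \<rho> = - c. There the phase is i pi c^2 or its negative, and the two
  hypotheses on z exclude both. Compactness gives a bound on a finite interval; beyond it the
  exponential is at most 1/2.\<close>

lemma denominator_lower_bound_line0:
  assumes z: "norm z = 1" and c: "c > 0" and zc: "z \<noteq> cis (pi * c\<^sup>2)" "z \<noteq> cis (- (pi * c\<^sup>2))"
  obtains \<delta> where "\<delta> > 0" "\<And>\<rho>. \<delta> \<le> norm (1 - z * exp (- phase 0 (Complex \<rho> c)))"
proof -
  define g where "g = (\<lambda>\<rho>. norm (1 - z * exp (- phase 0 (Complex \<rho> c))))"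
  have "continuous_on UNIV g"
    unfolding g_def phase_def Complex_eq by (intro continuous_intros)
  then have "continuous_on {- (c + 1)..c + 1} g"
    by (rule continuous_on_subset) auto
  then have "\<exists>\<rho>0\<in>{- (c + 1)..c + 1}. \<forall>\<rho>\<in>{- (c + 1)..c + 1}. g \<rho>0 \<le> g \<rho>"
    using c by (intro continuous_attains_inf) auto
  then obtain \<rho>0 where \<rho>0: "\<And>\<rho>. \<rho> \<in> {- (c + 1)..c + 1} \<Longrightarrow> g \<rho>0 \<le> g \<rho>"
    by blast
  have pos: "g \<rho> > 0" for \<rho>
  proof (rule ccontr)
    assume "\<not> g \<rho> > 0"
    then have eq: "1 = z * exp (- phase 0 (Complex \<rho> c))"
      by (simp add: g_def)
    then have "1 = norm (z * exp (- phase 0 (Complex \<rho> c)))"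
      by (metis norm_one)
    then have "Re (phase 0 (Complex \<rho> c)) = 0"
      using z by (simp add: norm_mult norm_exp_eq_Re)
    then have "\<rho>\<^sup>2 = c\<^sup>2"
      by (simp add: Re_phase)
    then have "\<rho> = c \<or> \<rho> = - c"
      by (simp add: power2_eq_iff)
    moreover have "z = exp (phase 0 (Complex \<rho> c))"
      using eq by (simp add: exp_minus field_simps)
    then have "z = cis (pi * (\<rho> * c))"
      using \<open>Re (phase 0 (Complex \<rho> c)) = 0\<close> by (simp add: exp_eq_polar Im_phase)
    ultimately show False
      using zc by (auto simp: power2_eq_square)
  qed
  have "1 / 2 \<le> g \<rho>" if "\<rho> \<notin> {- (c + 1)..c + 1}" for \<rho>
  proof -
    have "c + 1 \<le> \<bar>\<rho>\<bar>"
      using that by auto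
    then have "(c + 1)\<^sup>2 \<le> \<rho>\<^sup>2"
      using c by (simp add: abs_le_square_iff[symmetric])
    moreover have "c\<^sup>2 + 1 \<le> (c + 1)\<^sup>2"
      using c by (simp add: power2_eq_square algebra_simps)
    ultimately have "1 \<le> \<rho>\<^sup>2 - c\<^sup>2"
      by linarith
    then have "pi / 2 * 1 \<le> pi / 2 * (\<rho>\<^sup>2 - c\<^sup>2 + 0)"
      by (intro mult_left_mono) auto
    moreover have "1 \<le> pi / 2 * 1"
      using pi_gt3 by linarith
    ultimately have "1 \<le> pi / 2 * (\<rho>\<^sup>2 - c\<^sup>2 + 0)"
      by (rule order_trans[rotated])
    then have "1 \<le> Re (phase 0 (Complex \<rho> c))"
      by (simp only: Re_phase complex.sel)
    then have "norm (z * exp (- phase 0 (Complex \<rho> c))) \<le> exp (- 1)"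
      using z by (simp add: norm_mult norm_exp_eq_Re)
    also have "exp (- 1 :: real) \<le> 1 / 2"
      using exp_ge_add_one_self[of "1::real"] by (simp add: exp_minus field_simps)
    finally have "norm (z * exp (- phase 0 (Complex \<rho> c))) \<le> 1 / 2" .
    then show ?thesis
      using norm_triangle_ineq2[of 1 "z * exp (- phase 0 (Complex \<rho> c))"] by (simp add: g_def)
  qed
  then have "min (1 / 2) (g \<rho>0) \<le> g \<rho>" for \<rho>
    using \<rho>0[of \<rho>] by fastforce
  then show ?thesis
    using pos[of \<rho>0] that[of "min (1 / 2) (g \<rho>0)"] by (simp add: g_def)
qed

text \<open>The bound has to be uniform in \<epsilon>, because \<epsilon> = 7 / (4 s^2) varies with
  s. A shift by \<epsilon> divides the exponential by a real number E close to 1, which costs little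
  of the bound at \<epsilon> = 0. The lower line is covered because the phase is even.\<close>

lemma denominator_lower_bound_line:
  assumes "norm z = 1" "c > 0" "z \<noteq> cis (pi * c\<^sup>2)" "z \<noteq> cis (- (pi * c\<^sup>2))"
  obtains \<delta> \<epsilon>0 where "\<delta> > 0" "\<epsilon>0 > 0"
    "\<And>\<epsilon> v. 0 \<le> \<epsilon> \<Longrightarrow> \<epsilon> \<le> \<epsilon>0 \<Longrightarrow> \<bar>Im v\<bar> = c \<Longrightarrow> \<delta> \<le> norm (1 - z * exp (- phase \<epsilon> v))"
proof -
  obtain d where d: "d > 0" "\<And>\<rho>. d \<le> norm (1 - z * exp (- phase 0 (Complex \<rho> c)))"
    using denominator_lower_bound_line0[OF assms] by blast
  \<comment> \<open>Chosen so that E = exp (pi \<epsilon> / 2) is at most 1 + d / 2 for \<epsilon>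
    up to \<open>\<epsilon>0\<close>.\<close>
  define \<epsilon>0 where "\<epsilon>0 = 2 / pi * ln (1 + d / 2)"
  have d0: "d \<le> norm (1 - z * exp (- phase 0 v))" if v: "\<bar>Im v\<bar> = c" for v
  proof (cases "Im v = c")
    case True
    then show ?thesis
      using d(2)[of "Re v"] by (metis complex_surj)
  next
    case False
    then have "Im (- v) = c"
      using v by auto
    then show ?thesis
      using d(2)[of "Re (- v)"] phase_minus[of 0 v] by (metis complex_surj)
  qed
  show ?thesis
  proof
    show "d / 2 / (1 + d / 2) > 0" "\<epsilon>0 > 0"
      using d(1) by (simp_all add: \<epsilon>0_def)
    fix \<epsilon> v
    assume \<epsilon>: "0 \<le> \<epsilon>" "\<epsilon> \<le> \<epsilon>0" and v: "\<bar>Im v\<bar> = c"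
    define E where "E = exp (pi * \<epsilon> / 2)"
    have "pi * \<epsilon> / 2 \<le> ln (1 + d / 2)"
      using \<epsilon>(2) by (simp add: \<epsilon>0_def field_simps)
    then have "E \<le> exp (ln (1 + d / 2))"
      unfolding E_def by simp
    then have E: "1 \<le> E" "E \<le> 1 + d / 2"
      using d(1) \<epsilon>(1) by (auto simp: E_def)
    have "exp (- phase \<epsilon> v) = exp (- phase 0 v) / of_real E"
      by (simp only: phase_eq_0_plus[of \<epsilon> v] E_def exp_of_real[symmetric] minus_add_distrib exp_add exp_minus divide_inverse)
    then have "1 - z * exp (- phase \<epsilon> v) = (of_real E - z * exp (- phase 0 v)) / of_real E"
      using E by (simp add: diff_divide_distrib)
    then have eq: "norm (1 - z * exp (- phase \<epsilon> v)) = norm (of_real E - z * exp (- phase 0 v)) / E"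
      using E by (simp add: norm_divide)
    have "norm (1 - z * exp (- phase 0 v)) \<le> norm (of_real E - z * exp (- phase 0 v)) + norm (of_real (E - 1) :: complex)"
      by (rule order_trans[OF _ norm_triangle_ineq4]) (simp add: algebra_simps)
    then have "d \<le> norm (of_real E - z * exp (- phase 0 v)) + (E - 1)"
      using d0[OF v] E unfolding norm_of_real by linarith
    then have "d / 2 \<le> norm (of_real E - z * exp (- phase 0 v))"
      using E(2) by linarith
    then show "d / 2 / (1 + d / 2) \<le> norm (1 - z * exp (- phase \<epsilon> v))"
      unfolding eq using E d(1) by (intro frac_le) auto
  qed
qed

text \<open>The Gaussian decay of the exponential along the line absorbs the factor v. A larger
  \<epsilon> only shrinks the exponential, which makes the bound uniform.\<close>

lemma numerator_bound_line:
  assumes "c > 0" "\<beta> > 0"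
  obtains B where "B > 0"
    "\<And>\<epsilon> v. 0 \<le> \<epsilon> \<Longrightarrow> \<bar>Im v\<bar> = c \<Longrightarrow> norm (v * exp (- (of_real \<beta> * phase \<epsilon> v))) \<le> B / (1 + (Re v)\<^sup>2)"
proof -
  define b where "b = \<beta> * pi / 2"
  have "b > 0"
    using assms by (simp add: b_def)
  \<comment> \<open>With this m one has m (1 + x) <= 1 + b x / 2 <= exp (b x / 2). Squaring produces
    two powers of 1 + x, one of which pays for the norm of v.\<close>
  define m where "m = min 1 (b / 2)"
  have m: "0 < m" "m \<le> 1" "m \<le> b / 2"
    using \<open>b > 0\<close> by (auto simp: m_def)
  define B where "B = (c + 1) * exp (b * c\<^sup>2) / m\<^sup>2"
  show ?thesis
  proof
    show "B > 0"
      using assms m by (simp add: B_def)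
    fix \<epsilon> :: real and v :: complex
    assume \<epsilon>: "0 \<le> \<epsilon>" and v: "\<bar>Im v\<bar> = c"
    define x where "x = (Re v)\<^sup>2"
    have "x \<ge> 0"
      by (simp add: x_def)
    have "m * (1 + x) \<le> 1 + b / 2 * x"
      using m \<open>x \<ge> 0\<close> mult_right_mono[of m "b / 2" x] by (simp add: distrib_left)
    also have "\<dots> \<le> exp (b / 2 * x)"
      using exp_ge_add_one_self by simp
    finally have "(m * (1 + x))\<^sup>2 \<le> (exp (b / 2 * x))\<^sup>2"
      using m \<open>x \<ge> 0\<close> by (intro power_mono) auto
    then have *: "m\<^sup>2 * (1 + x)\<^sup>2 \<le> exp (b * x)"
      by (simp add: power_mult_distrib flip: exp_double)
    have "norm v \<le> \<bar>Re v\<bar> + c"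
      using cmod_le[of v] v by simp
    moreover have "\<bar>Re v\<bar> \<le> 1 + x"
      unfolding x_def using sum_squares_ge_zero[of "\<bar>Re v\<bar> - 1" 0]
      by (simp add: power2_eq_square algebra_simps)
    moreover have "c \<le> c * (1 + x)"
      using assms \<open>x \<ge> 0\<close> by simp
    ultimately have n: "norm v \<le> (c + 1) * (1 + x)"
      by (simp add: algebra_simps)
    have v2: "(Im v)\<^sup>2 = c\<^sup>2"
      using v by (metis power2_abs)
    have "\<beta> * Re (phase \<epsilon> v) = b * x - b * c\<^sup>2 + b * \<epsilon>"
      by (simp add: Re_phase b_def x_def v2 algebra_simps)
    then have "exp (- (\<beta> * Re (phase \<epsilon> v))) \<le> exp (b * c\<^sup>2 - b * x)"
      using \<epsilon> \<open>b > 0\<close> by simp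
    also have "\<dots> = exp (b * c\<^sup>2) / exp (b * x)"
      by (simp add: exp_diff)
    also have "\<dots> \<le> exp (b * c\<^sup>2) / (m\<^sup>2 * (1 + x)\<^sup>2)"
      using * m \<open>x \<ge> 0\<close> by (intro divide_left_mono) auto
    finally have "norm (v * exp (- (of_real \<beta> * phase \<epsilon> v))) \<le> (c + 1) * (1 + x) * (exp (b * c\<^sup>2) / (m\<^sup>2 * (1 + x)\<^sup>2))"
      unfolding norm_mult norm_exp_phase using n assms \<open>x \<ge> 0\<close> by (intro mult_mono) simp_all
    also have "\<dots> = B / (1 + x)"
      using m \<open>x \<ge> 0\<close> by (simp add: B_def power2_eq_square divide_simps)
    finally show "norm (v * exp (- (of_real \<beta> * phase \<epsilon> v))) \<le> B / (1 + (Re v)\<^sup>2)"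
      by (simp add: x_def)
  qed
qed

lemma norm_cos_ge_sinh: "\<bar>sinh (Im z)\<bar> \<le> norm (cos z)" for z :: complex
proof -
  have "(sinh (Im z))\<^sup>2 \<le> (norm (cos z))\<^sup>2"
    unfolding norm_cos_squared by (simp add: sinh_field_def exp_minus power_divide)
  then show ?thesis
    by (metis abs_le_square_iff abs_norm_cancel)
qed

lemma norm_cos_ge_exp:
  fixes z :: complex
  assumes "1 \<le> \<bar>Im z\<bar>"
  shows "exp \<bar>Im z\<bar> / 4 \<le> norm (cos z)"
proof -
  define e where "e = exp \<bar>Im z\<bar>"
  have "2 \<le> e"
    using exp_ge_add_one_self[of "\<bar>Im z\<bar>"] assms unfolding e_def by linarith
  then have "2 * 2 \<le> e * e"
    by (intro mult_mono) auto
  then have "e / 4 \<le> (e - inverse e) / 2"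
    using \<open>2 \<le> e\<close> by (simp add: field_simps)
  then have "exp \<bar>Im z\<bar> / 4 \<le> sinh \<bar>Im z\<bar>"
    by (simp add: sinh_field_def exp_minus e_def)
  also have "\<dots> = \<bar>sinh (Im z)\<bar>"
    by (auto simp: abs_if)
  finally show ?thesis
    using norm_cos_ge_sinh[of z] by linarith
qed

text \<open>A bound by length times supremum would grow with X. Integrating 1 / (1 + \<rho>^2) to an
  arctangent gives a constant free of X, so that the width of the rectangle can be sent to
  infinity.\<close>

lemma norm_contour_integral_horizontal_le:
  assumes X: "0 < X" and A: "0 \<le> A"
    and f: "f contour_integrable_on linepath (Complex (- X) y) (Complex X y)"
    and bound: "\<And>\<rho>. \<bar>\<rho>\<bar> \<le> X \<Longrightarrow> norm (f (Complex \<rho> y)) \<le> A / (1 + \<rho>\<^sup>2)"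
  shows "norm (contour_integral (linepath (Complex (- X) y) (Complex X y)) f) \<le> A * pi"
proof -
  define \<rho> where "\<rho> = (\<lambda>u::real. (2 * u - 1) * X)"
  let ?p = "linepath (Complex (- X) y) (Complex X y)"
  have p: "?p u = Complex (\<rho> u) y" "Complex X y - Complex (- X) y = of_real (2 * X)" for u
    by (auto simp: linepath_def \<rho>_def complex_eq_iff algebra_simps)
  have I: "((\<lambda>u. f (?p u) * of_real (2 * X)) has_integral contour_integral ?p f) {0..1}"
    using has_contour_integral_integral[OF f] by (simp add: has_contour_integral_linepath p(2))
  have J: "((\<lambda>u. A / (1 + (\<rho> u)\<^sup>2) * (2 * X)) has_integral (A * arctan (\<rho> 1) - A * arctan (\<rho> 0))) {0..1}"
  proof (rule fundamental_theorem_of_calculus)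
    fix u :: real
    have "((\<lambda>u. A * arctan ((2 * u - 1) * X)) has_real_derivative A * (inverse (1 + ((2 * u - 1) * X)\<^sup>2) * (2 * X))) (at u within {0..1})"
      by (rule derivative_eq_intros refl | simp)+
    then show "((\<lambda>u. A * arctan (\<rho> u)) has_vector_derivative A / (1 + (\<rho> u)\<^sup>2) * (2 * X)) (at u within {0..1})"
      unfolding \<rho>_def has_real_derivative_iff_has_vector_derivative[symmetric] by (simp add: divide_inverse mult_ac)
  qed auto
  have "norm (integral {0..1} (\<lambda>u. f (?p u) * of_real (2 * X))) \<le> integral {0..1} (\<lambda>u. A / (1 + (\<rho> u)\<^sup>2) * (2 * X))"
  proof (rule integral_norm_bound_integral)
    fix u :: real
    assume "u \<in> {0..1}"
    then have "\<bar>2 * u - 1\<bar> * X \<le> 1 * X"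
      using X by (intro mult_right_mono) auto
    then have "\<bar>\<rho> u\<bar> \<le> X"
      using X by (simp add: \<rho>_def abs_mult)
    then have "norm (f (?p u)) * (2 * X) \<le> A / (1 + (\<rho> u)\<^sup>2) * (2 * X)"
      unfolding p using X bound by (intro mult_right_mono) auto
    then show "norm (f (?p u) * of_real (2 * X)) \<le> A / (1 + (\<rho> u)\<^sup>2) * (2 * X)"
      using X by (simp add: norm_mult)
  qed (rule has_integral_integrable[OF I] has_integral_integrable[OF J])+
  then have "norm (contour_integral ?p f) \<le> A * arctan (\<rho> 1) - A * arctan (\<rho> 0)"
    using integral_unique[OF I] integral_unique[OF J] by simp
  also have "\<dots> = A * (2 * arctan X)"
    by (simp add: \<rho>_def arctan_minus)
  also have "2 * arctan X \<le> pi"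
    using arctan_ubound[of X] by linarith
  then have "A * (2 * arctan X) \<le> A * pi"
    using A by (rule mult_left_mono)
  finally show ?thesis .
qed

section \<open>Poles and residues of the kernel\<close>

lemma phase_has_field_derivative: "(phase \<epsilon> has_field_derivative of_real pi * v) (at v)"
  unfolding phase_def[abs_def] by (rule derivative_eq_intros refl | simp)+

lemma cos_half_integer: "cos (pi * (real k + 1 / 2)) = 0"
  and sin_half_integer: "sin (pi * (real k + 1 / 2)) = (- 1) ^ k"
  by (simp_all add: distrib_left cos_add sin_add mult.commute[of pi])

lemma cos_nonzero_off_axis:
  assumes "Im v \<noteq> 0" "0 < s"
  shows "cos (of_real (pi * s) * v) \<noteq> 0"
proof
  assume "cos (of_real (pi * s) * v) = 0"
  then have "\<bar>sinh (Im (of_real (pi * s) * v))\<bar> \<le> 0"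
    using norm_cos_ge_sinh[of "of_real (pi * s) * v"] by simp
  then show False
    using assms by simp
qed

text \<open>The square of p has the negative real part - \<epsilon>. Since the zeros of the cosine
  are real, the two families of poles never meet and all poles of the kernel are simple.\<close>

lemma pole_off_axis:
  assumes "p\<^sup>2 = 2 * \<i> * of_real \<mu> - of_real \<epsilon>" "0 < \<epsilon>"
  shows "Im p \<noteq> 0"
proof
  assume "Im p = 0"
  then have "Re (p\<^sup>2) = (Re p)\<^sup>2"
    by (simp add: power2_eq_square)
  with assms show False
    by (simp add: add_nonneg_eq_0_iff) (metis add.inverse_neutral neg_less_0_iff_less not_less zero_le_power2)
qed

lemma phase_at_pole:
  assumes "p\<^sup>2 = 2 * \<i> * of_real \<mu> - of_real \<epsilon>"
  shows "phase \<epsilon> p = \<i> * of_real (pi * \<mu>)"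
  unfolding phase_def assms by simp

context
  fixes z :: complex and \<beta> \<epsilon> s :: real
  assumes z: "norm z = 1" and \<epsilon>: "\<epsilon> > 0" and s: "s > 0"
begin

abbreviation "den v \<equiv> (1 - z * exp (- phase \<epsilon> v)) * cos (of_real (pi * s) * v)"

lemma den_has_field_derivative:
  "(den has_field_derivative (z * exp (- phase \<epsilon> v) * (of_real pi * v) * cos (of_real (pi * s) * v)
     - (1 - z * exp (- phase \<epsilon> v)) * (sin (of_real (pi * s) * v) * of_real (pi * s)))) (at v)"
  by (rule derivative_eq_intros phase_has_field_derivative refl | simp)+

lemma den_holomorphic: "den holomorphic_on A"
  unfolding phase_def by (intro holomorphic_intros)

lemma residue_kernel:
  assumes "den p = 0" "p \<noteq> 0"
    and d: "d = z * exp (- phase \<epsilon> p) * (of_real pi * p) * cos (of_real (pi * s) * p)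
     - (1 - z * exp (- phase \<epsilon> p)) * (sin (of_real (pi * s) * p) * of_real (pi * s))" "d \<noteq> 0"
  shows "residue (kernel z \<beta> \<epsilon> s) p = p * exp (- (of_real \<beta> * phase \<epsilon> p)) / d"
  unfolding kernel_def[abs_def]
proof (rule residue_simple_pole_deriv)
  show "(\<lambda>v. v * exp (- (of_real \<beta> * phase \<epsilon> v))) holomorphic_on UNIV"
    unfolding phase_def by (intro holomorphic_intros)
  show "(den has_field_derivative d) (at p)"
    unfolding d by (rule den_has_field_derivative)
  show "den holomorphic_on UNIV"
    by (rule den_holomorphic)
qed (use assms in auto)

lemma Re_phase_real_pos:
  assumes "Im v = 0"
  shows "Re (phase \<epsilon> v) > 0"
proof -
  have "(Re v)\<^sup>2 + \<epsilon> > 0"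
    using \<epsilon> by (simp add: add_nonneg_pos)
  then show ?thesis
    using assms by (simp add: Re_phase)
qed

lemma fermi_denominator_nonzero:
  assumes "Re (phase \<epsilon> v) > 0"
  shows "1 - z * exp (- phase \<epsilon> v) \<noteq> 0"
proof
  assume "1 - z * exp (- phase \<epsilon> v) = 0"
  then have "1 = z * exp (- phase \<epsilon> v)"
    by simp
  then have "1 = norm (z * exp (- phase \<epsilon> v))"
    by (metis norm_one)
  with z assms show False
    by (simp add: norm_mult norm_exp_eq_Re)
qed

lemma half_integer_residue_eq:
  fixes \<sigma> D :: complex
  assumes "\<sigma> * \<sigma> = 1" "D \<noteq> 0"
  shows "K / of_real s * E / (D * (\<sigma> * of_real (pi * s))) = \<sigma> * K * (E / D) / of_real (pi * s\<^sup>2)"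
proof -
  have "\<sigma> \<noteq> 0" "inverse \<sigma> = \<sigma>"
    using assms(1) by (auto intro: inverse_unique)
  then show ?thesis
    using assms(2) s by (simp add: divide_inverse power2_eq_square mult_ac)
qed

text \<open>The kernel is odd, so its residues at p and - p agree, and every k is counted twice in
  the contour integral.\<close>

lemma half_integer_pole:
  fixes k :: nat
  defines "p \<equiv> complex_of_real ((real k + 1 / 2) / s)"
  shows "den p = 0" "den (- p) = 0"
    and "residue (kernel z \<beta> \<epsilon> s) p = - ((- 1) ^ k * (of_nat k + 1 / 2) * fermi z \<beta> \<epsilon> p) / of_real (pi * s\<^sup>2)"
    and "residue (kernel z \<beta> \<epsilon> s) (- p) = - ((- 1) ^ k * (of_nat k + 1 / 2) * fermi z \<beta> \<epsilon> p) / of_real (pi * s\<^sup>2)"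
proof -
  have sp: "of_real (pi * s) * p = of_real (pi * (real k + 1 / 2))"
    using s by (simp add: p_def)
  have cos0: "cos (of_real (pi * s) * p) = 0"
    unfolding sp cos_of_real cos_half_integer by simp
  have sin1: "sin (of_real (pi * s) * p) = (- 1) ^ k"
    unfolding sp sin_of_real sin_half_integer by simp
  show den0: "den p = 0" "den (- p) = 0"
    using cos0 by simp_all
  have nz: "1 - z * exp (- phase \<epsilon> p) \<noteq> 0"
    by (intro fermi_denominator_nonzero Re_phase_real_pos) (simp add: p_def)
  have p: "p \<noteq> 0" "p = (of_nat k + 1 / 2) / of_real s"
    using s by (auto simp: p_def complex_eq_iff)
  have k: "(- 1) ^ k * (- 1) ^ k = (1 :: complex)"
    by (simp flip: power_mult_distrib)
  have key: "p * exp (- (of_real \<beta> * phase \<epsilon> p)) / ((1 - z * exp (- phase \<epsilon> p)) * ((- 1) ^ k * of_real (pi * s)))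
      = (- 1) ^ k * (of_nat k + 1 / 2) * fermi z \<beta> \<epsilon> p / of_real (pi * s\<^sup>2)"
    using half_integer_residue_eq[OF k nz, of "of_nat k + 1 / 2"] by (simp only: fermi_def flip: p(2))
  have "residue (kernel z \<beta> \<epsilon> s) p = p * exp (- (of_real \<beta> * phase \<epsilon> p)) /
    (- (1 - z * exp (- phase \<epsilon> p)) * ((- 1) ^ k * of_real (pi * s)))"
  proof (rule residue_kernel)
    show "- (1 - z * exp (- phase \<epsilon> p)) * ((- 1) ^ k * of_real (pi * s)) =
        z * exp (- phase \<epsilon> p) * (of_real pi * p) * cos (of_real (pi * s) * p)
        - (1 - z * exp (- phase \<epsilon> p)) * (sin (of_real (pi * s) * p) * of_real (pi * s))"
      unfolding cos0 sin1 by (simp add: algebra_simps)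
  qed (use p nz s den0 in auto)
  also have "\<dots> = - ((- 1) ^ k * (of_nat k + 1 / 2) * fermi z \<beta> \<epsilon> p) / of_real (pi * s\<^sup>2)"
    by (simp only: mult_minus_left mult_minus_right divide_minus_right minus_divide_left[symmetric] key)
  finally show "residue (kernel z \<beta> \<epsilon> s) p = \<dots>" .
  have "residue (kernel z \<beta> \<epsilon> s) (- p) = (- p) * exp (- (of_real \<beta> * phase \<epsilon> (- p))) /
    ((1 - z * exp (- phase \<epsilon> (- p))) * ((- 1) ^ k * of_real (pi * s)))"
  proof (rule residue_kernel)
    show "(1 - z * exp (- phase \<epsilon> (- p))) * ((- 1) ^ k * of_real (pi * s)) =
        z * exp (- phase \<epsilon> (- p)) * (of_real pi * (- p)) * cos (of_real (pi * s) * (- p))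
        - (1 - z * exp (- phase \<epsilon> (- p))) * (sin (of_real (pi * s) * (- p)) * of_real (pi * s))"
      unfolding mult_minus_right cos_minus sin_minus cos0 sin1 by simp
  qed (use p nz s den0 in auto)
  also have "\<dots> = - ((- 1) ^ k * (of_nat k + 1 / 2) * fermi z \<beta> \<epsilon> p) / of_real (pi * s\<^sup>2)"
    by (simp only: phase_minus mult_minus_left minus_divide_left[symmetric] key)
  finally show "residue (kernel z \<beta> \<epsilon> s) (- p) = \<dots>" .
qed

text \<open>At such a point z exp (- phase) = 1, so the derivative of the denominator is pi p times
  the cosine, and p cancels against the numerator. The parameter \<beta> survives only in the phase
  factor.\<close>

lemma fermi_pole:
  assumes p: "p\<^sup>2 = 2 * \<i> * of_real \<mu> - of_real \<epsilon>" and \<mu>: "cis (pi * \<mu>) = z"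
  shows "den p = 0"
    and "residue (kernel z \<beta> \<epsilon> s) p = cis (- (pi * \<beta> * \<mu>)) / (of_real pi * cos (of_real (pi * s) * p))"
proof -
  have ph: "phase \<epsilon> p = \<i> * of_real (pi * \<mu>)"
    by (rule phase_at_pole[OF p])
  have e: "z * exp (- phase \<epsilon> p) = 1"
    unfolding ph \<mu>[symmetric] cis_conv_exp by (simp add: exp_minus)
  show den0: "den p = 0"
    by (simp add: e)
  have nz: "p \<noteq> 0" "cos (of_real (pi * s) * p) \<noteq> 0"
    using pole_off_axis[OF p \<epsilon>] cos_nonzero_off_axis[OF _ s, of p] by auto
  have "residue (kernel z \<beta> \<epsilon> s) p = p * exp (- (of_real \<beta> * phase \<epsilon> p)) / (of_real pi * p * cos (of_real (pi * s) * p))"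
    by (rule residue_kernel) (use den0 nz in \<open>simp_all add: e\<close>)
  also have "\<dots> = exp (- (of_real \<beta> * phase \<epsilon> p)) / (of_real pi * cos (of_real (pi * s) * p))"
    using nz by simp
  also have "exp (- (of_real \<beta> * phase \<epsilon> p)) = cis (- (pi * \<beta> * \<mu>))"
    unfolding ph cis_conv_exp by (simp add: mult_ac)
  finally show "residue (kernel z \<beta> \<epsilon> s) p = cis (- (pi * \<beta> * \<mu>)) / (of_real pi * cos (of_real (pi * s) * p))" .
qed

text \<open>Because z has modulus 1, a zero forces the phase to be purely imaginary; \<mu> is its
  imaginary part divided by pi.\<close>

lemma fermi_poleE:
  assumes "1 - z * exp (- phase \<epsilon> p) = 0"
  obtains \<mu> where "cis (pi * \<mu>) = z" "p\<^sup>2 = 2 * \<i> * of_real \<mu> - of_real \<epsilon>"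
proof -
  have "Re (phase \<epsilon> p) = 0"
  proof -
    have "1 = norm (z * exp (- phase \<epsilon> p))"
      using assms by (metis eq_iff_diff_eq_0 norm_one)
    then show ?thesis
      using z by (simp add: norm_mult norm_exp_eq_Re)
  qed
  define \<mu> where "\<mu> = Im (phase \<epsilon> p) / pi"
  have ph: "phase \<epsilon> p = \<i> * of_real (pi * \<mu>)"
    using \<open>Re (phase \<epsilon> p) = 0\<close> by (simp add: \<mu>_def complex_eq_iff)
  have "z = exp (phase \<epsilon> p)"
    using assms by (simp add: exp_minus field_simps)
  then have "cis (pi * \<mu>) = z"
    by (simp add: ph cis_conv_exp)
  moreover have "p\<^sup>2 + of_real \<epsilon> = 2 * \<i> * of_real \<mu>"
    using ph by (simp add: phase_def)
  ultimately show ?thesis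
    using that[of \<mu>] by (simp add: algebra_simps)
qed

text \<open>The half-width X = N / s places the vertical sides midway between consecutive zeros of
  the cosine, so that exactly the half-integers with k < N are enclosed. By \<open>inside\<close>
  and \<open>complete\<close>, M lists the indices of the other poles in the strip.\<close>

theorem contour_integral_kernel:
  fixes N :: nat and c :: real and M :: "real set"
  defines "X \<equiv> real N / s"
  assumes c: "0 < c" "c < X" and line: "\<And>v. \<bar>Im v\<bar> = c \<Longrightarrow> 1 - z * exp (- phase \<epsilon> v) \<noteq> 0"
    and M: "finite M" "\<And>\<mu>. \<mu> \<in> M \<Longrightarrow> cis (pi * \<mu>) = z"
    and inside: "\<And>\<mu>. \<mu> \<in> M \<Longrightarrow> \<bar>Im (csqrt (2 * \<i> * of_real \<mu> - of_real \<epsilon>))\<bar> < c"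
    and complete: "\<And>p \<mu>. cis (pi * \<mu>) = z \<Longrightarrow> p\<^sup>2 = 2 * \<i> * of_real \<mu> - of_real \<epsilon> \<Longrightarrow> \<bar>Im p\<bar> < c \<Longrightarrow> \<mu> \<in> M"
  shows "path_image (rectpath (Complex (- X) (- c)) (Complex X c)) \<inter> {v. den v = 0} = {}" (is ?A)
    and "contour_integral (rectpath (Complex (- X) (- c)) (Complex X c)) (kernel z \<beta> \<epsilon> s) =
      2 * \<i> / of_real (s\<^sup>2) * (2 * of_real (s\<^sup>2) *
        (\<Sum>\<mu>\<in>M. cis (- (pi * \<beta> * \<mu>)) / cos (of_real (pi * s) * csqrt (2 * \<i> * of_real \<mu> - of_real \<epsilon>)))
        - (\<Sum>k<N. (- 1) ^ k * (2 * of_nat k + 1) * fermi z \<beta> \<epsilon> (of_real ((real k + 1 / 2) / s))))" (is ?B)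
proof -
  let ?a = "Complex (- X) (- c)" and ?b = "Complex X c"
  define r where "r = (\<lambda>\<mu>. csqrt (2 * \<i> * of_real \<mu> - of_real \<epsilon>))"
  define e where "e = (\<lambda>k::nat. complex_of_real ((real k + 1 / 2) / s))"
  have r2: "(r \<mu>)\<^sup>2 = 2 * \<i> * of_real \<mu> - of_real \<epsilon>" "(- r \<mu>)\<^sup>2 = 2 * \<i> * of_real \<mu> - of_real \<epsilon>" for \<mu>
    by (simp_all add: r_def)
  have X: "X > 0"
    using c by linarith
  \<comment> \<open>The real part of a pole is smaller in modulus than its imaginary part, hence
    below c < X: a pole in the strip is also inside the rectangle.\<close>
  have Re_small: "\<bar>Re p\<bar> < X" if "p\<^sup>2 = 2 * \<i> * of_real \<mu> - of_real \<epsilon>" "\<bar>Im p\<bar> < c" for p \<mu>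
  proof -
    have "Re (p\<^sup>2) = - \<epsilon>"
      by (simp add: that(1))
    then have "(Re p)\<^sup>2 < (Im p)\<^sup>2"
      using \<epsilon> by (simp add: power2_eq_square)
    also have "\<dots> < c\<^sup>2"
      using power_strict_mono[OF that(2), of 2] by simp
    finally show ?thesis
      using c power2_less_imp_less[of "\<bar>Re p\<bar>" c] by simp
  qed
  have cos_zero: "\<exists>k. v = e k \<or> v = - e k" if cos0: "cos (of_real (pi * s) * v) = 0" for v
  proof -
    obtain n :: int where "of_real (pi * s) * v = of_real (n * pi) + of_real pi / 2"
      using cos0 unfolding cos_eq_0 by blast
    moreover have "complex_of_real (pi * s * ((real_of_int n + 1 / 2) / s)) = of_real (real_of_int n * pi + pi / 2)"
      by (rule arg_cong) (use s in \<open>simp add: field_simps\<close>)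
    ultimately have "of_real (pi * s) * v = of_real (pi * s) * of_real ((real_of_int n + 1 / 2) / s)"
      by (simp only: of_real_mult of_real_add of_real_divide of_real_numeral)
    then have v: "v = of_real ((real_of_int n + 1 / 2) / s)"
      using s by (metis mult_left_cancel mult_pos_pos of_real_eq_0_iff order_less_irrefl pi_gt_zero)
    show ?thesis
    proof (cases "n \<ge> 0")
      case True
      then have "v = e (nat n)"
        unfolding v e_def by simp
      then show ?thesis by blast
    next
      case False
      then have "real_of_int n + 1 / 2 = - (real (nat (- n - 1)) + 1 / 2)"
        by simp
      then have "v = - e (nat (- n - 1))"
        unfolding v e_def by (simp only: minus_divide_left[symmetric] of_real_minus)
      then show ?thesis by blast
    qed
  qed
  have den_zero: "(\<exists>k. v = e k \<or> v = - e k) \<or> (\<exists>\<mu>. cis (pi * \<mu>) = z \<and> v\<^sup>2 = 2 * \<i> * of_real \<mu> - of_real \<epsilon>)"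
    if "den v = 0" for v
    using that cos_zero fermi_poleE[of v] by (metis mult_eq_0_iff)
  define P where "P = e ` {..<N} \<union> (\<lambda>k. - e k) ` {..<N} \<union> (r ` M \<union> (\<lambda>\<mu>. - r \<mu>) ` M)"
  have P_den: "den p = 0" if "p \<in> P" for p
    using that half_integer_pole(1,2) fermi_pole(1)[OF r2(1)] fermi_pole(1)[OF r2(2)] M(2)
    unfolding P_def e_def by blast
  have P_box: "p \<in> box ?a ?b" if "p \<in> P" for p
  proof -
    have "e k \<in> box ?a ?b" "- e k \<in> box ?a ?b" if "k < N" for k
    proof -
      define y where "y = (real k + 1 / 2) / s"
      have "0 < y"
        using s by (simp add: y_def)
      moreover have "y < X"
        unfolding y_def X_def using s that by (intro divide_strict_right_mono) auto
      ultimately show "e k \<in> box ?a ?b" "- e k \<in> box ?a ?b"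
        using c by (simp_all add: in_box_complex_iff e_def flip: y_def)
    qed
    moreover have "r \<mu> \<in> box ?a ?b" "- r \<mu> \<in> box ?a ?b" if "\<mu> \<in> M" for \<mu>
    proof -
      have "\<bar>Im (r \<mu>)\<bar> < c"
        unfolding r_def by (rule inside[OF that])
      moreover from Re_small[OF r2(1) this] have "\<bar>Re (r \<mu>)\<bar> < X" .
      ultimately show "r \<mu> \<in> box ?a ?b" "- r \<mu> \<in> box ?a ?b"
        by (simp_all add: in_box_complex_iff abs_less_iff)
    qed
    ultimately show ?thesis
      using that by (auto simp: P_def)
  qed
  have cbox_P: "p \<in> P" if "p \<in> cbox ?a ?b" "den p = 0" for p
    using den_zero[OF that(2)]
  proof (elim disjE exE conjE)
    fix k assume "p = e k"
    with that have "(real k + 1 / 2) / s \<le> real N / s"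
      by (simp add: in_cbox_complex_iff e_def X_def)
    then have "k < N"
      using s by (simp add: divide_le_cancel)
    with \<open>p = e k\<close> show ?thesis
      by (auto simp: P_def)
  next
    fix k assume "p = - e k"
    with that have "(real k + 1 / 2) / s \<le> real N / s"
      by (simp add: in_cbox_complex_iff e_def X_def)
    then have "k < N"
      using s by (simp add: divide_le_cancel)
    with \<open>p = - e k\<close> show ?thesis
      by (auto simp: P_def)
  next
    fix \<mu> assume \<mu>: "cis (pi * \<mu>) = z" "p\<^sup>2 = 2 * \<i> * of_real \<mu> - of_real \<epsilon>"
    have "z * exp (- phase \<epsilon> p) = 1"
      unfolding phase_at_pole[OF \<mu>(2)] \<mu>(1)[symmetric] cis_conv_exp by (simp add: exp_minus)
    then have "\<bar>Im p\<bar> \<noteq> c"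
      using line[of p] by auto
    then have "\<bar>Im p\<bar> < c"
      using that(1) by (simp add: in_cbox_complex_iff) linarith
    then have "\<mu> \<in> M"
      using complete \<mu> by blast
    moreover have "p = r \<mu> \<or> p = - r \<mu>"
      using \<mu>(2) r2(1)[of \<mu>] by (metis power2_eq_iff)
    ultimately show ?thesis
      by (auto simp: P_def)
  qed
  show ?A
  proof -
    have "v \<notin> path_image (rectpath ?a ?b)" if "den v = 0" for v
      using cbox_P[OF _ that] P_box X c by (auto simp: path_image_rectpath_cbox_minus_box)
    then show ?thesis by blast
  qed
  \<comment> \<open>A slightly larger open box, convex and hence connected, with finitely many poles
    by compactness of its closure. Those outside the rectangle have winding number 0.\<close>
  define S where "S = box (Complex (- X - 1) (- c - 1)) (Complex (X + 1) (c + 1))"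
  define pts where "pts = {v \<in> S. den v = 0}"
  have "finite {v \<in> cbox (Complex (- X - 1) (- c - 1)) (Complex (X + 1) (c + 1)). den v = 0}"
  proof (rule holomorphic_compact_finite_zeros)
    show "den holomorphic_on UNIV"
      by (rule den_holomorphic)
    have "den (Complex 0 c) \<noteq> 0"
      using line[of "Complex 0 c"] c cos_nonzero_off_axis[OF _ s, of "Complex 0 c"] by simp
    moreover have "den (e 0) = 0"
      unfolding e_def by (rule half_integer_pole)
    ultimately show "\<not> den constant_on UNIV"
      unfolding constant_on_def by (metis UNIV_I)
  qed auto
  then have fin: "finite pts"
    by (rule finite_subset[rotated]) (auto simp: pts_def S_def box_subset_cbox[THEN subsetD])
  have sub: "cbox ?a ?b \<subseteq> S"
    by (auto simp: S_def in_box_complex_iff in_cbox_complex_iff)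
  have pts_P: "P \<subseteq> pts" "pts \<inter> cbox ?a ?b = P"
  proof -
    have "P \<subseteq> cbox ?a ?b"
      using P_box box_subset_cbox[of ?a ?b] by blast
    then show "P \<subseteq> pts" "pts \<inter> cbox ?a ?b = P"
      unfolding pts_def using P_den cbox_P sub by blast+
  qed
  have "contour_integral (rectpath ?a ?b) (kernel z \<beta> \<epsilon> s)
      = 2 * pi * \<i> * (\<Sum>p\<in>pts. winding_number (rectpath ?a ?b) p * residue (kernel z \<beta> \<epsilon> s) p)"
  proof (rule Residue_theorem[OF _ _ fin])
    show "open S" "connected S"
      by (auto simp: S_def convex_connected)
    show "kernel z \<beta> \<epsilon> s holomorphic_on S - pts"
      unfolding kernel_def[abs_def] phase_def
      by (intro holomorphic_intros) (auto simp: pts_def phase_def)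
    show "path_image (rectpath ?a ?b) \<subseteq> S - pts"
      using \<open>?A\<close> path_image_rectpath_subset_cbox[of ?a ?b] X c sub by (auto simp: pts_def)
    show "\<forall>w. w \<notin> S \<longrightarrow> winding_number (rectpath ?a ?b) w = 0"
      using sub X c by (intro allI impI winding_number_rectpath_outside) auto
  qed auto
  also have "(\<Sum>p\<in>pts. winding_number (rectpath ?a ?b) p * residue (kernel z \<beta> \<epsilon> s) p)
      = (\<Sum>p\<in>P. winding_number (rectpath ?a ?b) p * residue (kernel z \<beta> \<epsilon> s) p)"
  proof (intro sum.mono_neutral_right fin pts_P ballI)
    fix p assume "p \<in> pts - P"
    then have "p \<notin> cbox ?a ?b"
      using pts_P by blast
    then show "winding_number (rectpath ?a ?b) p * residue (kernel z \<beta> \<epsilon> s) p = 0"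
      using X c by (subst winding_number_rectpath_outside) auto
  qed
  also have "\<dots> = (\<Sum>p\<in>P. residue (kernel z \<beta> \<epsilon> s) p)"
    by (intro sum.cong refl) (simp add: winding_number_rectpath P_box)
  also have "\<dots> = (\<Sum>k<N. residue (kernel z \<beta> \<epsilon> s) (e k)) + (\<Sum>k<N. residue (kernel z \<beta> \<epsilon> s) (- e k))
       + ((\<Sum>\<mu>\<in>M. residue (kernel z \<beta> \<epsilon> s) (r \<mu>)) + (\<Sum>\<mu>\<in>M. residue (kernel z \<beta> \<epsilon> s) (- r \<mu>)))"
  proof -
    have inj_e: "inj_on e {..<N}" "inj_on (\<lambda>k. - e k) {..<N}"
    proof -
      have "k = l" if "e k = e l" for k l
        using that s unfolding e_def of_real_eq_iff by simp
      then show "inj_on e {..<N}" "inj_on (\<lambda>k. - e k) {..<N}"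
        by (simp_all add: inj_on_def)
    qed
    have "\<mu> = \<mu>'" if "r \<mu> = r \<mu>' \<or> r \<mu> = - r \<mu>'" for \<mu> \<mu>'
    proof -
      have "(r \<mu>)\<^sup>2 = (r \<mu>')\<^sup>2"
        using that by (metis power2_minus)
      then show ?thesis
        unfolding r2(1) by simp
    qed
    then have inj_r: "inj_on r M" "inj_on (\<lambda>\<mu>. - r \<mu>) M"
      by (simp_all add: inj_on_def)
    have Im_r: "Im (r \<mu>) \<noteq> 0" for \<mu>
      using pole_off_axis[OF r2(1) \<epsilon>] .
    have Re_e: "Re (e k) > 0" for k
      using s by (simp add: e_def)
    have "e k \<noteq> - e l" for k l
    proof
      assume "e k = - e l"
      then have "Re (e k) = - Re (e l)"
        by simp
      with Re_e[of k] Re_e[of l] show False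
        by linarith
    qed
    then have d1: "e ` {..<N} \<inter> (\<lambda>k. - e k) ` {..<N} = {}"
      by blast
    have "r \<mu> \<noteq> - r \<mu>'" for \<mu> \<mu>'
    proof
      assume eq: "r \<mu> = - r \<mu>'"
      then have "\<mu> = \<mu>'"
        using \<open>\<And>\<mu> \<mu>'. r \<mu> = r \<mu>' \<or> r \<mu> = - r \<mu>' \<Longrightarrow> \<mu> = \<mu>'\<close> by blast
      with eq Im_r[of \<mu>] show False
        by simp
    qed
    then have d2: "r ` M \<inter> (\<lambda>\<mu>. - r \<mu>) ` M = {}"
      by blast
    have "Im (e k) = 0" for k
      by (simp add: e_def)
    then have d3: "(e ` {..<N} \<union> (\<lambda>k. - e k) ` {..<N}) \<inter> (r ` M \<union> (\<lambda>\<mu>. - r \<mu>) ` M) = {}"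
    proof -
      have "Im w = 0" if "w \<in> e ` {..<N} \<union> (\<lambda>k. - e k) ` {..<N}" for w
        using that by (auto simp: \<open>\<And>k. Im (e k) = 0\<close>)
      moreover have "Im w \<noteq> 0" if "w \<in> r ` M \<union> (\<lambda>\<mu>. - r \<mu>) ` M" for w
        using that by (auto simp: Im_r)
      ultimately show ?thesis
        by blast
    qed
    show ?thesis
      unfolding P_def using d1 d2 d3 M(1) inj_e inj_r
      by (simp add: sum.union_disjoint sum.reindex)
  qed
  also have "\<dots> = 2 * ((\<Sum>k<N. - ((- 1) ^ k * (of_nat k + 1 / 2) * fermi z \<beta> \<epsilon> (e k)) / of_real (pi * s\<^sup>2))
      + (\<Sum>\<mu>\<in>M. cis (- (pi * \<beta> * \<mu>)) / (of_real pi * cos (of_real (pi * s) * r \<mu>))))"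
    using half_integer_pole(3,4) fermi_pole(2)[OF r2(1) M(2)] fermi_pole(2)[OF r2(2) M(2)]
    by (simp add: e_def)
  also have "\<dots> = 1 / of_real (pi * s\<^sup>2) * (2 * of_real (s\<^sup>2) * (\<Sum>\<mu>\<in>M. cis (- (pi * \<beta> * \<mu>)) / cos (of_real (pi * s) * r \<mu>))
     - (\<Sum>k<N. (- 1) ^ k * (2 * of_nat k + 1) * fermi z \<beta> \<epsilon> (e k)))"
    unfolding right_diff_distrib distrib_left sum_distrib_left sum_negf[symmetric] diff_conv_add_uminus
    using s by (intro arg_cong2[where f = "(+)"] trans[OF add.commute] sum.cong refl) (simp_all add: field_simps)
  finally have "contour_integral (rectpath ?a ?b) (kernel z \<beta> \<epsilon> s) = 2 * pi * \<i> * (1 / of_real (pi * s\<^sup>2) *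
     (2 * of_real (s\<^sup>2) * (\<Sum>\<mu>\<in>M. cis (- (pi * \<beta> * \<mu>)) / cos (of_real (pi * s) * r \<mu>))
     - (\<Sum>k<N. (- 1) ^ k * (2 * of_nat k + 1) * fermi z \<beta> \<epsilon> (e k))))" .
  moreover have "2 * pi * \<i> * (1 / of_real (pi * s\<^sup>2) * w) = 2 * \<i> / of_real (s\<^sup>2) * w" for w
    by simp
  ultimately show ?B
    unfolding r_def e_def by (simp only:)
qed

end

section \<open>Which poles lie in the strip, and the limit of infinite width\<close>

lemma csqrt_abs_Im_less:
  assumes "0 < \<epsilon>" "\<bar>\<mu>\<bar> + \<epsilon> < c\<^sup>2" "0 < c"
  shows "\<bar>Im (csqrt (2 * \<i> * of_real \<mu> - of_real \<epsilon>))\<bar> < c"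
proof -
  define p where "p = csqrt (2 * \<i> * of_real \<mu> - of_real \<epsilon>)"
  have p2: "p\<^sup>2 = 2 * \<i> * of_real \<mu> - of_real \<epsilon>"
    by (simp add: p_def)
  have "(Re p)\<^sup>2 - (Im p)\<^sup>2 = - \<epsilon>"
    using arg_cong[OF p2, of Re] by (simp add: power2_eq_square)
  moreover have "(Re p)\<^sup>2 + (Im p)\<^sup>2 = norm (p\<^sup>2)"
    by (simp add: norm_power cmod_power2)
  moreover have "norm (p\<^sup>2) \<le> 2 * \<bar>\<mu>\<bar> + \<epsilon>"
    unfolding p2 using assms norm_triangle_ineq4[of "2 * \<i> * of_real \<mu>" "of_real \<epsilon>"]
    by (simp add: norm_mult)
  ultimately have "(Im p)\<^sup>2 < c\<^sup>2"
    using assms by linarith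
  then show ?thesis
    unfolding p_def[symmetric] using assms power2_less_imp_less[of "\<bar>Im p\<bar>" c] by simp
qed

text \<open>This follows from Re p Im p = \<mu> and |Re p| <= |Im p|. Together with
  \<open>csqrt_abs_Im_less\<close> it identifies the poles in the strip as those with |\<mu>| < c^2,
  once \<epsilon> is small.\<close>

lemma pole_in_strip:
  assumes "p\<^sup>2 = 2 * \<i> * of_real \<mu> - of_real \<epsilon>" "0 \<le> \<epsilon>" "\<bar>Im p\<bar> < c"
  shows "\<bar>\<mu>\<bar> < c\<^sup>2"
proof -
  have "(Re p)\<^sup>2 - (Im p)\<^sup>2 = - \<epsilon>" "Re p * Im p = \<mu>"
    using arg_cong[OF assms(1), of Re] arg_cong[OF assms(1), of Im]
    by (simp_all add: power2_eq_square mult.commute)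
  then have "(Re p)\<^sup>2 \<le> (Im p)\<^sup>2" "\<bar>\<mu>\<bar> = \<bar>Re p\<bar> * \<bar>Im p\<bar>"
    using assms(2) by (auto simp flip: abs_mult)
  then have "\<bar>Re p\<bar> \<le> \<bar>Im p\<bar>" and \<mu>: "\<bar>\<mu>\<bar> = \<bar>Re p\<bar> * \<bar>Im p\<bar>"
    by (simp_all only: abs_le_square_iff)
  then have "\<bar>\<mu>\<bar> \<le> \<bar>Im p\<bar> * \<bar>Im p\<bar>"
    unfolding \<mu> by (intro mult_right_mono) auto
  also have "\<dots> < c * c"
    using assms(3) by (intro mult_strict_mono') auto
  finally show ?thesis
    by (simp add: power2_eq_square)
qed

text \<open>For fixed s let N tend to infinity: the vertical sides disappear and the partial sums
  converge to L. The two horizontal sides remain, where 1 / cos is of order exp (- pi c s). The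
  other bounds on these lines do not depend on s, and therefore neither does K.\<close>

theorem contour_expansion:
  fixes z :: complex and \<beta> c :: real
  defines "M \<equiv> {\<mu>. cis (pi * \<mu>) = z \<and> \<bar>\<mu>\<bar> < c\<^sup>2}"
  assumes z: "norm z = 1" and \<beta>: "\<beta> > 0" and c: "c > 0"
    and zc: "z \<noteq> cis (pi * c\<^sup>2)" "z \<noteq> cis (- (pi * c\<^sup>2))" and M: "finite M"
  shows "\<exists>K>0. \<forall>\<^sub>F s in at_top. \<forall>L.
    (\<lambda>k. (- 1) ^ k * (2 * of_nat k + 1) * fermi z \<beta> (7 / (4 * s\<^sup>2)) (of_real ((real k + 1 / 2) / s))) sums L \<longrightarrow>
    norm (L - 2 * of_real (s\<^sup>2) *
        (\<Sum>\<mu>\<in>M. cis (- (pi * \<beta> * \<mu>)) / cos (of_real (pi * s) * csqrt (2 * \<i> * of_real \<mu> - of_real (7 / (4 * s\<^sup>2))))))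
      \<le> K * s\<^sup>2 * exp (- (pi * c * s))" (is "\<exists>K>0. eventually (?P K) at_top")
proof -
  obtain \<delta> \<epsilon>0 where \<delta>: "\<delta> > 0" "\<epsilon>0 > 0"
    "\<And>\<epsilon> v. 0 \<le> \<epsilon> \<Longrightarrow> \<epsilon> \<le> \<epsilon>0 \<Longrightarrow> \<bar>Im v\<bar> = c \<Longrightarrow> \<delta> \<le> norm (1 - z * exp (- phase \<epsilon> v))"
    using denominator_lower_bound_line[OF z c zc] by blast
  obtain B where B: "B > 0"
    "\<And>\<epsilon> v. 0 \<le> \<epsilon> \<Longrightarrow> \<bar>Im v\<bar> = c \<Longrightarrow> norm (v * exp (- (of_real \<beta> * phase \<epsilon> v))) \<le> B / (1 + (Re v)\<^sup>2)"
    using numerator_bound_line[OF c \<beta>] by blast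
  \<comment> \<open>Finiteness of M leaves a gap below c^2, so that the poles indexed by M stay
    strictly inside the strip as long as \<epsilon> < \<open>\<epsilon>1\<close>.\<close>
  obtain \<epsilon>1 where \<epsilon>1: "\<epsilon>1 > 0" "\<And>\<mu>. \<mu> \<in> M \<Longrightarrow> \<bar>\<mu>\<bar> + \<epsilon>1 < c\<^sup>2"
  proof -
    have "\<forall>\<mu>\<in>M. \<forall>\<^sub>F e in at_right 0. \<bar>\<mu>\<bar> + e < c\<^sup>2"
    proof
      fix \<mu> assume "\<mu> \<in> M"
      then have "0 < c\<^sup>2 - \<bar>\<mu>\<bar>"
        by (simp add: M_def)
      from eventually_at_right_real[OF this] show "\<forall>\<^sub>F e in at_right 0. \<bar>\<mu>\<bar> + e < c\<^sup>2"
        by eventually_elim auto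
    qed
    then have "\<forall>\<^sub>F e in at_right 0. \<forall>\<mu>\<in>M. \<bar>\<mu>\<bar> + e < c\<^sup>2"
      using M by (simp add: eventually_ball_finite)
    moreover have "\<forall>\<^sub>F e in at_right (0::real). e > 0"
      by (simp add: eventually_at_right_less)
    ultimately have "\<forall>\<^sub>F e in at_right 0. e > 0 \<and> (\<forall>\<mu>\<in>M. \<bar>\<mu>\<bar> + e < c\<^sup>2)"
      by eventually_elim simp
    then show ?thesis
      using that by (auto dest!: eventually_happens)
  qed
  \<comment> \<open>Two horizontal sides, each at most A pi with A = 4 (B / \<delta>) exp (- pi c
    s), times the normalising factor s^2 / 2.\<close>
  define K where "K = 4 * pi * B / \<delta>"
  have "K > 0"
    using B \<delta> by (simp add: K_def)
  moreover have "eventually (?P K) at_top"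
  proof -
    have lim: "((\<lambda>s::real. 7 / (4 * s\<^sup>2)) \<longlongrightarrow> 0) at_top"
      by real_asymp
    have "\<forall>\<^sub>F s in at_top. 7 / (4 * s\<^sup>2) < min \<epsilon>0 \<epsilon>1"
      using \<delta> \<epsilon>1 by (intro order_tendstoD(2)[OF lim]) auto
    then show ?thesis
      using eventually_gt_at_top[of 0] eventually_ge_at_top[of "1 / (pi * c)"]
    proof eventually_elim
      case (elim s)
      show ?case
      proof (intro allI impI)
        fix L
        assume sums: "(\<lambda>k. (- 1) ^ k * (2 * of_nat k + 1) * fermi z \<beta> (7 / (4 * s\<^sup>2)) (of_real ((real k + 1 / 2) / s))) sums L"
        define \<epsilon> where "\<epsilon> = 7 / (4 * s\<^sup>2)"
        have s: "s > 0" and \<epsilon>: "0 < \<epsilon>" "\<epsilon> \<le> \<epsilon>0" "\<epsilon> < \<epsilon>1"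
          using elim by (auto simp: \<epsilon>_def)
        have pcs: "pi * c * s \<ge> 1"
          using elim(3) c by (simp add: field_simps)
        define main where "main = 2 * of_real (s\<^sup>2) *
          (\<Sum>\<mu>\<in>M. cis (- (pi * \<beta> * \<mu>)) / cos (of_real (pi * s) * csqrt (2 * \<i> * of_real \<mu> - of_real \<epsilon>)))"
        define S where "S = (\<lambda>N. \<Sum>k<N. (- 1) ^ k * (2 * of_nat k + 1) * fermi z \<beta> \<epsilon> (of_real ((real k + 1 / 2) / s)))"
        have SL: "S \<longlonglongrightarrow> L"
          using sums unfolding S_def sums_def \<epsilon>_def .
        define X where "X = (\<lambda>N. real N / s)"
        \<comment> \<open>A bound for the kernel on the vertical sides, where |Re v| = X, |Im v| <=
          c, and the cosine has modulus at least 1.\<close>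
        define V where "V = (\<lambda>N. (X N + c) * exp (- (\<beta> * (pi / 2 * ((X N)\<^sup>2 - c\<^sup>2)))) / (1 - exp (- (pi / 2 * ((X N)\<^sup>2 - c\<^sup>2)))))"
        have "V \<longlonglongrightarrow> 0"
        proof -
          have "filterlim X at_top sequentially"
            unfolding X_def using s by real_asymp
          moreover have "((\<lambda>x. (x + c) * exp (- (\<beta> * (pi / 2 * (x\<^sup>2 - c\<^sup>2)))) / (1 - exp (- (pi / 2 * (x\<^sup>2 - c\<^sup>2))))) \<longlongrightarrow> 0) at_top"
            using \<beta> c by real_asymp
          ultimately show ?thesis
            unfolding V_def by (rule filterlim_compose[rotated])
        qed
        define A where "A = B / \<delta> * (4 * exp (- (pi * c * s)))"
        have "A \<ge> 0"
          using B \<delta> by (simp add: A_def)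
        have XN: "\<forall>\<^sub>F N in sequentially. c < X N"
          unfolding X_def using s by real_asymp
        have "\<forall>\<^sub>F N in sequentially. norm (S N - main) \<le> s\<^sup>2 / 2 * (2 * (A * pi) + 2 * (V N * (2 * c)))"
          using XN
        proof eventually_elim
          case (elim N)
          let ?X = "X N"
          let ?a = "Complex (- ?X) (- c)" and ?b = "Complex ?X (- c)" and ?c = "Complex ?X c" and ?d = "Complex (- ?X) c"
          let ?f = "kernel z \<beta> \<epsilon> s"
          have X: "0 < ?X"
            using elim c by linarith
          have ct: "path_image (rectpath ?a ?c) \<inter> {v. den z \<epsilon> s v = 0} = {}"
            "contour_integral (rectpath ?a ?c) ?f = 2 * \<i> / of_real (s\<^sup>2) * (main - S N)"
          proof -
            have 1: "1 - z * exp (- phase \<epsilon> v) \<noteq> 0" if "\<bar>Im v\<bar> = c" for v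
              using \<delta>(3)[of \<epsilon> v] \<delta>(1) that \<epsilon> by auto
            have 2: "cis (pi * \<mu>) = z" if "\<mu> \<in> M" for \<mu>
              using that by (simp add: M_def)
            have 3: "\<bar>Im (csqrt (2 * \<i> * of_real \<mu> - of_real \<epsilon>))\<bar> < c" if "\<mu> \<in> M" for \<mu>
              by (rule csqrt_abs_Im_less) (use \<epsilon>1(2)[OF that] \<epsilon> c in auto)
            have 4: "\<mu> \<in> M" if "cis (pi * \<mu>) = z" "p\<^sup>2 = 2 * \<i> * of_real \<mu> - of_real \<epsilon>" "\<bar>Im p\<bar> < c" for p \<mu>
              using pole_in_strip[OF that(2) _ that(3)] that(1) \<epsilon> by (simp add: M_def)
            show "path_image (rectpath ?a ?c) \<inter> {v. den z \<epsilon> s v = 0} = {}"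
              unfolding X_def by (rule contour_integral_kernel(1)[OF z \<epsilon>(1) s c elim[unfolded X_def] _ M]) (fact 1 2 3 4)+
            show "contour_integral (rectpath ?a ?c) ?f = 2 * \<i> / of_real (s\<^sup>2) * (main - S N)"
              unfolding X_def main_def S_def
              by (rule contour_integral_kernel(2)[OF z \<epsilon>(1) s c elim[unfolded X_def] _ M]) (fact 1 2 3 4)+
          qed
          have pim: "path_image (rectpath ?a ?c) = closed_segment ?a ?b \<union> closed_segment ?b ?c \<union> closed_segment ?c ?d \<union> closed_segment ?d ?a"
            by (simp add: rectpath_def Let_def path_image_join Un_assoc)
          have cont: "continuous_on A ?f" if "A \<subseteq> path_image (rectpath ?a ?c)" for A
            unfolding kernel_def[abs_def] phase_def
            by (intro continuous_intros) (use ct(1) that in \<open>auto simp: phase_def\<close>)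
          have c1: "continuous_on (closed_segment ?a ?b) ?f" and c2: "continuous_on (closed_segment ?b ?c) ?f"
            and c3: "continuous_on (closed_segment ?d ?c) ?f" "continuous_on (closed_segment ?c ?d) ?f"
            and c4: "continuous_on (closed_segment ?d ?a) ?f"
            by (rule cont; use pim closed_segment_commute in blast)+
          note ci = contour_integrable_continuous_linepath
          have "contour_integral (rectpath ?a ?c) ?f = contour_integral (linepath ?a ?b) ?f + contour_integral (linepath ?b ?c) ?f
              + contour_integral (linepath ?c ?d) ?f + contour_integral (linepath ?d ?a) ?f"
            using ci[OF c1] ci[OF c2] ci[OF c3(2)] ci[OF c4]
            by (simp add: rectpath_def Let_def contour_integral_join contour_integrable_joinI)
          then have split: "contour_integral (rectpath ?a ?c) ?f = contour_integral (linepath ?a ?b) ?f + contour_integral (linepath ?b ?c) ?f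
              - contour_integral (linepath ?d ?c) ?f + contour_integral (linepath ?d ?a) ?f"
            using contour_integral_reverse_linepath[OF c3(2)] by simp
          have horiz: "norm (?f v) \<le> A / (1 + (Re v)\<^sup>2)" if v: "\<bar>Im v\<bar> = c" for v
          proof -
            have Im: "\<bar>Im (of_real (pi * s) * v)\<bar> = pi * c * s"
              using s v by (simp add: abs_mult)
            have "exp (pi * c * s) / 4 \<le> norm (cos (of_real (pi * s) * v))"
              using norm_cos_ge_exp[of "of_real (pi * s) * v"] pcs unfolding Im by blast
            moreover have "\<delta> \<le> norm (1 - z * exp (- phase \<epsilon> v))"
              using \<delta>(3) v \<epsilon> by auto
            ultimately have "\<delta> * (exp (pi * c * s) / 4) \<le> norm (den z \<epsilon> s v)"
              using \<delta>(1) unfolding norm_mult by (intro mult_mono) auto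
            then have "norm (?f v) \<le> (B / (1 + (Re v)\<^sup>2)) / (\<delta> * (exp (pi * c * s) / 4))"
              unfolding kernel_def norm_divide using B(2)[of \<epsilon> v] \<epsilon> v \<delta>(1) B(1)
              by (intro frac_le) auto
            also have "\<dots> = A / (1 + (Re v)\<^sup>2)"
              by (simp add: A_def exp_minus field_simps)
            finally show ?thesis .
          qed
          have horiz': "norm (?f (Complex \<rho> y)) \<le> A / (1 + \<rho>\<^sup>2)" if "\<bar>y\<bar> = c" for \<rho> y
            using horiz[of "Complex \<rho> y"] that by simp
          have vert: "norm (?f v) \<le> V N" if v: "\<bar>Re v\<bar> = ?X" "\<bar>Im v\<bar> \<le> c" for v
          proof -
            have Re2: "(Re v)\<^sup>2 = ?X\<^sup>2"
              using v(1) by (metis power2_abs)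
            have Im2: "(Im v)\<^sup>2 \<le> c\<^sup>2"
              using v(2) power_mono[of "\<bar>Im v\<bar>" c 2] by simp
            have ph: "pi / 2 * (?X\<^sup>2 - c\<^sup>2) \<le> Re (phase \<epsilon> v)"
              unfolding Re_phase Re2 using Im2 \<epsilon> by (intro mult_left_mono) auto
            have "c\<^sup>2 < ?X\<^sup>2"
              using elim c by (intro power_strict_mono) auto
            then have pos: "0 < pi / 2 * (?X\<^sup>2 - c\<^sup>2)"
              by simp
            have "norm v \<le> ?X + c"
              using cmod_le[of v] v by simp
            moreover have "exp (- (\<beta> * Re (phase \<epsilon> v))) \<le> exp (- (\<beta> * (pi / 2 * (?X\<^sup>2 - c\<^sup>2))))"
              using mult_left_mono[OF ph, of \<beta>] \<beta> by simp
            ultimately have num: "norm (v * exp (- (of_real \<beta> * phase \<epsilon> v))) \<le> (?X + c) * exp (- (\<beta> * (pi / 2 * (?X\<^sup>2 - c\<^sup>2))))"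
              unfolding norm_mult norm_exp_phase by (intro mult_mono) (use X c in auto)
            have "norm (z * exp (- phase \<epsilon> v)) = exp (- Re (phase \<epsilon> v))"
              using z by (simp add: norm_mult norm_exp_eq_Re)
            also have "\<dots> \<le> exp (- (pi / 2 * (?X\<^sup>2 - c\<^sup>2)))"
              using ph by simp
            finally have d1: "1 - exp (- (pi / 2 * (?X\<^sup>2 - c\<^sup>2))) \<le> norm (1 - z * exp (- phase \<epsilon> v))"
              using norm_triangle_ineq2[of 1 "z * exp (- phase \<epsilon> v)"] by simp
            \<comment> \<open>Here s times X is the integer N, so the real part of the argument is a
              multiple of pi.\<close>
            have "\<bar>cos (Re (of_real (pi * s) * v))\<bar> = 1"
            proof -
              have "Re v = ?X \<or> Re v = - ?X"
                using v(1) by linarith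
              then have "cos (Re (of_real (pi * s) * v)) = cos (pi * real N)"
                using s by (auto simp: X_def)
              then show ?thesis
                by (simp add: mult.commute[of pi])
            qed
            then have "(cos (Re (of_real (pi * s) * v)))\<^sup>2 = 1"
              by (metis one_power2 power2_abs)
            then have "1\<^sup>2 \<le> (norm (cos (of_real (pi * s) * v)))\<^sup>2"
              unfolding norm_cos_squared by simp
            then have d2: "1 \<le> norm (cos (of_real (pi * s) * v))"
              by (rule power2_le_imp_le) simp
            have "(1 - exp (- (pi / 2 * (?X\<^sup>2 - c\<^sup>2)))) * 1 \<le> norm (den z \<epsilon> s v)"
              unfolding norm_mult by (intro mult_mono d1 d2) auto
            then show ?thesis
              unfolding kernel_def norm_divide V_def using num pos X c by (intro frac_le) auto
          qed
          have "V N \<ge> 0"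
            using order_trans[OF norm_ge_zero vert[of ?b]] X c by simp
          have seg: "\<bar>Re v\<bar> = ?X \<and> \<bar>Im v\<bar> \<le> c" if "v \<in> closed_segment ?b ?c \<or> v \<in> closed_segment ?d ?a" for v
            using that X c by (auto simp: closed_segment_same_Re closed_segment_eq_real_ivl)
          have "norm (contour_integral (linepath ?a ?b) ?f) \<le> A * pi"
            by (rule norm_contour_integral_horizontal_le[OF X \<open>A \<ge> 0\<close> ci[OF c1]]) (use c in \<open>auto intro!: horiz'\<close>)
          moreover have "norm (contour_integral (linepath ?d ?c) ?f) \<le> A * pi"
            by (rule norm_contour_integral_horizontal_le[OF X \<open>A \<ge> 0\<close> ci[OF c3(1)]]) (use c in \<open>auto intro!: horiz'\<close>)
          moreover have "norm (contour_integral (linepath ?b ?c) ?f) \<le> V N * norm (?c - ?b)"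
            by (rule contour_integral_bound_linepath[OF ci[OF c2] \<open>V N \<ge> 0\<close>]) (use vert seg in auto)
          moreover have "norm (contour_integral (linepath ?d ?a) ?f) \<le> V N * norm (?a - ?d)"
            by (rule contour_integral_bound_linepath[OF ci[OF c4] \<open>V N \<ge> 0\<close>]) (use vert seg in auto)
          moreover have "norm (?c - ?b) = 2 * c" "norm (?a - ?d) = 2 * c"
            using c by (simp_all add: cmod_def real_sqrt_mult)
          ultimately have total: "norm (contour_integral (rectpath ?a ?c) ?f) \<le> 2 * (A * pi) + 2 * (V N * (2 * c))"
            unfolding split by (smt (verit) norm_triangle_ineq norm_triangle_ineq4)
          have "main - S N = of_real (s\<^sup>2) / (2 * \<i>) * contour_integral (rectpath ?a ?c) ?f"
            unfolding ct(2) using s by simp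
          then have "norm (main - S N) = s\<^sup>2 / 2 * norm (contour_integral (rectpath ?a ?c) ?f)"
            by (simp add: norm_mult norm_divide norm_power)
          also have "\<dots> \<le> s\<^sup>2 / 2 * (2 * (A * pi) + 2 * (V N * (2 * c)))"
            by (intro mult_left_mono total) auto
          finally show ?case
            by (simp add: norm_minus_commute)
        qed
        moreover have "(\<lambda>N. norm (S N - main)) \<longlonglongrightarrow> norm (L - main)"
          by (intro tendsto_intros SL)
        moreover have "(\<lambda>N. s\<^sup>2 / 2 * (2 * (A * pi) + 2 * (V N * (2 * c)))) \<longlonglongrightarrow> s\<^sup>2 / 2 * (2 * (A * pi) + 2 * (0 * (2 * c)))"
          by (intro tendsto_intros \<open>V \<longlonglongrightarrow> 0\<close>)
        ultimately have "norm (L - main) \<le> s\<^sup>2 / 2 * (2 * (A * pi) + 2 * (0 * (2 * c)))"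
          by (intro tendsto_le[OF sequentially_bot])
        also have "\<dots> = K * s\<^sup>2 * exp (- (pi * c * s))"
          by (simp add: A_def K_def)
        finally show "norm (L - 2 * of_real (s\<^sup>2) *
          (\<Sum>\<mu>\<in>M. cis (- (pi * \<beta> * \<mu>)) / cos (of_real (pi * s) * csqrt (2 * \<i> * of_real \<mu> - of_real (7 / (4 * s\<^sup>2))))))
            \<le> K * s\<^sup>2 * exp (- (pi * c * s))"
          by (simp add: main_def \<epsilon>_def)
      qed
    qed
  qed
  ultimately show ?thesis
    by blast
qed

section \<open>Lambert series at q = exp (- t / a) with t = pi / s^2\<close>

definition lambert :: "'a::{real_normed_field,banach} \<Rightarrow> nat \<Rightarrow> nat \<Rightarrow> 'a \<Rightarrow> 'a" where
  "lambert z a b q = (\<Sum>k. lambert_term z a b q k)"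

lemma summable_lambert_term:
  fixes q z :: "'a::{real_normed_field,banach}"
  assumes "norm q < 1" "norm z \<le> 1" "0 < a" "0 < b"
  shows "summable (lambert_term z a b q)"
  by (rule summable_comparison_test'[of "\<lambda>k. (2 * of_nat k + 1) * norm q ^ k * (1 / (1 - norm q))"])
     (use assms norm_lambert_term_le[OF order.refl assms(1,2,3,4)] in \<open>auto intro!: summable_mult2 summable_odd_powers\<close>)

text \<open>Completing the square in k^2 + k + 2; this is where the constant 7/4 originates.\<close>

lemma two_Suc_triangle: "2 * real (Suc (triangle k)) = (real k + 1 / 2)\<^sup>2 + 7 / 4"
  by (induction k) (auto simp: power2_eq_square algebra_simps)

text \<open>The powers a and b of q = exp (- t / a) are exp (- t) and exp (- t b / a), so a and b
  enter only through \<beta> = b / a.\<close>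

lemma lambert_term_eq_fermi:
  fixes z :: complex and a b :: nat
  assumes s: "s > 0" and a: "0 < a"
  shows "lambert_term z a b (of_real (exp (- (pi / s\<^sup>2) / real a))) k =
     (- 1) ^ k * (2 * of_nat k + 1) * fermi z (real b / real a) (7 / (4 * s\<^sup>2)) (of_real ((real k + 1 / 2) / s))"
proof -
  define E where "E = Suc (triangle k)"
  define t where "t = pi / s\<^sup>2"
  have "((real k + 1 / 2) / s)\<^sup>2 + 7 / (4 * s\<^sup>2) = 2 * real E / s\<^sup>2"
    unfolding E_def two_Suc_triangle power_divide using s by (simp add: field_simps)
  then have ph: "phase (7 / (4 * s\<^sup>2)) (of_real ((real k + 1 / 2) / s)) = of_real (t * real E)"
    unfolding phase_def of_real_power[symmetric] of_real_add[symmetric] of_real_mult[symmetric]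
    by (simp add: t_def)
  have pow: "complex_of_real (exp (- t / real a)) ^ (n * E) = exp (- (of_real (real n / real a) * of_real (t * real E)))" for n
  proof -
    have "exp (- t / real a) ^ (n * E) = exp (- (real n / real a * (t * real E)))"
      unfolding exp_of_nat_mult[symmetric] by (simp add: mult_ac)
    then have "complex_of_real (exp (- t / real a) ^ (n * E)) = of_real (exp (- (real n / real a * (t * real E))))"
      by (rule arg_cong)
    then show ?thesis
      by (simp only: of_real_power exp_of_real[symmetric] of_real_minus of_real_mult)
  qed
  show ?thesis
    unfolding lambert_term_def fermi_def ph t_def[symmetric] E_def[symmetric] pow using a by simp
qed

lemma exp_neg_less_one: "s > 0 \<Longrightarrow> 0 < a \<Longrightarrow> norm (complex_of_real (exp (- (pi / s\<^sup>2) / real a))) < 1"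
  by simp

theorem lambert_expansion:
  fixes z :: complex and a b :: nat and c :: real
  defines "M \<equiv> {\<mu>. cis (pi * \<mu>) = z \<and> \<bar>\<mu>\<bar> < c\<^sup>2}"
  assumes z: "norm z = 1" and ab: "0 < a" "0 < b" and c: "c > 0"
    and zc: "z \<noteq> cis (pi * c\<^sup>2)" "z \<noteq> cis (- (pi * c\<^sup>2))" and M: "finite M"
  shows "\<exists>K>0. \<forall>\<^sub>F s in at_top.
    norm (lambert z a b (of_real (exp (- (pi / s\<^sup>2) / real a))) - 2 * of_real (s\<^sup>2) *
        (\<Sum>\<mu>\<in>M. cis (- (pi * (real b / real a) * \<mu>)) / cos (of_real (pi * s) * csqrt (2 * \<i> * of_real \<mu> - of_real (7 / (4 * s\<^sup>2))))))
      \<le> K * s\<^sup>2 * exp (- (pi * c * s))" (is "\<exists>K>0. eventually (?P K) at_top")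
proof -
  have "real b / real a > 0"
    using ab by simp
  from contour_expansion[OF z this c zc M[unfolded M_def]] obtain K where K: "K > 0" and ev: "\<forall>\<^sub>F s in at_top. \<forall>L.
    (\<lambda>k. (- 1) ^ k * (2 * of_nat k + 1) * fermi z (real b / real a) (7 / (4 * s\<^sup>2)) (of_real ((real k + 1 / 2) / s))) sums L \<longrightarrow>
    norm (L - 2 * of_real (s\<^sup>2) *
        (\<Sum>\<mu>\<in>M. cis (- (pi * (real b / real a) * \<mu>)) / cos (of_real (pi * s) * csqrt (2 * \<i> * of_real \<mu> - of_real (7 / (4 * s\<^sup>2))))))
      \<le> K * s\<^sup>2 * exp (- (pi * c * s))"
    unfolding M_def by blast
  have "eventually (?P K) at_top"
    using ev eventually_gt_at_top[of 0]
  proof eventually_elim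
    case (elim s)
    have "lambert_term z a b (of_real (exp (- (pi / s\<^sup>2) / real a))) sums lambert z a b (of_real (exp (- (pi / s\<^sup>2) / real a)))"
      unfolding lambert_def
      by (intro summable_sums summable_lambert_term exp_neg_less_one) (use z ab elim in auto)
    then have "(\<lambda>k. (- 1) ^ k * (2 * of_nat k + 1) * fermi z (real b / real a) (7 / (4 * s\<^sup>2)) (of_real ((real k + 1 / 2) / s))) sums
       lambert z a b (of_real (exp (- (pi / s\<^sup>2) / real a)))"
      unfolding lambert_term_eq_fermi[OF elim(2) ab(1), abs_def] .
    with elim(1) show ?case
      by blast
  qed
  with K show ?thesis
    by blast
qed

section \<open>The dominant poles and the resulting asymptotics of the series\<close>

text \<open>The pole with index \<open>\<mu>\<close> in the unscaled variable \<open>u = s v\<close>.\<close>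

definition upole :: "real \<Rightarrow> real \<Rightarrow> complex" where
  "upole \<mu> s = of_real s * csqrt (2 * \<i> * of_real \<mu> - of_real (7 / (4 * s\<^sup>2)))"

lemma Re_upole: "Re (upole \<mu> s) = s * Re (csqrt (2 * \<i> * of_real \<mu> - of_real (7 / (4 * s\<^sup>2))))"
proof -
  have "Re (of_real s * w) = s * Re w" for w
    by simp
  then show ?thesis
    unfolding upole_def .
qed

lemma upole_squared: "s > 0 \<Longrightarrow> (upole \<mu> s)\<^sup>2 = 2 * \<i> * of_real (\<mu> * s\<^sup>2) - 7 / 4"
  by (simp add: upole_def power_mult_distrib algebra_simps)

lemma upole_Re_Im:
  assumes "s > 0"
  shows "(Im (upole \<mu> s))\<^sup>2 = (Re (upole \<mu> s))\<^sup>2 + 7 / 4" "Re (upole \<mu> s) * Im (upole \<mu> s) = \<mu> * s\<^sup>2"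
  using arg_cong[OF upole_squared[OF assms], of Re \<mu>] arg_cong[OF upole_squared[OF assms], of Im \<mu>]
  by (simp_all add: power2_eq_square mult_ac)

lemma upole_pos:
  assumes "s > 0" "\<mu> > 0"
  shows "Re (upole \<mu> s) > 0" "Im (upole \<mu> s) > 0" "Im (upole \<mu> s) > sqrt \<mu> * s"
proof -
  have "Re (upole \<mu> s) \<ge> 0"
    unfolding Re_upole using assms by (intro mult_nonneg_nonneg Re_csqrt) auto
  moreover have RI: "Re (upole \<mu> s) * Im (upole \<mu> s) > 0"
    unfolding upole_Re_Im(2)[OF assms(1)] using assms by simp
  ultimately show *: "Re (upole \<mu> s) > 0" "Im (upole \<mu> s) > 0"
    by (auto simp: zero_less_mult_iff)
  have "(Re (upole \<mu> s))\<^sup>2 < (Im (upole \<mu> s))\<^sup>2"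
    using upole_Re_Im(1)[OF assms(1)] by simp
  then have "Re (upole \<mu> s) < Im (upole \<mu> s)"
    using * by (auto intro: power2_less_imp_less)
  then have "Re (upole \<mu> s) * Im (upole \<mu> s) < Im (upole \<mu> s) * Im (upole \<mu> s)"
    using * by (intro mult_strict_right_mono) auto
  then have "\<mu> * s\<^sup>2 < (Im (upole \<mu> s))\<^sup>2"
    unfolding upole_Re_Im(2)[OF assms(1)] power2_eq_square[of "Im _"] .
  then have "(sqrt \<mu> * s)\<^sup>2 < (Im (upole \<mu> s))\<^sup>2"
    using assms by (simp add: power_mult_distrib)
  then show "Im (upole \<mu> s) > sqrt \<mu> * s"
    using * by (auto intro: power2_less_imp_less)
qed

text \<open>Conjugation preserves the condition Re > 0 that singles out the principal square root.
  Consequently opposite indices contribute complex conjugates when z = - 1, and their sum is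
  real.\<close>

lemma upole_uminus:
  assumes "s > 0" "\<mu> > 0"
  shows "upole (- \<mu>) s = cnj (upole \<mu> s)"
proof -
  let ?w = "csqrt (2 * \<i> * of_real \<mu> - of_real (7 / (4 * s\<^sup>2)))"
  have "Re ?w > 0"
    using upole_pos(1)[OF assms] assms unfolding Re_upole by (simp only: zero_less_mult_iff) auto
  then have "Re (cnj ?w) > 0"
    by (simp only: cnj.sel)
  moreover have "(cnj ?w)\<^sup>2 = 2 * \<i> * of_real (- \<mu>) - of_real (7 / (4 * s\<^sup>2))"
    unfolding complex_cnj_power[symmetric] power2_csqrt by simp
  ultimately have "csqrt (2 * \<i> * of_real (- \<mu>) - of_real (7 / (4 * s\<^sup>2))) = cnj ?w"
    by (intro csqrt_unique disjI1)
  then show ?thesis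
    unfolding upole_def by (simp only: complex_cnj_mult complex_cnj_complex_of_real)
qed

text \<open>With w = exp (i pi u) one has 1 / cos (pi u) = 2 w / (1 + w^2), which differs from 2 w
  by 2 w^3 / (1 + w^2).\<close>

lemma sec_approx:
  assumes "1 \<le> Im u"
  shows "norm (1 / cos (of_real pi * u) - 2 * exp (\<i> * of_real pi * u)) \<le> 4 * exp (- (3 * pi * Im u))"
proof -
  define w where "w = exp (\<i> * of_real pi * u)"
  have nw: "norm w = exp (- (pi * Im u))"
    by (simp add: w_def norm_exp_eq_Re)
  have "1 + (1::real) \<le> exp 1"
    by (rule exp_ge_add_one_self)
  have "1 \<le> pi * Im u"
    using mult_mono[of 1 pi 1 "Im u"] assms pi_gt3 by auto
  then have "norm w \<le> exp (- 1)"
    by (simp add: nw)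
  also have "\<dots> \<le> 1 / 2"
    using \<open>1 + (1::real) \<le> exp 1\<close> by (simp add: exp_minus field_simps)
  finally have "norm w \<le> 1 / 2" .
  then have "norm w * norm w \<le> 1 / 2 * 1"
    by (intro mult_mono) auto
  then have w2: "norm (w\<^sup>2) \<le> 1 / 2"
    by (simp add: norm_mult power2_eq_square)
  have w0: "w \<noteq> 0"
    by (simp add: w_def)
  have "1 + w\<^sup>2 \<noteq> 0"
  proof
    assume "1 + w\<^sup>2 = 0"
    then have "w\<^sup>2 = - 1"
      by (simp add: eq_neg_iff_add_eq_0 add.commute)
    with w2 show False
      by simp
  qed
  have cos: "cos (of_real pi * u) = (1 + w\<^sup>2) / (2 * w)"
    using w0 unfolding cos_exp_eq w_def
    by (simp add: exp_minus field_simps power2_eq_square)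
  have eq: "1 / cos (of_real pi * u) - 2 * w = - (2 * w ^ 3 / (1 + w\<^sup>2))"
    unfolding cos using w0 \<open>1 + w\<^sup>2 \<noteq> 0\<close> by (simp add: field_simps power2_eq_square power3_eq_cube)
  have "1 / 2 \<le> norm (1 + w\<^sup>2)"
    using w2 norm_triangle_ineq2[of 1 "- (w\<^sup>2)"] by simp
  then have "norm (2 * w ^ 3 / (1 + w\<^sup>2)) \<le> 2 * norm w ^ 3 / (1 / 2)"
    unfolding norm_divide by (intro frac_le) (auto simp: norm_mult norm_power)
  also have "norm w ^ 3 = exp (- (3 * pi * Im u))"
    unfolding nw exp_of_nat_mult[symmetric] by simp
  finally show ?thesis
    unfolding eq[unfolded w_def] by (simp add: w_def)
qed

lemma norm_cos_le_exp: "norm (cos z) \<le> exp \<bar>Im z\<bar>" for z :: complex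
proof -
  have "norm (cos z) \<le> (norm (exp (\<i> * z)) + norm (exp (- (\<i> * z)))) / 2"
    unfolding cos_exp_eq using norm_triangle_ineq[of "exp (\<i> * z)" "exp (- (\<i> * z))"] by (simp add: norm_divide)
  also have "\<dots> \<le> exp \<bar>Im z\<bar>"
    by (cases "Im z \<ge> 0") (simp_all add: norm_exp_eq_Re)
  finally show ?thesis .
qed

text \<open>The strip height c = 2 serves z = - 1: its square lies strictly between the odd integers
  3 and 5, so the pairs of index 1 and 3 are kept and the boundary lines stay free of poles.\<close>

lemma cis_pi_eq_minus_one_set: "{\<mu>. cis (pi * \<mu>) = - 1 \<and> \<bar>\<mu>\<bar> < 2\<^sup>2} = {- 3, - 1, 1, 3}"
proof (intro equalityI subsetI)
  fix \<mu> :: real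
  assume "\<mu> \<in> {\<mu>. cis (pi * \<mu>) = - 1 \<and> \<bar>\<mu>\<bar> < 2\<^sup>2}"
  then have "cos (pi * \<mu>) = - 1" "\<bar>\<mu>\<bar> < 4"
    by (auto simp: complex_eq_iff)
  then obtain n :: int where "pi * \<mu> = (2 * n + 1) * pi"
    by (auto simp: cos_eq_minus1)
  then have \<mu>: "\<mu> = 2 * n + 1"
    by simp
  with \<open>\<bar>\<mu>\<bar> < 4\<close> have "\<bar>2 * n + 1\<bar> < 4"
    by linarith
  then have "n = - 2 \<or> n = - 1 \<or> n = 0 \<or> n = 1"
    by presburger
  then show "\<mu> \<in> {- 3, - 1, 1, 3}"
    using \<mu> by auto
next
  have "cis (pi * 3) = cis (2 * pi) * cis pi"
    unfolding cis_mult by (simp add: mult.commute)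
  then have "cis (pi * 3) = - 1"
    by simp
  then have "cis (- (pi * 3)) = - 1"
    by (metis cis_cnj complex_cnj_minus complex_cnj_one)
  fix \<mu> :: real
  assume "\<mu> \<in> {- 3, - 1, 1, 3}"
  then show "\<mu> \<in> {\<mu>. cis (pi * \<mu>) = - 1 \<and> \<bar>\<mu>\<bar> < 2\<^sup>2}"
    using \<open>cis (pi * 3) = - 1\<close> \<open>cis (- (pi * 3)) = - 1\<close> by (auto simp: complex_eq_iff)
qed

text \<open>Conjugate indices add up to twice a real part, and each 1 / cos is replaced by 2 exp (i
  pi u); this turns the prefactor 2 s^2 into 8 s^2. The shifts of the two cosines come from the
  factors cis in the residues.\<close>

theorem lambert_minus_one_asymptotics:
  fixes a b :: nat
  assumes ab: "0 < a" "0 < b"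
  shows "\<exists>K>0. \<forall>\<^sub>F s in at_top. norm (lambert (- 1 :: complex) a b (of_real (exp (- (pi / s\<^sup>2) / real a)))
      - of_real (8 * s\<^sup>2 * (exp (- (pi * Im (upole 1 s))) * cos (pi * Re (upole 1 s) - pi * (real b / real a))
             + exp (- (pi * Im (upole 3 s))) * cos (pi * Re (upole 3 s) - 3 * pi * (real b / real a)))))
     \<le> K * s\<^sup>2 * exp (- (2 * pi * s))"
proof -
  define \<beta> where "\<beta> = real b / real a"
  have "cis (pi * 2\<^sup>2) = 1" "cis (- (pi * 2\<^sup>2)) = (1 :: complex)"
  proof -
    have "cis (pi * 2\<^sup>2) = cis (2 * pi) * cis (2 * pi)"
      unfolding cis_mult by (simp add: mult.commute)
    then show "cis (pi * 2\<^sup>2) = 1"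
      by simp
    then show "cis (- (pi * 2\<^sup>2)) = (1 :: complex)"
      by (metis cis_cnj complex_cnj_one)
  qed
  then have "\<exists>K>0. \<forall>\<^sub>F s in at_top.
    norm (lambert (- 1 :: complex) a b (of_real (exp (- (pi / s\<^sup>2) / real a))) - 2 * of_real (s\<^sup>2) *
        (\<Sum>\<mu>\<in>{- 3, - 1, 1, 3}. cis (- (pi * \<beta> * \<mu>)) / cos (of_real (pi * s) * csqrt (2 * \<i> * of_real \<mu> - of_real (7 / (4 * s\<^sup>2))))))
      \<le> K * s\<^sup>2 * exp (- (pi * 2 * s))" (is "\<exists>K>0. eventually (?Q K) at_top")
    unfolding \<beta>_def
    by (intro lambert_expansion[of "- 1" a b 2, unfolded cis_pi_eq_minus_one_set]) (use ab in simp_all)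
  then obtain K where K: "K > 0" and ev: "eventually (?Q K) at_top"
    by blast
  have "\<forall>\<^sub>F s in at_top. norm (lambert (- 1 :: complex) a b (of_real (exp (- (pi / s\<^sup>2) / real a)))
      - of_real (8 * s\<^sup>2 * (exp (- (pi * Im (upole 1 s))) * cos (pi * Re (upole 1 s) - pi * \<beta>)
             + exp (- (pi * Im (upole 3 s))) * cos (pi * Re (upole 3 s) - 3 * pi * \<beta>))))
     \<le> (K + 32) * s\<^sup>2 * exp (- (2 * pi * s))"
    using ev eventually_ge_at_top[of 1]
  proof eventually_elim
    case (elim s)
    have s: "s > 0"
      using elim by simp
    define g where "g = (\<lambda>\<mu>. cis (- (pi * \<beta> * \<mu>)) / cos (of_real pi * upole \<mu> s))"
    define h where "h = (\<lambda>\<mu>. exp (- (pi * Im (upole \<mu> s))) * cos (pi * Re (upole \<mu> s) - pi * \<beta> * \<mu>))"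
    \<comment> \<open>For \<mu> >= 1 the pole has imaginary part at least s, so the error in
      \<open>sec_approx\<close> is at most 4 exp (- 2 pi s). The two indices 1 and 3, with the
      factor 4 s^2, account for the additional 32 in the constant.\<close>
    have g_approx: "\<bar>Re (g \<mu>) - 2 * h \<mu>\<bar> \<le> 4 * exp (- (2 * pi * s))" if "\<mu> \<ge> 1" for \<mu>
    proof -
      have "1 * s \<le> sqrt \<mu> * s"
        using that s by (intro mult_right_mono) auto
      then have Y: "s \<le> Im (upole \<mu> s)"
        using upole_pos(3)[OF s, of \<mu>] that by linarith
      have "cis (- (pi * \<beta> * \<mu>)) * (2 * exp (\<i> * of_real pi * upole \<mu> s)) =
         of_real (2 * exp (- (pi * Im (upole \<mu> s)))) * (cis (- (pi * \<beta> * \<mu>)) * cis (pi * Re (upole \<mu> s)))"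
        by (simp add: exp_eq_polar)
      then have e: "cis (- (pi * \<beta> * \<mu>)) * (2 * exp (\<i> * of_real pi * upole \<mu> s)) =
         of_real (2 * exp (- (pi * Im (upole \<mu> s)))) * cis (pi * Re (upole \<mu> s) - pi * \<beta> * \<mu>)"
        unfolding cis_mult by (simp only: add.commute diff_conv_add_uminus)
      have "Re (cis (- (pi * \<beta> * \<mu>)) * (2 * exp (\<i> * of_real pi * upole \<mu> s))) = 2 * h \<mu>"
        unfolding e by (simp add: h_def)
      moreover have "cis (- (pi * \<beta> * \<mu>)) * (1 / cos (of_real pi * upole \<mu> s)) = g \<mu>"
        by (simp add: g_def)
      ultimately have "\<bar>Re (g \<mu>) - 2 * h \<mu>\<bar> = \<bar>Re (cis (- (pi * \<beta> * \<mu>)) * (1 / cos (of_real pi * upole \<mu> s) - 2 * exp (\<i> * of_real pi * upole \<mu> s)))\<bar>"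
        by (simp only: right_diff_distrib minus_complex.sel)
      also have "\<dots> \<le> norm (cis (- (pi * \<beta> * \<mu>)) * (1 / cos (of_real pi * upole \<mu> s) - 2 * exp (\<i> * of_real pi * upole \<mu> s)))"
        by (rule abs_Re_le_cmod)
      also have "\<dots> \<le> 4 * exp (- (3 * pi * Im (upole \<mu> s)))"
        unfolding norm_mult norm_cis using sec_approx[of "upole \<mu> s"] Y elim(2) by simp
      also have "2 * pi * s \<le> 3 * pi * Im (upole \<mu> s)"
        using Y s by (intro mult_mono) auto
      then have "4 * exp (- (3 * pi * Im (upole \<mu> s))) \<le> 4 * exp (- (2 * pi * s))"
        by simp
      finally show ?thesis .
    qed
    have g_uminus: "g (- \<mu>) = cnj (g \<mu>)" if "\<mu> > 0" for \<mu>
      using that s by (simp add: g_def upole_uminus cis_cnj cnj_cos)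
    have "(\<Sum>\<mu>\<in>{- 3, - 1, 1, 3}. cis (- (pi * \<beta> * \<mu>)) / cos (of_real (pi * s) * csqrt (2 * \<i> * of_real \<mu> - of_real (7 / (4 * s\<^sup>2))))) = (\<Sum>\<mu>\<in>{- 3, - 1, 1, 3}. g \<mu>)"
      by (simp only: g_def upole_def of_real_mult mult.assoc)
    also have "\<dots> = (g 1 + cnj (g 1)) + (g 3 + cnj (g 3))"
      using g_uminus[of 1] g_uminus[of 3] by simp
    also have "\<dots> = of_real (2 * Re (g 1) + 2 * Re (g 3))"
      by (simp add: complex_add_cnj)
    finally have main: "2 * of_real (s\<^sup>2) * (\<Sum>\<mu>\<in>{- 3, - 1, 1, 3}. cis (- (pi * \<beta> * \<mu>)) / cos (of_real (pi * s) * csqrt (2 * \<i> * of_real \<mu> - of_real (7 / (4 * s\<^sup>2)))))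
       = of_real (2 * s\<^sup>2 * (2 * Re (g 1) + 2 * Re (g 3)))"
      by simp
    have "\<bar>2 * s\<^sup>2 * (2 * Re (g 1) + 2 * Re (g 3)) - 8 * s\<^sup>2 * (h 1 + h 3)\<bar> = 4 * s\<^sup>2 * \<bar>(Re (g 1) - 2 * h 1) + (Re (g 3) - 2 * h 3)\<bar>"
    proof -
      have "2 * s\<^sup>2 * (2 * Re (g 1) + 2 * Re (g 3)) - 8 * s\<^sup>2 * (h 1 + h 3) = 4 * s\<^sup>2 * ((Re (g 1) - 2 * h 1) + (Re (g 3) - 2 * h 3))"
        by (simp add: algebra_simps)
      then show ?thesis
        by (simp only: abs_mult) simp
    qed
    also have "\<dots> \<le> 4 * s\<^sup>2 * (4 * exp (- (2 * pi * s)) + 4 * exp (- (2 * pi * s)))"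
      by (intro mult_left_mono order_trans[OF abs_triangle_ineq] add_mono g_approx) auto
    finally have d: "norm (complex_of_real (2 * s\<^sup>2 * (2 * Re (g 1) + 2 * Re (g 3))) - of_real (8 * s\<^sup>2 * (h 1 + h 3))) \<le> 32 * s\<^sup>2 * exp (- (2 * pi * s))"
      unfolding of_real_diff[symmetric] norm_of_real by simp
    have "h 1 + h 3 = exp (- (pi * Im (upole 1 s))) * cos (pi * Re (upole 1 s) - pi * \<beta>)
             + exp (- (pi * Im (upole 3 s))) * cos (pi * Re (upole 3 s) - 3 * pi * \<beta>)"
      by (simp add: h_def mult_ac)
    moreover have "norm (lambert (- 1 :: complex) a b (of_real (exp (- (pi / s\<^sup>2) / real a))) - of_real (8 * s\<^sup>2 * (h 1 + h 3)))
       \<le> K * s\<^sup>2 * exp (- (pi * 2 * s)) + 32 * s\<^sup>2 * exp (- (2 * pi * s))"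
    proof -
      have triangle: "norm (x - y) \<le> e + e'" if "norm (x - w) \<le> e" "norm (w - y) \<le> e'" for x y w :: complex and e e'
        using that dist_triangle[of x y w] by (simp add: dist_norm)
      show ?thesis
        by (rule triangle[OF elim(1)[unfolded main] d])
    qed
    ultimately show ?case
      by (simp add: algebra_simps)
  qed
  then show ?thesis
    using K unfolding \<beta>_def by (intro exI[of _ "K + 32"]) auto
qed

text \<open>For z other than - 1 exactly one \<mu> with cis (pi \<mu>) = z lies in (-1, 1), so the
  height c = 1 retains a single index. A single term cannot cancel, and relative to s^2 it is at
  least of order exp (- pi \<gamma> s) with \<gamma> < 1, which beats the remainder of order exp (-
  pi s).\<close>

theorem lambert_eventually_nonzero:
  fixes z :: complex
  assumes z: "norm z = 1" "z \<noteq> - 1" and a: "0 < a" "0 < b"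
  shows "\<forall>\<^sub>F s in at_top. lambert z a b (of_real (exp (- (pi / s\<^sup>2) / real a))) \<noteq> 0"
proof -
  define \<alpha> where "\<alpha> = Arg z / pi"
  have "z \<noteq> 0"
    using z by auto
  have cis\<alpha>: "cis (pi * \<alpha>) = z"
    using cis_Arg[OF \<open>z \<noteq> 0\<close>] z(1) by (simp add: \<alpha>_def sgn_div_norm)
  have "Arg z \<noteq> pi"
    using z(2) cis\<alpha> by (auto simp: \<alpha>_def)
  then have "\<bar>Arg z\<bar> < pi"
    using mpi_less_Arg[of z] Arg_le_pi[of z] by linarith
  then have \<alpha>: "\<bar>\<alpha>\<bar> < 1"
    by (simp add: \<alpha>_def)
  have M: "{\<mu>. cis (pi * \<mu>) = z \<and> \<bar>\<mu>\<bar> < 1\<^sup>2} = {\<alpha>}"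
  proof (intro equalityI subsetI)
    fix \<mu> :: real
    assume "\<mu> \<in> {\<mu>. cis (pi * \<mu>) = z \<and> \<bar>\<mu>\<bar> < 1\<^sup>2}"
    then have \<mu>: "cis (pi * \<mu>) = z" "\<bar>\<mu>\<bar> < 1"
      by auto
    then have "\<bar>pi * \<mu>\<bar> < pi"
      by (simp add: abs_mult)
    then have "Arg z = pi * \<mu>"
      using \<mu> z(1) by (intro cis_Arg_unique) (auto simp: sgn_div_norm)
    then show "\<mu> \<in> {\<alpha>}"
      by (simp add: \<alpha>_def)
  qed (use cis\<alpha> \<alpha> in auto)
  \<comment> \<open>The square of \<gamma> is the midpoint between |\<alpha>| and 1: it exceeds
    |\<alpha>| + \<epsilon> for small \<epsilon>, as the bound on the imaginary part of the pole
    requires, and is still below 1.\<close>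
  define \<gamma> where "\<gamma> = sqrt ((1 + \<bar>\<alpha>\<bar>) / 2)"
  have \<gamma>: "0 < \<gamma>" "\<gamma> < 1" "\<gamma>\<^sup>2 = (1 + \<bar>\<alpha>\<bar>) / 2"
    using \<alpha> by (auto simp: \<gamma>_def)
  have "\<exists>K>0. \<forall>\<^sub>F s in at_top.
    norm (lambert z a b (of_real (exp (- (pi / s\<^sup>2) / real a))) - 2 * of_real (s\<^sup>2) *
        (\<Sum>\<mu>\<in>{\<alpha>}. cis (- (pi * (real b / real a) * \<mu>)) / cos (of_real (pi * s) * csqrt (2 * \<i> * of_real \<mu> - of_real (7 / (4 * s\<^sup>2))))))
      \<le> K * s\<^sup>2 * exp (- (pi * 1 * s))" (is "\<exists>K>0. eventually (?Q K) at_top")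
    by (rule lambert_expansion[of z a b 1, unfolded M]) (use z a in \<open>auto simp: complex_eq_iff\<close>)
  then obtain K where K: "K > 0" and ev: "eventually (?Q K) at_top"
    by blast
  have "\<forall>\<^sub>F s in at_top. 7 / (4 * s\<^sup>2) < (1 - \<bar>\<alpha>\<bar>) / 2"
  proof (rule order_tendstoD(2))
    show "((\<lambda>s::real. 7 / (4 * s\<^sup>2)) \<longlongrightarrow> 0) at_top"
      by real_asymp
  qed (use \<alpha> in auto)
  moreover have "\<forall>\<^sub>F s in at_top. K * exp (- (pi * 1 * s)) < 2 * exp (- (pi * s * \<gamma>))"
    using K \<gamma>(1,2) by real_asymp
  ultimately show ?thesis
    using ev eventually_gt_at_top[of 0]
  proof eventually_elim
    case (elim s)
    define v where "v = csqrt (2 * \<i> * of_real \<alpha> - of_real (7 / (4 * s\<^sup>2)))"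
    have "\<bar>Im v\<bar> < \<gamma>"
      unfolding v_def
    proof (rule csqrt_abs_Im_less)
      show "\<bar>\<alpha>\<bar> + 7 / (4 * s\<^sup>2) < \<gamma>\<^sup>2"
        unfolding \<gamma>(3) using elim(1) by argo
    qed (use elim(4) \<gamma> in auto)
    have "norm (cos (of_real (pi * s) * v)) \<le> exp (pi * s * \<gamma>)"
    proof -
      have "norm (cos (of_real (pi * s) * v)) \<le> exp \<bar>Im (of_real (pi * s) * v)\<bar>"
        by (rule norm_cos_le_exp)
      also have "\<dots> \<le> exp (pi * s * \<gamma>)"
        using \<open>\<bar>Im v\<bar> < \<gamma>\<close> elim(4) by (simp add: abs_mult)
      finally show ?thesis .
    qed
    moreover have "cos (of_real (pi * s) * v) \<noteq> 0"
    proof (rule cos_nonzero_off_axis)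
      show "Im v \<noteq> 0"
        by (rule pole_off_axis[where \<epsilon> = "7 / (4 * s\<^sup>2)" and \<mu> = \<alpha>]) (use elim(4) in \<open>simp_all add: v_def\<close>)
    qed (use elim(4) in auto)
    ultimately have "exp (- (pi * s * \<gamma>)) \<le> 1 / norm (cos (of_real (pi * s) * v))"
      by (simp add: exp_minus divide_inverse le_imp_inverse_le)
    from mult_left_mono[OF this, of "2 * s\<^sup>2"]
    have "2 * s\<^sup>2 * exp (- (pi * s * \<gamma>)) \<le> norm (2 * of_real (s\<^sup>2) * (cis (- (pi * (real b / real a) * \<alpha>)) / cos (of_real (pi * s) * v)))"
      by (simp add: norm_mult norm_divide norm_power)
    moreover have "s\<^sup>2 * (K * exp (- (pi * 1 * s))) < s\<^sup>2 * (2 * exp (- (pi * s * \<gamma>)))"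
      using elim(2,4) by (intro mult_strict_left_mono) auto
    ultimately show ?case
      using elim(3) unfolding v_def by (auto simp: mult_ac)
  qed
qed

section \<open>Asymptotics of the zeros\<close>

lemma V_minus_eq_lambert:
  assumes "t > 0"
  shows "complex_of_real (V_minus t) = lambert (- 1) 1 1 (of_real (exp (- t)))"
proof -
  define Q where "Q = exp (- t)"
  have Q: "0 < Q" "Q < 1"
    using assms by (simp_all add: Q_def)
  note L = lambert_identity[of Q "- 1" 1 1]
  have s: "summable (\<lambda>m. Q * ((- 1) ^ m * Q ^ m * Phi (Q ^ (m + 1)) ^ 3))"
    using L(2) Q by (simp add: mult_ac)
  then have "summable (\<lambda>m. (- 1) ^ m * Q ^ m * Phi (Q ^ (m + 1)) ^ 3)"
    using Q by (subst (asm) summable_cmult_iff) simp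
  then have "V_minus t = (\<Sum>m. Q * ((- 1) ^ m * Q ^ m * Phi (Q ^ (m + 1)) ^ 3))"
    unfolding V_minus_def Let_def Q_def[symmetric] by (rule suminf_mult[symmetric])
  also have "\<dots> = (\<Sum>k. lambert_term (- 1) 1 1 Q k)"
    using L(1) Q by (simp add: mult_ac)
  finally have "complex_of_real (V_minus t) = (\<Sum>k. of_real (lambert_term (- 1) 1 1 Q k))"
    using summable_lambert_term[of Q "- 1" 1 1] Q by (simp add: suminf_of_real)
  then show ?thesis
    by (simp add: lambert_def lambert_term_def Q_def)
qed

text \<open>In the variable s = sqrt (pi / t) of the contour expansion the window condition thus
  reads |s - h| < 1/4.\<close>

lemma Theta_eq: "t > 0 \<Longrightarrow> Theta t = pi * sqrt (pi / t)"
proof -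
  assume "t > 0"
  have "pi powr (3 / 2) = pi powr (1 + 1 / 2)"
    by simp
  also have "\<dots> = pi * sqrt pi"
    using powr_half_sqrt[of pi] by (simp only: powr_add) simp
  finally have "pi powr (3 / 2) = pi * sqrt pi" .
  moreover have "t powr (- (1 / 2)) = inverse (sqrt t)"
    using \<open>t > 0\<close> powr_half_sqrt[of t] by (simp only: powr_minus)
  ultimately have "Theta t = pi * sqrt pi * inverse (sqrt t)"
    unfolding Theta_def by (rule arg_cong2)
  then show "Theta t = pi * sqrt (pi / t)"
    unfolding real_sqrt_divide by (simp only: divide_inverse mult.assoc)
qed

section \<open>Elementary estimates for asymptotic comparison\<close>

lemma hh_ge: "hh j \<ge> 1 / 2" and hh_pos: "hh j > 0"
  by (simp_all add: hh_def)

lemma bigo_hh_one: "(\<lambda>j. 1 / hh j) \<in> O(\<lambda>_. 1)"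
  unfolding hh_def by real_asymp

lemma bigo_hh_tendsto_0:
  assumes "f \<in> O(\<lambda>j. 1 / hh j)"
  shows "f \<longlonglongrightarrow> 0"
proof -
  obtain c where c: "\<forall>\<^sub>F j in sequentially. norm (f j) \<le> c * norm (1 / hh j)"
    using assms by (elim landau_o.bigE)
  have "(\<lambda>j. 1 / hh j) \<longlonglongrightarrow> 0"
    unfolding hh_def by real_asymp
  from tendsto_mult[OF tendsto_const tendsto_norm[OF this]]
  have "(\<lambda>j. c * norm (1 / hh j)) \<longlonglongrightarrow> c * norm (0 :: real)" .
  then show ?thesis
    using Lim_null_comparison[OF c] by simp
qed

lemma abs_exp_minus_one_le:
  fixes x :: real
  assumes "\<bar>x\<bar> \<le> 1"
  shows "\<bar>exp x - 1\<bar> \<le> 2 * \<bar>x\<bar>"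
proof (cases "x \<ge> 0")
  case True
  have "x * x \<le> x * 1"
    using assms True by (intro mult_left_mono) auto
  moreover have "exp x \<le> 1 + x + x\<^sup>2"
    using assms True by (intro exp_bound) auto
  ultimately show ?thesis
    using True exp_ge_add_one_self[of x] unfolding power2_eq_square by linarith
next
  case False
  then have "exp x < 1"
    by simp
  then show ?thesis
    using False exp_ge_add_one_self[of x] by linarith
qed

lemma exp_minus_one_bigo:
  assumes "f \<in> O(\<lambda>j. 1 / hh j)"
  shows "(\<lambda>j. exp (f j) - 1) \<in> O(\<lambda>j. 1 / hh j)"
proof -
  have "\<forall>\<^sub>F j in sequentially. \<bar>f j\<bar> < 1"
    using order_tendstoD(2)[OF tendsto_rabs[OF bigo_hh_tendsto_0[OF assms]], of 1] by simp
  then have "\<forall>\<^sub>F j in sequentially. norm (exp (f j) - 1) \<le> 2 * norm (f j)"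
    by eventually_elim (simp add: abs_exp_minus_one_le)
  then have "(\<lambda>j. exp (f j) - 1) \<in> O(f)"
    by (rule bigoI)
  then show ?thesis
    using assms by (rule landau_o.big_trans)
qed

lemma abs_cos_diff_le: "\<bar>cos x - cos y\<bar> \<le> \<bar>x - y\<bar>" for x y :: real
proof -
  have "\<bar>sin ((x + y) / 2)\<bar> * \<bar>sin ((y - x) / 2)\<bar> \<le> 1 * \<bar>(y - x) / 2\<bar>"
    by (rule mult_mono[OF abs_sin_le_one abs_sin_x_le_abs_x]) simp_all
  moreover have "\<bar>cos x - cos y\<bar> = 2 * (\<bar>sin ((x + y) / 2)\<bar> * \<bar>sin ((y - x) / 2)\<bar>)"
    unfolding cos_diff_cos abs_mult by simp
  ultimately have "\<bar>cos x - cos y\<bar> \<le> 2 * (1 * \<bar>(y - x) / 2\<bar>)"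
    by linarith
  also have "\<dots> = \<bar>x - y\<bar>"
    by (simp add: abs_minus_commute)
  finally show ?thesis .
qed

lemma cos_diff_bigo:
  assumes "(\<lambda>j. f j - g j) \<in> O[F](h)"
  shows "(\<lambda>j. cos (f j) - cos (g j) :: real) \<in> O[F](h)"
proof (rule landau_o.big_trans[OF bigoI assms])
  show "\<forall>\<^sub>F j in F. norm (cos (f j) - cos (g j)) \<le> 1 * norm (f j - g j)"
    unfolding real_norm_def mult_1 by (intro always_eventually allI abs_cos_diff_le)
qed

lemma cos_bigo_one: "(\<lambda>j. cos (f j) :: real) \<in> O[F](\<lambda>_. 1)"
  by (intro bigoI[of _ 1] always_eventually allI) simp

lemma abs_sin_minus_self_le: "\<bar>sin x - x\<bar> \<le> \<bar>x\<bar> ^ 3 / 6" for x :: real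
proof -
  have "(\<Sum>m<3. sin_coeff m * x ^ m) = x"
    by (simp add: sin_coeff_def numeral_3_eq_3)
  moreover have "inverse (fact 3) = (1 / 6 :: real)"
    by (simp add: fact_numeral)
  ultimately show ?thesis
    using Maclaurin_sin_bound[of x 3] by (simp only:)
qed

text \<open>A quantitative inverse of the sine near 0, for turning smallness of sin (pi \<delta>)
  into smallness of \<delta>. In this range the cubic error of the sine is at most |x| / 2.\<close>

lemma abs_le_two_abs_sin:
  fixes x :: real
  assumes "\<bar>x\<bar> \<le> 3 / 2"
  shows "\<bar>x\<bar> \<le> 2 * \<bar>sin x\<bar>"
proof -
  have "\<bar>x\<bar> ^ 2 \<le> (3 / 2) ^ 2"
    using assms by (intro power_mono) auto
  then have "\<bar>x\<bar> * \<bar>x\<bar> ^ 2 \<le> \<bar>x\<bar> * 3"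
    by (intro mult_left_mono) (auto simp: power_divide)
  then have "\<bar>x\<bar> ^ 3 / 6 \<le> \<bar>x\<bar> / 2"
    by (simp add: power3_eq_cube power2_eq_square)
  then show ?thesis
    using abs_sin_minus_self_le[of x] by linarith
qed

section \<open>Explicit roots for the poles, and t as a function of the real part\<close>

lemma upole_eq:
  fixes \<mu> s :: real
  defines "\<eta> \<equiv> 7 / (8 * \<mu>) / s\<^sup>2"
  assumes "\<mu> > 0"
  shows "Re (upole \<mu> s) = sqrt \<mu> * (s * sqrt (sqrt (1 + \<eta>\<^sup>2) - \<eta>))"
    and "Im (upole \<mu> s) = sqrt \<mu> * (s * sqrt (sqrt (1 + \<eta>\<^sup>2) + \<eta>))"
proof -
  define \<epsilon> where "\<epsilon> = 7 / (4 * s\<^sup>2)"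
  have \<epsilon>: "\<epsilon> = 2 * \<mu> * \<eta>"
    using assms by (simp add: \<epsilon>_def \<eta>_def)
  have "4 * \<mu>\<^sup>2 + \<epsilon>\<^sup>2 = (2 * \<mu>)\<^sup>2 * (1 + \<eta>\<^sup>2)"
    by (simp add: \<epsilon> power2_eq_square algebra_simps)
  then have "sqrt (4 * \<mu>\<^sup>2 + \<epsilon>\<^sup>2) = 2 * \<mu> * sqrt (1 + \<eta>\<^sup>2)"
    using assms by (simp add: real_sqrt_mult)
  then have "(sqrt (4 * \<mu>\<^sup>2 + \<epsilon>\<^sup>2) - \<epsilon>) / 2 = \<mu> * (sqrt (1 + \<eta>\<^sup>2) - \<eta>)"
    "(sqrt (4 * \<mu>\<^sup>2 + \<epsilon>\<^sup>2) + \<epsilon>) / 2 = \<mu> * (sqrt (1 + \<eta>\<^sup>2) + \<eta>)"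
    by (simp_all add: \<epsilon> field_simps)
  moreover have "Re (upole \<mu> s) = s * sqrt ((sqrt (4 * \<mu>\<^sup>2 + \<epsilon>\<^sup>2) - \<epsilon>) / 2)"
    "Im (upole \<mu> s) = s * sqrt ((sqrt (4 * \<mu>\<^sup>2 + \<epsilon>\<^sup>2) + \<epsilon>) / 2)"
    using assms(2) by (simp_all add: \<epsilon>_def upole_def cmod_def power_mult_distrib add.commute)
  ultimately show "Re (upole \<mu> s) = sqrt \<mu> * (s * sqrt (sqrt (1 + \<eta>\<^sup>2) - \<eta>))"
    "Im (upole \<mu> s) = sqrt \<mu> * (s * sqrt (sqrt (1 + \<eta>\<^sup>2) + \<eta>))"
    by (simp_all add: real_sqrt_mult)
qed

lemma nested_sqrt_asymptotics:
  assumes "c > 0"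
  shows "(\<lambda>s. s * sqrt (sqrt (1 + (c / s\<^sup>2)\<^sup>2) - c / s\<^sup>2) - s) \<in> O(\<lambda>s::real. 1 / s)"
    and "(\<lambda>s. s * sqrt (sqrt (1 + (c / s\<^sup>2)\<^sup>2) + c / s\<^sup>2) - s) \<in> O(\<lambda>s::real. 1 / s)"
  using assms by real_asymp+

lemma upole_asymptotics:
  assumes "\<mu> > 0"
  shows "(\<lambda>s. Re (upole \<mu> s) - sqrt \<mu> * s) \<in> O(\<lambda>s. 1 / s)"
    and "(\<lambda>s. Im (upole \<mu> s) - sqrt \<mu> * s) \<in> O(\<lambda>s. 1 / s)"
proof -
  have "0 < 7 / (8 * \<mu>)"
    using assms by simp
  note asymp = nested_sqrt_asymptotics[OF this]
  show "(\<lambda>s. Re (upole \<mu> s) - sqrt \<mu> * s) \<in> O(\<lambda>s. 1 / s)"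
    "(\<lambda>s. Im (upole \<mu> s) - sqrt \<mu> * s) \<in> O(\<lambda>s. 1 / s)"
    unfolding upole_eq[OF assms] right_diff_distrib[symmetric]
    using asymp assms by (simp_all only: landau_o.big.cmult_in_iff real_sqrt_eq_zero_cancel_iff less_imp_neq[symmetric] not_False_eq_True)
qed

definition t_of :: "real \<Rightarrow> real" where
  "t_of x = pi / (x * sqrt (x\<^sup>2 + 7 / 4))"

lemma t_star_eq: "t_star j = t_of (hh j)"
  by (simp add: t_star_def t_of_def)

text \<open>Because Im^2 = Re^2 + 7/4 and Re Im = s^2, the real part determines s and t without any
  error term. As \<open>t_star\<close> is the value of \<open>t_of\<close> at h, a zero is compared
  with it through the real part of its pole.\<close>

lemma upole_one_parametrisation:
  assumes "s > 0"
  shows "s\<^sup>2 = Re (upole 1 s) * sqrt ((Re (upole 1 s))\<^sup>2 + 7 / 4)" "pi / s\<^sup>2 = t_of (Re (upole 1 s))"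
proof -
  have "Im (upole 1 s) = sqrt ((Re (upole 1 s))\<^sup>2 + 7 / 4)"
    using upole_Re_Im(1)[OF assms, of 1] upole_pos(2)[OF assms, of 1] by (metis less_imp_le real_sqrt_unique zero_less_one)
  then show *: "s\<^sup>2 = Re (upole 1 s) * sqrt ((Re (upole 1 s))\<^sup>2 + 7 / 4)"
    using upole_Re_Im(2)[OF assms, of 1] by simp
  then show "pi / s\<^sup>2 = t_of (Re (upole 1 s))"
    by (simp add: t_of_def)
qed

definition t_of_deriv :: "real \<Rightarrow> real" where
  "t_of_deriv x = - pi * (2 * x\<^sup>2 + 7 / 4) / (x\<^sup>2 * (x\<^sup>2 + 7 / 4) * sqrt (x\<^sup>2 + 7 / 4))"

lemma t_of_has_derivative:
  assumes "x > 0"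
  shows "(t_of has_real_derivative t_of_deriv x) (at x)"
proof -
  define r where "r = sqrt (x\<^sup>2 + 7 / 4)"
  have "x\<^sup>2 + 7 / 4 > 0"
    by (simp add: add_nonneg_pos)
  then have r: "r > 0" "r\<^sup>2 = x\<^sup>2 + 7 / 4"
    by (simp_all add: r_def)
  have "(t_of has_real_derivative - (pi * (1 * r + x * (2 * x * (inverse r / 2)))) / (x * r)\<^sup>2) (at x)"
    unfolding t_of_def[abs_def] r_def
    using assms \<open>x\<^sup>2 + 7 / 4 > 0\<close> by (auto intro!: derivative_eq_intros simp: power2_eq_square)
  also have "- (pi * (1 * r + x * (2 * x * (inverse r / 2)))) / (x * r)\<^sup>2 = - (pi * (r\<^sup>2 + x\<^sup>2)) / (x\<^sup>2 * r\<^sup>2 * r)"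
    using r(1) assms by (simp add: field_simps power2_eq_square)
  also have "\<dots> = t_of_deriv x"
    unfolding r(2) by (simp add: t_of_deriv_def r_def)
  finally show ?thesis .
qed

lemma t_of_mean_value_less:
  assumes "0 < x" "x < y"
  shows "\<exists>\<xi>>x. \<xi> < y \<and> t_of y - t_of x = (y - x) * t_of_deriv \<xi>"
  by (rule MVT2[OF assms(2), where f = t_of and f' = t_of_deriv])
     (rule t_of_has_derivative, use assms in linarith)

text \<open>The sign of x - y is unknown in the application, so the intermediate point is located
  only by its distance to y.\<close>

lemma t_of_mean_value:
  assumes "x > 0" "y > 0"
  shows "\<exists>\<xi>. \<bar>\<xi> - y\<bar> \<le> \<bar>x - y\<bar> \<and> t_of x - t_of y = (x - y) * t_of_deriv \<xi>"
proof (cases x y rule: linorder_cases)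
  case less
  obtain \<xi> where \<xi>: "x < \<xi>" "\<xi> < y" "t_of y - t_of x = (y - x) * t_of_deriv \<xi>"
    using t_of_mean_value_less[OF assms(1) less] by (elim exE conjE)
  have "t_of x - t_of y = - (t_of y - t_of x)"
    by simp
  also have "\<dots> = (x - y) * t_of_deriv \<xi>"
    unfolding \<xi>(3) by (simp only: mult_minus_left[symmetric] minus_diff_eq)
  finally have "t_of x - t_of y = (x - y) * t_of_deriv \<xi>" .
  moreover have "\<bar>\<xi> - y\<bar> \<le> \<bar>x - y\<bar>"
    using \<xi>(1,2) by simp
  ultimately show ?thesis
    by blast
next
  case greater
  obtain \<xi> where \<xi>: "y < \<xi>" "\<xi> < x" "t_of x - t_of y = (x - y) * t_of_deriv \<xi>"
    using t_of_mean_value_less[OF assms(2) greater] by (elim exE conjE)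
  moreover have "\<bar>\<xi> - y\<bar> \<le> \<bar>x - y\<bar>"
    using \<xi>(1,2) by simp
  ultimately show ?thesis
    by blast
next
  case equal
  show ?thesis
    unfolding equal by (rule exI[of _ y]) simp
qed

lemma t_of_deriv_asymptotics: "(\<lambda>x. t_of_deriv x * x ^ 3 + 2 * pi) \<in> O(\<lambda>x. 1 / x)"
  unfolding t_of_deriv_def by real_asymp

lemma sqrt_asymptotics: "(\<lambda>x. sqrt (x * sqrt (x\<^sup>2 + 7 / 4)) - (x + 7 / (16 * x))) \<in> O(\<lambda>x. 1 / x ^ 3)"
  by real_asymp

text \<open>Divide the expansion for a = b = 1 by the amplitude 8 s^2 exp (- pi Im u) of the leading
  pair, u being the pole of index 1. The phase shifts are then pi and 3 pi, and both cosines merely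
  change sign.\<close>

lemma V_minus_asymptotics:
  "\<exists>K>0. \<forall>\<^sub>F s in at_top. V_minus (pi / s\<^sup>2) = 0 \<longrightarrow>
     \<bar>cos (pi * Re (upole 1 s)) + exp (- (pi * (Im (upole 3 s) - Im (upole 1 s)))) * cos (pi * Re (upole 3 s))\<bar>
       \<le> K * exp (pi * Im (upole 1 s) - 2 * pi * s)"
proof -
  obtain K where K: "K > 0" and ev: "\<forall>\<^sub>F s in at_top. norm (lambert (- 1 :: complex) 1 1 (of_real (exp (- (pi / s\<^sup>2) / real 1)))
      - of_real (8 * s\<^sup>2 * (exp (- (pi * Im (upole 1 s))) * cos (pi * Re (upole 1 s) - pi * (real 1 / real 1))
             + exp (- (pi * Im (upole 3 s))) * cos (pi * Re (upole 3 s) - 3 * pi * (real 1 / real 1)))))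
     \<le> K * s\<^sup>2 * exp (- (2 * pi * s))"
    using lambert_minus_one_asymptotics[OF zero_less_one zero_less_one] by blast
  have "\<forall>\<^sub>F s in at_top. V_minus (pi / s\<^sup>2) = 0 \<longrightarrow>
     \<bar>cos (pi * Re (upole 1 s)) + exp (- (pi * (Im (upole 3 s) - Im (upole 1 s)))) * cos (pi * Re (upole 3 s))\<bar>
       \<le> K / 8 * exp (pi * Im (upole 1 s) - 2 * pi * s)"
    using ev eventually_gt_at_top[of 0]
  proof (eventually_elim, intro impI)
    fix s :: real
    assume s: "s > 0" and zero: "V_minus (pi / s\<^sup>2) = 0"
      and bound: "norm (lambert (- 1 :: complex) 1 1 (of_real (exp (- (pi / s\<^sup>2) / real 1)))
      - of_real (8 * s\<^sup>2 * (exp (- (pi * Im (upole 1 s))) * cos (pi * Re (upole 1 s) - pi * (real 1 / real 1))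
             + exp (- (pi * Im (upole 3 s))) * cos (pi * Re (upole 3 s) - 3 * pi * (real 1 / real 1)))))
     \<le> K * s\<^sup>2 * exp (- (2 * pi * s))"
    define X1 X3 Y1 Y3 where "X1 = pi * Re (upole 1 s)" and "X3 = pi * Re (upole 3 s)"
      and "Y1 = pi * Im (upole 1 s)" and "Y3 = pi * Im (upole 3 s)"
    have zero': "lambert (- 1 :: complex) 1 1 (of_real (exp (- (pi / s\<^sup>2) / real 1))) = 0"
      using V_minus_eq_lambert[of "pi / s\<^sup>2"] s zero by simp
    have "cos (X3 - 3 * pi) = cos ((X3 - pi) - 2 * pi)"
      by (rule arg_cong) simp
    then have cos: "cos (X1 - pi * (real 1 / real 1)) = - cos X1" "cos (X3 - 3 * pi * (real 1 / real 1)) = - cos X3"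
      by (simp_all add: cos_diff)
    have "norm (0 - complex_of_real (8 * s\<^sup>2 * (exp (- Y1) * - cos X1 + exp (- Y3) * - cos X3))) \<le> K * s\<^sup>2 * exp (- (2 * pi * s))"
      using bound unfolding zero' X1_def[symmetric] X3_def[symmetric] Y1_def[symmetric] Y3_def[symmetric] cos .
    then have "\<bar>8 * s\<^sup>2 * (exp (- Y1) * - cos X1 + exp (- Y3) * - cos X3)\<bar> \<le> K * s\<^sup>2 * exp (- (2 * pi * s))"
      unfolding diff_0 norm_minus_cancel norm_of_real .
    moreover have "8 * s\<^sup>2 * (exp (- Y1) * - cos X1 + exp (- Y3) * - cos X3) = - (8 * s\<^sup>2 * (exp (- Y1) * cos X1 + exp (- Y3) * cos X3))"
      by (simp add: algebra_simps)
    ultimately have "\<bar>8 * s\<^sup>2 * (exp (- Y1) * cos X1 + exp (- Y3) * cos X3)\<bar> \<le> K * s\<^sup>2 * exp (- (2 * pi * s))"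
      by (simp only: abs_minus_cancel)
    then have "8 * (s\<^sup>2 * \<bar>exp (- Y1) * cos X1 + exp (- Y3) * cos X3\<bar>) \<le> K * s\<^sup>2 * exp (- (2 * pi * s))"
      by (simp only: abs_mult abs_numeral abs_power2 mult.assoc)
    then have "s\<^sup>2 * \<bar>exp (- Y1) * cos X1 + exp (- Y3) * cos X3\<bar> \<le> s\<^sup>2 * (K / 8 * exp (- (2 * pi * s)))"
      by (simp add: mult_ac)
    then have "\<bar>exp (- Y1) * cos X1 + exp (- Y3) * cos X3\<bar> \<le> K / 8 * exp (- (2 * pi * s))"
      using s by (simp only: mult_le_cancel_left_pos zero_less_power)
    then have le: "exp Y1 * \<bar>exp (- Y1) * cos X1 + exp (- Y3) * cos X3\<bar> \<le> exp Y1 * (K / 8 * exp (- (2 * pi * s)))"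
      by (rule mult_left_mono) simp
    have eq1: "exp Y1 * \<bar>exp (- Y1) * cos X1 + exp (- Y3) * cos X3\<bar> = \<bar>cos X1 + exp (- (Y3 - Y1)) * cos X3\<bar>"
    proof -
      have "exp Y1 * \<bar>exp (- Y1) * cos X1 + exp (- Y3) * cos X3\<bar> = \<bar>exp Y1 * (exp (- Y1) * cos X1 + exp (- Y3) * cos X3)\<bar>"
        by (simp only: abs_mult abs_exp_cancel)
      also have "exp Y1 * (exp (- Y1) * cos X1 + exp (- Y3) * cos X3) = exp (Y1 + - Y1) * cos X1 + exp (Y1 + - Y3) * cos X3"
        by (simp only: distrib_left mult.assoc exp_add)
      also have "\<dots> = cos X1 + exp (- (Y3 - Y1)) * cos X3"
        by simp
      finally show ?thesis .
    qed
    have eq2: "exp Y1 * (K / 8 * exp (- (2 * pi * s))) = K / 8 * exp (Y1 - 2 * pi * s)"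
    proof -
      have "exp (Y1 - 2 * pi * s) = exp Y1 * exp (- (2 * pi * s))"
        unfolding exp_add[symmetric] by simp
      then show ?thesis
        by (simp only: mult.left_commute)
    qed
    have le': "\<bar>cos X1 + exp (- (Y3 - Y1)) * cos X3\<bar> \<le> K / 8 * exp (Y1 - 2 * pi * s)"
      using le unfolding eq1 eq2 .
    have eq3: "pi * (Im (upole 3 s) - Im (upole 1 s)) = Y3 - Y1"
      unfolding Y1_def Y3_def by (rule right_diff_distrib)
    show "\<bar>cos (pi * Re (upole 1 s)) + exp (- (pi * (Im (upole 3 s) - Im (upole 1 s)))) * cos (pi * Re (upole 3 s))\<bar>
       \<le> K / 8 * exp (pi * Im (upole 1 s) - 2 * pi * s)"
      unfolding eq3 X1_def[symmetric] X3_def[symmetric] Y1_def[symmetric] by (rule le')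
  qed
  then show ?thesis
    using K by (intro exI[of _ "K / 8"]) auto
qed

lemma bigo_compose_hh:
  fixes f :: "real \<Rightarrow> real"
  assumes f: "f \<in> O[at_top](\<lambda>x. 1 / x ^ n)" and y: "\<forall>\<^sub>F j in sequentially. hh j / 2 \<le> y j"
  shows "(\<lambda>j. f (y j)) \<in> O(\<lambda>j. 1 / hh j ^ n)"
proof -
  have "filterlim (\<lambda>j. hh j / 2) at_top sequentially"
    unfolding hh_def by real_asymp
  then have "filterlim y at_top sequentially"
    using y by (rule filterlim_at_top_mono)
  from landau_o.big.compose[OF f this] have "(\<lambda>j. f (y j)) \<in> O(\<lambda>j. 1 / y j ^ n)" .
  also have "(\<lambda>j. 1 / y j ^ n) \<in> O(\<lambda>j. 1 / hh j ^ n)"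
  proof (rule bigoI[of _ "2 ^ n"])
    show "\<forall>\<^sub>F j in sequentially. norm (1 / y j ^ n) \<le> 2 ^ n * norm (1 / hh j ^ n)"
      using y
    proof eventually_elim
      case (elim j)
      have "(hh j / 2) ^ n \<le> y j ^ n"
        using elim hh_pos[of j] by (intro power_mono) auto
      moreover have "0 < y j" "0 < hh j"
        using elim hh_pos[of j] by linarith+
      ultimately have "1 / y j ^ n \<le> 1 / (hh j / 2) ^ n"
        by (intro divide_left_mono mult_pos_pos) auto
      then show ?case
        using \<open>0 < y j\<close> \<open>0 < hh j\<close> by (simp add: power_divide)
    qed
  qed
  finally show ?thesis .
qed

section \<open>A sequence of zeros in the windows\<close>

locale zero_sequence =
  fixes t s :: "nat \<Rightarrow> real"
  assumes zero: "\<forall>\<^sub>F j in sequentially. t j > 0 \<and> V_minus (t j) = 0 \<and> in_window j (t j)"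
  defines "s \<equiv> \<lambda>j. sqrt (pi / t j)"
begin

text \<open>For large j, t j is \<open>t_of (x j)\<close> while \<open>t_star j\<close> is
  \<open>t_of (hh j)\<close>. So \<delta> is the displacement of the zero in the coordinate in which
  the leading pair is exact, and E is its expected size, the order of the ratio of the amplitudes of
  the pairs 3 and 1.\<close>

definition "x j = Re (upole 1 (s j))"
definition "\<delta> j = x j - hh j"
definition "\<kappa> = sqrt 3 - (1::real)"
definition "E j = exp (- (\<kappa> * pi * hh j))"

lemma \<kappa>: "0 < \<kappa>" "\<kappa> < 1"
  using real_sqrt_less_mono[of 1 3] real_sqrt_less_mono[of 3 4] by (simp_all add: \<kappa>_def)

lemma s_window: "\<forall>\<^sub>F j in sequentially. t j > 0 \<and> s j > 0 \<and> \<bar>s j - hh j\<bar> < 1 / 4 \<and> t j = pi / (s j)\<^sup>2"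
  using zero
proof eventually_elim
  case (elim j)
  then have "Theta (t j) = pi * s j"
    by (simp add: Theta_eq s_def)
  then have "pi * (s j - hh j) = Theta (t j) - pi * (real j + 1 / 2)"
    by (simp only: hh_def right_diff_distrib)
  moreover have "\<bar>Theta (t j) - pi * (real j + 1 / 2)\<bar> < pi * (1 / 4)"
    using elim unfolding in_window_def by simp
  ultimately have "\<bar>pi * (s j - hh j)\<bar> < pi * (1 / 4)"
    by (simp only:)
  then have "\<bar>s j - hh j\<bar> < 1 / 4"
    unfolding abs_mult by (simp only: abs_of_pos[OF pi_gt_zero] mult_less_cancel_left_pos[OF pi_gt_zero])
  with elim show ?case
    by (simp add: s_def)
qed

lemma s_large: "\<forall>\<^sub>F j in sequentially. hh j / 2 \<le> s j"
  using s_window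
proof eventually_elim
  case (elim j)
  then have "\<bar>s j - hh j\<bar> < 1 / 4"
    by blast
  with hh_ge[of j] show ?case
    by linarith
qed

lemma filterlim_s: "filterlim s at_top sequentially"
proof (rule filterlim_at_top_mono[OF _ s_large])
  show "filterlim (\<lambda>j. hh j / 2) at_top sequentially"
    unfolding hh_def by real_asymp
qed

lemma upole_bigo:
  assumes "\<mu> > 0"
  shows "(\<lambda>j. Re (upole \<mu> (s j)) - sqrt \<mu> * s j) \<in> O(\<lambda>j. 1 / hh j)"
    and "(\<lambda>j. Im (upole \<mu> (s j)) - sqrt \<mu> * s j) \<in> O(\<lambda>j. 1 / hh j)"
  using bigo_compose_hh[of _ 1, OF _ s_large] upole_asymptotics[OF assms] by simp_all

lemma \<delta>_small: "\<forall>\<^sub>F j in sequentially. \<bar>\<delta> j\<bar> < 1 / 3"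
proof -
  have "(\<lambda>j. x j - s j) \<in> O(\<lambda>j. 1 / hh j)"
    using upole_bigo(1)[of 1] by (simp add: x_def)
  \<comment> \<open>Here 1/12 = 1/3 - 1/4 is the room left by the window |s - h| < 1/4. The bound
    1/3 on \<delta> keeps |pi \<delta>| below 3/2, as \<open>abs_le_two_abs_sin\<close>
    requires.\<close>
  from order_tendstoD(2)[OF tendsto_rabs[OF bigo_hh_tendsto_0[OF this]], of "1 / 12"]
  have "\<forall>\<^sub>F j in sequentially. \<bar>x j - s j\<bar> < 1 / 12"
    by simp
  with s_window show ?thesis
  proof eventually_elim
    case (elim j)
    then have "\<bar>s j - hh j\<bar> < 1 / 4"
      by blast
    with elim(2) show ?case
      unfolding \<delta>_def by linarith
  qed
qed

lemma cos_x: "cos (pi * x j) = - ((- 1) ^ j * sin (pi * \<delta> j))"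
proof -
  have "pi * x j = pi * (real j + 1 / 2) + pi * \<delta> j"
    by (simp add: \<delta>_def hh_def algebra_simps)
  then show ?thesis
    by (simp only: cos_add cos_half_integer sin_half_integer)
qed

lemma E_bigo: "E \<in> O(\<lambda>j. 1 / hh j)" "E \<in> O(\<lambda>j. 1 / hh j ^ 3)"
  unfolding E_def hh_def using \<kappa> by real_asymp+

definition "A j = exp (- (pi * (Im (upole 3 (s j)) - Im (upole 1 (s j)) - \<kappa> * s j)))"

lemma A_bigo: "(\<lambda>j. A j - 1) \<in> O(\<lambda>j. 1 / hh j)"
proof -
  have "(\<lambda>j. (Im (upole 3 (s j)) - sqrt 3 * s j) - (Im (upole 1 (s j)) - sqrt 1 * s j)) \<in> O(\<lambda>j. 1 / hh j)"
    by (intro sum_in_bigo upole_bigo) auto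
  then have "(\<lambda>j. - pi * ((Im (upole 3 (s j)) - sqrt 3 * s j) - (Im (upole 1 (s j)) - sqrt 1 * s j))) \<in> O(\<lambda>j. 1 / hh j)"
    by simp
  then have "(\<lambda>j. - (pi * (Im (upole 3 (s j)) - Im (upole 1 (s j)) - \<kappa> * s j))) \<in> O(\<lambda>j. 1 / hh j)"
    by (rule landau_o.big.in_cong[THEN iffD1, rotated]) (intro always_eventually allI, simp add: \<kappa>_def algebra_simps)
  from exp_minus_one_bigo[OF this] show ?thesis
    by (simp add: A_def)
qed

lemma bigo_one_if: "(\<lambda>j. f j - 1) \<in> O(\<lambda>j. 1 / hh j) \<Longrightarrow> f \<in> O(\<lambda>_. 1)"
proof -
  assume "(\<lambda>j. f j - 1) \<in> O(\<lambda>j. 1 / hh j)"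
  then have "(\<lambda>j. f j - 1) \<in> O(\<lambda>_. 1)"
    using bigo_hh_one by (rule landau_o.big_trans)
  then have "(\<lambda>j. (f j - 1) + 1) \<in> O(\<lambda>_. 1)"
    by (rule sum_in_bigo) simp
  then show ?thesis
    by simp
qed

text \<open>The factor \<open>exp (- (\<kappa> \<pi> s)) * A\<close> is the amplitude of the pole pair \<open>\<plusminus>3\<close> relative to that of the pair \<open>\<plusminus>1\<close>, so
  \<open>r\<close> is the relative contour remainder at a zero.\<close>

definition "r j = cos (pi * x j) + exp (- (\<kappa> * pi * s j)) * A j * cos (pi * Re (upole 3 (s j)))"

text \<open>The remainder exp (pi Im u - 2 pi s) is exp (- pi s) times exp (pi (Im u - s)), and the
  second factor tends to 1 because Im u - s is O(1/h).\<close>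

lemma r_bigo: "r \<in> O(\<lambda>j. exp (- (pi * s j)))"
proof -
  obtain K where K: "K > 0" and ev: "\<forall>\<^sub>F s in at_top. V_minus (pi / s\<^sup>2) = 0 \<longrightarrow>
     \<bar>cos (pi * Re (upole 1 s)) + exp (- (pi * (Im (upole 3 s) - Im (upole 1 s)))) * cos (pi * Re (upole 3 s))\<bar>
       \<le> K * exp (pi * Im (upole 1 s) - 2 * pi * s)"
    using V_minus_asymptotics by blast
  have "\<forall>\<^sub>F j in sequentially. V_minus (pi / (s j)\<^sup>2) = 0 \<longrightarrow>
     \<bar>cos (pi * Re (upole 1 (s j))) + exp (- (pi * (Im (upole 3 (s j)) - Im (upole 1 (s j))))) * cos (pi * Re (upole 3 (s j)))\<bar>
       \<le> K * exp (pi * Im (upole 1 (s j)) - 2 * pi * s j)"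
    using filterlim_s ev unfolding filterlim_iff by blast
  with zero s_window have "\<forall>\<^sub>F j in sequentially. norm (r j) \<le> K * norm (exp (pi * Im (upole 1 (s j)) - 2 * pi * s j))"
  proof eventually_elim
    case (elim j)
    have "exp (- (pi * (Im (upole 3 (s j)) - Im (upole 1 (s j))))) = exp (- (\<kappa> * pi * s j)) * A j"
      unfolding A_def exp_add[symmetric] by (simp add: algebra_simps)
    with elim show ?case
      by (simp add: r_def x_def)
  qed
  then have "r \<in> O(\<lambda>j. exp (pi * Im (upole 1 (s j)) - 2 * pi * s j))"
    by (rule bigoI)
  also have "(\<lambda>j. exp (pi * Im (upole 1 (s j)) - 2 * pi * s j)) = (\<lambda>j. exp (pi * (Im (upole 1 (s j)) - s j)) * exp (- (pi * s j)))"
    unfolding exp_add[symmetric] by (simp add: algebra_simps)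
  also have "\<dots> \<in> O(\<lambda>j. 1 * exp (- (pi * s j)))"
  proof (intro landau_o.big.mult bigo_one_if exp_minus_one_bigo)
    show "(\<lambda>j. pi * (Im (upole 1 (s j)) - s j)) \<in> O(\<lambda>j. 1 / hh j)"
      using upole_bigo(2)[of 1] by simp
  qed auto
  finally show ?thesis
    by simp
qed

text \<open>Only the window bound |s - h| < 1/4 is available at this stage; it costs the constant
  exp (c pi / 4).\<close>

lemma exp_s_bigo:
  assumes "c \<ge> 0"
  shows "(\<lambda>j. exp (- (c * pi * s j))) \<in> O(\<lambda>j. exp (- (c * pi * hh j)))"
proof (rule bigoI[of _ "exp (c * pi / 4)"])
  show "\<forall>\<^sub>F j in sequentially. norm (exp (- (c * pi * s j))) \<le> exp (c * pi / 4) * norm (exp (- (c * pi * hh j)))"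
    using s_window
  proof eventually_elim
    case (elim j)
    then have "\<bar>s j - hh j\<bar> < 1 / 4"
      by blast
    then have "hh j - 1 / 4 \<le> s j"
      by linarith
    then have "c * pi * (hh j - 1 / 4) \<le> c * pi * s j"
      using assms by (intro mult_left_mono) auto
    then have "exp (- (c * pi * s j)) \<le> exp (c * pi / 4 + - (c * pi * hh j))"
      by (simp add: algebra_simps)
    then show ?case
      unfolding exp_add by simp
  qed
qed

text \<open>First round, with the window bound on s: the pair 3 and the remainder are both O(E), the
  latter because \<kappa> < 1. Hence sin (pi \<delta>) is O(E), and with it \<delta>.\<close>

lemma \<delta>_bigo: "\<delta> \<in> O(E)"
proof -
  have 1: "(\<lambda>j. exp (- (\<kappa> * pi * s j))) \<in> O(E)"
    unfolding E_def using \<kappa> by (intro exp_s_bigo) simp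
  have "(\<lambda>j. exp (- (\<kappa> * pi * s j)) * A j * cos (pi * Re (upole 3 (s j)))) \<in> O(\<lambda>j. E j * 1 * 1)"
    by (intro landau_o.big.mult 1 bigo_one_if A_bigo cos_bigo_one)
  moreover have "r \<in> O(E)"
  proof -
    have "(\<lambda>j. exp (- (1 * pi * s j))) \<in> O(\<lambda>j. exp (- (1 * pi * hh j)))"
      by (rule exp_s_bigo) simp
    also have "(\<lambda>j. exp (- (1 * pi * hh j))) \<in> O(E)"
      unfolding E_def hh_def using \<kappa> by real_asymp
    finally show ?thesis
      using landau_o.big_trans[OF r_bigo] by simp
  qed
  ultimately have "(\<lambda>j. r j - exp (- (\<kappa> * pi * s j)) * A j * cos (pi * Re (upole 3 (s j)))) \<in> O(E)"
    by (intro sum_in_bigo) simp_all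
  then have cos_E: "(\<lambda>j. cos (pi * x j)) \<in> O(E)"
    by (simp add: r_def)
  have "\<forall>\<^sub>F j in sequentially. norm (\<delta> j) \<le> 2 / pi * norm (cos (pi * x j))"
    using \<delta>_small
  proof eventually_elim
    case (elim j)
    have "pi * \<bar>\<delta> j\<bar> \<le> pi * (1 / 3)"
      using elim by (intro mult_left_mono) auto
    then have "pi * \<bar>\<delta> j\<bar> \<le> 3 / 2"
      using pi_less_4 by linarith
    then have "\<bar>pi * \<delta> j\<bar> \<le> 3 / 2"
      by (simp add: abs_mult)
    then have "\<bar>pi * \<delta> j\<bar> \<le> 2 * \<bar>sin (pi * \<delta> j)\<bar>"
      by (rule abs_le_two_abs_sin)
    then show ?case
      unfolding cos_x by (simp add: abs_mult field_simps)
  qed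
  then have "\<delta> \<in> O(\<lambda>j. cos (pi * x j))"
    by (rule bigoI)
  then show ?thesis
    using cos_E by (rule landau_o.big_trans)
qed

text \<open>Feeding the first round back sharpens the window. Now exp (- \<kappa> pi s) equals E up
  to a factor 1 + O(1/h), which is needed to obtain the leading constant.\<close>

lemma s_minus_hh_bigo: "(\<lambda>j. s j - hh j) \<in> O(\<lambda>j. 1 / hh j)"
proof -
  have "(\<lambda>j. \<delta> j - (Re (upole 1 (s j)) - sqrt 1 * s j)) \<in> O(\<lambda>j. 1 / hh j)"
    by (intro sum_in_bigo upole_bigo landau_o.big_trans[OF \<delta>_bigo E_bigo(1)]) auto
  then show ?thesis
    by (simp add: \<delta>_def x_def)
qed

text \<open>Second round: in the contribution of the pair 3, the amplitude correction A, the
  exponential ratio B and the cosine C each differ by O(1/h) from their limiting forms 1, 1 and cos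
  (sqrt 3 pi h). The remainder divided by E is exponentially small because \<kappa> < 1.\<close>

lemma cos_x_refined: "(\<lambda>j. cos (pi * x j) / E j + cos (sqrt 3 * pi * hh j)) \<in> O(\<lambda>j. 1 / hh j)"
proof -
  define B where "B = (\<lambda>j. exp (- (\<kappa> * pi * (s j - hh j))))"
  define C where "C = (\<lambda>j. cos (pi * Re (upole 3 (s j))))"
  have B: "(\<lambda>j. B j - 1) \<in> O(\<lambda>j. 1 / hh j)"
    unfolding B_def by (intro exp_minus_one_bigo) (use s_minus_hh_bigo in simp)
  have AB: "(\<lambda>j. (A j - 1) * B j + (B j - 1)) \<in> O(\<lambda>j. 1 / hh j)"
    using landau_o.big.mult[OF A_bigo bigo_one_if[OF B]] by (intro sum_in_bigo B) simp
  have "(\<lambda>j. pi * (Re (upole 3 (s j)) - sqrt 3 * s j) + sqrt 3 * pi * (s j - hh j)) \<in> O(\<lambda>j. 1 / hh j)"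
    using upole_bigo(1)[of 3] s_minus_hh_bigo by (intro sum_in_bigo) simp_all
  then have "(\<lambda>j. pi * Re (upole 3 (s j)) - sqrt 3 * pi * hh j) \<in> O(\<lambda>j. 1 / hh j)"
    by (simp add: algebra_simps)
  then have C: "(\<lambda>j. C j - cos (sqrt 3 * pi * hh j)) \<in> O(\<lambda>j. 1 / hh j)"
    unfolding C_def by (rule cos_diff_bigo)
  have "(\<lambda>j. ((A j - 1) * B j + (B j - 1)) * C j) \<in> O(\<lambda>j. 1 / hh j * 1)"
    by (rule landau_o.big.mult[OF AB]) (simp add: C_def cos_bigo_one)
  then have ABC: "(\<lambda>j. ((A j - 1) * B j + (B j - 1)) * C j + (C j - cos (sqrt 3 * pi * hh j))) \<in> O(\<lambda>j. 1 / hh j)"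
    by (intro sum_in_bigo C) simp
  have R: "(\<lambda>j. r j / E j) \<in> O(\<lambda>j. 1 / hh j)"
  proof -
    have "(\<lambda>j. exp (- (1 * pi * s j))) \<in> O(\<lambda>j. exp (- (1 * pi * hh j)))"
      by (rule exp_s_bigo) simp
    with r_bigo have "r \<in> O(\<lambda>j. exp (- (pi * hh j)))"
      by (simp add: landau_o.big_trans)
    then have "(\<lambda>j. r j * inverse (E j)) \<in> O(\<lambda>j. exp (- (pi * hh j)) * inverse (E j))"
      by (rule landau_o.big.mult) simp
    also have "(\<lambda>j. exp (- (pi * hh j)) * inverse (E j)) \<in> O(\<lambda>j. 1 / hh j)"
      unfolding E_def hh_def using \<kappa> by real_asymp
    finally show ?thesis
      by (simp add: divide_inverse)
  qed
  \<comment> \<open>Telescopes the difference of A B C and cos (sqrt 3 pi h), replacing one factor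
    at a time.\<close>
  have eq: "cos (pi * x j) / E j + cos (sqrt 3 * pi * hh j)
      = r j / E j - (((A j - 1) * B j + (B j - 1)) * C j + (C j - cos (sqrt 3 * pi * hh j)))" for j
  proof -
    have "exp (- (\<kappa> * pi * s j)) = E j * B j"
      unfolding E_def B_def exp_add[symmetric] by (simp add: algebra_simps)
    then have "cos (pi * x j) = r j - E j * B j * A j * C j"
      by (simp add: r_def C_def)
    moreover have "E j > 0"
      by (simp add: E_def)
    ultimately show ?thesis
      by (simp add: field_simps)
  qed
  show ?thesis
    unfolding eq by (rule sum_in_bigo(2)[OF R ABC])
qed

lemma \<delta>_refined: "(\<lambda>j. pi * \<delta> j / E j - (- 1) ^ j * cos (sqrt 3 * pi * hh j)) \<in> O(\<lambda>j. 1 / hh j)"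
proof -
  have E: "E j > 0" for j
    by (simp add: E_def)
  \<comment> \<open>A quadratic bound is enough: \<delta> is O(E), so after division by E the error
    is still O(E).\<close>
  have "(\<lambda>j. sin (pi * \<delta> j) - pi * \<delta> j) \<in> O(\<lambda>j. \<delta> j * \<delta> j)"
  proof (rule bigoI)
    show "\<forall>\<^sub>F j in sequentially. norm (sin (pi * \<delta> j) - pi * \<delta> j) \<le> (pi ^ 3 / 6) * norm (\<delta> j * \<delta> j)"
      using \<delta>_small
    proof eventually_elim
      case (elim j)
      have "\<bar>sin (pi * \<delta> j) - pi * \<delta> j\<bar> \<le> \<bar>pi * \<delta> j\<bar> ^ 3 / 6"
        by (rule abs_sin_minus_self_le)
      also have "\<dots> = pi ^ 3 / 6 * \<bar>\<delta> j\<bar> ^ 3"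
        by (simp add: abs_mult power_mult_distrib)
      also have "\<dots> \<le> pi ^ 3 / 6 * \<bar>\<delta> j\<bar> ^ 2"
        using elim by (intro mult_left_mono power_decreasing) auto
      finally show ?case
        by (simp add: power2_eq_square)
    qed
  qed
  also have "(\<lambda>j. \<delta> j * \<delta> j) \<in> O(\<lambda>j. E j * E j)"
    by (intro landau_o.big.mult \<delta>_bigo)
  finally have "(\<lambda>j. (sin (pi * \<delta> j) - pi * \<delta> j) * inverse (E j)) \<in> O(\<lambda>j. E j * E j * inverse (E j))"
    by (rule landau_o.big.mult) simp
  moreover have "(\<lambda>j. E j * E j * inverse (E j)) = E"
  proof
    show "E j * E j * inverse (E j) = E j" for j
      using E[of j] by simp
  qed
  ultimately have S: "(\<lambda>j. (sin (pi * \<delta> j) - pi * \<delta> j) / E j) \<in> O(\<lambda>j. 1 / hh j)"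
    using landau_o.big_trans[OF _ E_bigo(1)] unfolding divide_inverse by simp
  have "(\<lambda>j. - ((- 1) ^ j) :: real) \<in> O(\<lambda>_. 1)"
    by (rule bigoI[of _ 1]) simp
  then have "(\<lambda>j. (- ((- 1) ^ j)) * (cos (pi * x j) / E j + cos (sqrt 3 * pi * hh j))) \<in> O(\<lambda>j. 1 * (1 / hh j))"
    using cos_x_refined by (rule landau_o.big.mult)
  moreover have eq: "(- ((- 1) ^ j)) * (cos (pi * x j) / E j + cos (sqrt 3 * pi * hh j)) = sin (pi * \<delta> j) / E j - (- 1) ^ j * cos (sqrt 3 * pi * hh j)" for j
    unfolding cos_x by (cases "even j") (simp_all add: algebra_simps)
  ultimately have "(\<lambda>j. sin (pi * \<delta> j) / E j - (- 1) ^ j * cos (sqrt 3 * pi * hh j)) \<in> O(\<lambda>j. 1 / hh j)"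
    unfolding eq mult_1 by -
  from sum_in_bigo(2)[OF this S] show ?thesis
    by (simp add: diff_divide_distrib)
qed

end

section \<open>From the displacement of the pole to that of t and Theta\<close>

context zero_sequence
begin

lemma x_window: "\<forall>\<^sub>F j in sequentially. hh j / 2 \<le> x j \<and> t j - t_star j = t_of (x j) - t_of (hh j)"
  using s_window \<delta>_small eventually_ge_at_top[of 1]
proof eventually_elim
  case (elim j)
  have "pi / (s j)\<^sup>2 = t_of (Re (upole 1 (s j)))"
    by (rule upole_one_parametrisation) (use elim in blast)
  moreover have "3 / 2 \<le> hh j"
    using elim(3) by (simp add: hh_def)
  then have "hh j / 2 \<le> x j"
    using elim(2) unfolding \<delta>_def by linarith
  ultimately show ?case
    using elim(1) by (simp add: t_star_eq x_def)
qed

definition "L j = (t j - t_star j) * hh j ^ 3 * exp ((sqrt 3 - 1) * pi * hh j)"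

text \<open>The derivative of \<open>t_of\<close> behaves like - 2 pi / x^3. Within distance
  |\<delta>| of h the cube may be taken at h, since h / \<xi> = 1 + O(1/h).\<close>

lemma scaled_deriv_bigo:
  assumes "\<forall>\<^sub>F j in sequentially. \<bar>\<xi> j - hh j\<bar> \<le> \<bar>\<delta> j\<bar>"
  shows "(\<lambda>j. t_of_deriv (\<xi> j) * hh j ^ 3 + 2 * pi) \<in> O(\<lambda>j. 1 / hh j)"
proof -
  have \<xi>\<delta>: "(\<lambda>j. \<xi> j - hh j) \<in> O(\<lambda>j. 1 / hh j)"
  proof -
    have "(\<lambda>j. \<xi> j - hh j) \<in> O(\<delta>)"
      by (rule bigoI[of _ 1]) (use assms in \<open>simp add: eventually_mono\<close>)
    then show ?thesis
      by (rule landau_o.big_trans[OF _ landau_o.big_trans[OF \<delta>_bigo E_bigo(1)]])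
  qed
  have \<xi>_large: "\<forall>\<^sub>F j in sequentially. hh j / 2 \<le> \<xi> j"
    using assms \<delta>_small eventually_ge_at_top[of 1]
  proof eventually_elim
    case (elim j)
    have "3 / 2 \<le> hh j"
      using elim(3) by (simp add: hh_def)
    then show ?case
      using elim(1,2) by linarith
  qed
  have 1: "(\<lambda>j. t_of_deriv (\<xi> j) * \<xi> j ^ 3 + 2 * pi) \<in> O(\<lambda>j. 1 / hh j)"
    using bigo_compose_hh[of "\<lambda>x. t_of_deriv x * x ^ 3 + 2 * pi" 1, OF _ \<xi>_large] t_of_deriv_asymptotics by simp
  have u: "(\<lambda>j. hh j / \<xi> j - 1) \<in> O(\<lambda>j. 1 / hh j)"
  proof (rule landau_o.big_trans[OF bigoI[of _ 4] \<xi>\<delta>])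
    show "\<forall>\<^sub>F j in sequentially. norm (hh j / \<xi> j - 1) \<le> 4 * norm (\<xi> j - hh j)"
      using \<xi>_large
    proof eventually_elim
      case (elim j)
      then have "1 / 4 \<le> \<xi> j"
        using hh_ge[of j] by linarith
      then have "hh j / \<xi> j - 1 = (hh j - \<xi> j) / \<xi> j"
        by (simp add: diff_divide_distrib)
      then have "norm (hh j / \<xi> j - 1) = \<bar>\<xi> j - hh j\<bar> / \<xi> j"
        using \<open>1 / 4 \<le> \<xi> j\<close> by (simp add: abs_divide abs_minus_commute)
      also have "\<dots> \<le> \<bar>\<xi> j - hh j\<bar> / (1 / 4)"
        using \<open>1 / 4 \<le> \<xi> j\<close> by (intro divide_left_mono) auto
      finally show ?case
        by simp
    qed
  qed
  define u where "u = (\<lambda>j. hh j / \<xi> j)"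
  have u1: "(\<lambda>j. u j - 1) \<in> O(\<lambda>j. 1 / hh j)" "u \<in> O(\<lambda>_. 1)"
    using u bigo_one_if[of u] by (simp_all add: u_def)
  have "(\<lambda>j. (u j - 1) * (u j * u j)) \<in> O(\<lambda>j. 1 / hh j * (1 * 1))" "(\<lambda>j. (u j - 1) * u j) \<in> O(\<lambda>j. 1 / hh j * 1)"
    by (intro landau_o.big.mult u1)+
  then have "(\<lambda>j. (u j - 1) * (u j * u j) + ((u j - 1) * u j + (u j - 1))) \<in> O(\<lambda>j. 1 / hh j)"
    by (intro sum_in_bigo u1) simp_all
  then have u3: "(\<lambda>j. u j ^ 3 - 1) \<in> O(\<lambda>j. 1 / hh j)"
    by (simp add: power3_eq_cube algebra_simps)
  have "(\<lambda>j. (t_of_deriv (\<xi> j) * \<xi> j ^ 3 + 2 * pi) * u j ^ 3) \<in> O(\<lambda>j. 1 / hh j * 1)"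
    by (intro landau_o.big.mult 1 bigo_one_if u3)
  then have "(\<lambda>j. (t_of_deriv (\<xi> j) * \<xi> j ^ 3 + 2 * pi) * u j ^ 3 - 2 * pi * (u j ^ 3 - 1)) \<in> O(\<lambda>j. 1 / hh j)"
    using u3 by (intro sum_in_bigo) simp_all
  moreover have "\<forall>\<^sub>F j in sequentially. (t_of_deriv (\<xi> j) * \<xi> j ^ 3 + 2 * pi) * u j ^ 3 - 2 * pi * (u j ^ 3 - 1) = t_of_deriv (\<xi> j) * hh j ^ 3 + 2 * pi"
    using \<xi>_large
  proof eventually_elim
    case (elim j)
    then have "\<xi> j \<noteq> 0"
      using hh_pos[of j] by auto
    then have "\<xi> j ^ 3 * u j ^ 3 = hh j ^ 3"
      by (simp add: u_def flip: power_mult_distrib)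
    then show ?case
      by (simp add: algebra_simps)
  qed
  ultimately show ?thesis
    by (subst (asm) landau_o.big.in_cong)
qed

text \<open>By the mean value theorem L is \<delta> / E times the scaled derivative, which tends to
  - 2 pi. Combined with \<open>\<delta>_refined\<close> this produces the factor 2 and turns the
  sign (-1)^j into (-1)^(j+1).\<close>

lemma L_refined: "(\<lambda>j. L j - 2 * (- 1) ^ (j + 1) * cos (sqrt 3 * pi * hh j)) \<in> O(\<lambda>j. 1 / hh j)"
proof -
  have ex: "\<forall>\<^sub>F j in sequentially. \<exists>\<xi>. \<bar>\<xi> - hh j\<bar> \<le> \<bar>\<delta> j\<bar> \<and> t_of (x j) - t_of (hh j) = \<delta> j * t_of_deriv \<xi>"
    using x_window
  proof eventually_elim
    case (elim j)
    then have "0 < x j"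
      using hh_pos[of j] by linarith
    then show ?case
      unfolding \<delta>_def using hh_pos by (rule t_of_mean_value)
  qed
  \<comment> \<open>The intermediate point exists only for large j; it is chosen for every j and its
    property is recovered eventually.\<close>
  define \<xi> where "\<xi> = (\<lambda>j. SOME \<xi>. \<bar>\<xi> - hh j\<bar> \<le> \<bar>\<delta> j\<bar> \<and> t_of (x j) - t_of (hh j) = \<delta> j * t_of_deriv \<xi>)"
  have \<xi>: "\<forall>\<^sub>F j in sequentially. \<bar>\<xi> j - hh j\<bar> \<le> \<bar>\<delta> j\<bar> \<and> t_of (x j) - t_of (hh j) = \<delta> j * t_of_deriv (\<xi> j)"
    unfolding \<xi>_def using ex by (rule eventually_mono) (rule someI_ex)
  have D: "(\<lambda>j. t_of_deriv (\<xi> j) * hh j ^ 3 + 2 * pi) \<in> O(\<lambda>j. 1 / hh j)"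
    by (rule scaled_deriv_bigo) (use \<xi> in eventually_elim, blast)
  have E: "E j > 0" "exp ((sqrt 3 - 1) * pi * hh j) = 1 / E j" for j
    by (simp_all add: E_def \<kappa>_def exp_minus divide_inverse)
  have "(\<lambda>j. \<delta> j * inverse (E j)) \<in> O(\<lambda>j. E j * inverse (E j))"
    by (intro landau_o.big.mult \<delta>_bigo) simp
  moreover have "E j * inverse (E j) = 1" for j
    using E(1)[of j] by simp
  ultimately have "(\<lambda>j. \<delta> j / E j) \<in> O(\<lambda>_. 1)"
    by (simp only: divide_inverse)
  from landau_o.big.mult[OF this D] have 1: "(\<lambda>j. \<delta> j / E j * (t_of_deriv (\<xi> j) * hh j ^ 3 + 2 * pi)) \<in> O(\<lambda>j. 1 / hh j)"
    by simp
  have 2: "(\<lambda>j. 2 * (pi * \<delta> j / E j - (- 1) ^ j * cos (sqrt 3 * pi * hh j))) \<in> O(\<lambda>j. 1 / hh j)"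
    by (rule landau_o.big.cmult_in_iff[THEN iffD2, OF _ \<delta>_refined]) simp
  have ev: "\<forall>\<^sub>F j in sequentially. \<delta> j / E j * (t_of_deriv (\<xi> j) * hh j ^ 3 + 2 * pi) - 2 * (pi * \<delta> j / E j - (- 1) ^ j * cos (sqrt 3 * pi * hh j))
     = L j - 2 * (- 1) ^ (j + 1) * cos (sqrt 3 * pi * hh j)"
    using \<xi> x_window
  proof eventually_elim
    case (elim j)
    then have "t j - t_star j = \<delta> j * t_of_deriv (\<xi> j)"
      by argo
    then have "L j = \<delta> j / E j * (t_of_deriv (\<xi> j) * hh j ^ 3)"
      unfolding L_def E(2) by (simp only:) simp
    then show ?case
      by (simp add: algebra_simps)
  qed
  show ?thesis
    using landau_o.big.in_cong[OF ev] sum_in_bigo(2)[OF 1 2] by blast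
qed

text \<open>Theta (t j) is pi s, and s is exactly sqrt (x sqrt (x^2 + 7/4)). Expanding the roots
  gives 7 / (16 x), and replacing x by h is harmless because \<delta> is exponentially
  small.\<close>

lemma Theta_refined: "(\<lambda>j. Theta (t j) - pi * (hh j + 7 / (16 * hh j))) \<in> O(\<lambda>j. 1 / hh j ^ 3)"
proof -
  have xl: "\<forall>\<^sub>F j in sequentially. hh j / 2 \<le> x j"
    using x_window by eventually_elim blast
  have 1: "(\<lambda>j. sqrt (x j * sqrt ((x j)\<^sup>2 + 7 / 4)) - (x j + 7 / (16 * x j))) \<in> O(\<lambda>j. 1 / hh j ^ 3)"
    by (rule bigo_compose_hh[OF sqrt_asymptotics xl])
  have 2: "\<delta> \<in> O(\<lambda>j. 1 / hh j ^ 3)"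
    by (rule landau_o.big_trans[OF \<delta>_bigo E_bigo(2)])
  have 3: "(\<lambda>j. 7 / (16 * x j) - 7 / (16 * hh j)) \<in> O(\<lambda>j. 1 / hh j ^ 3)"
  proof (rule landau_o.big_trans[OF bigoI[of _ 4] 2])
    show "\<forall>\<^sub>F j in sequentially. norm (7 / (16 * x j) - 7 / (16 * hh j)) \<le> 4 * norm (\<delta> j)"
      using xl
    proof eventually_elim
      case (elim j)
      have h: "1 / 2 \<le> hh j" "1 / 4 \<le> x j"
        using hh_ge[of j] elim by linarith+
      then have "7 / (16 * x j) - 7 / (16 * hh j) = - (7 / 16) * \<delta> j / (x j * hh j)"
        by (simp add: \<delta>_def field_simps)
      then have "norm (7 / (16 * x j) - 7 / (16 * hh j)) = 7 / 16 * \<bar>\<delta> j\<bar> / (x j * hh j)"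
        using h by (simp add: abs_mult abs_divide)
      also have "\<dots> \<le> 7 / 16 * \<bar>\<delta> j\<bar> / (1 / 4 * (1 / 2))"
        using h by (intro divide_left_mono mult_mono mult_pos_pos) auto
      also have "\<dots> = 7 / 2 * \<bar>\<delta> j\<bar>"
        by simp
      also have "\<dots> \<le> 4 * \<bar>\<delta> j\<bar>"
        by (intro mult_right_mono) auto
      finally show ?case
        by (simp only: real_norm_def)
    qed
  qed
  have "(\<lambda>j. pi * ((sqrt (x j * sqrt ((x j)\<^sup>2 + 7 / 4)) - (x j + 7 / (16 * x j))) + (\<delta> j + (7 / (16 * x j) - 7 / (16 * hh j))))) \<in> O(\<lambda>j. 1 / hh j ^ 3)"
    using sum_in_bigo(1)[OF 1 sum_in_bigo(1)[OF 2 3]] by simp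
  moreover have ev: "\<forall>\<^sub>F j in sequentially. pi * ((sqrt (x j * sqrt ((x j)\<^sup>2 + 7 / 4)) - (x j + 7 / (16 * x j))) + (\<delta> j + (7 / (16 * x j) - 7 / (16 * hh j))))
      = Theta (t j) - pi * (hh j + 7 / (16 * hh j))"
    using s_window
  proof eventually_elim
    case (elim j)
    then have s: "0 < s j" and t: "0 < t j"
      by blast+
    have "sqrt (x j * sqrt ((x j)\<^sup>2 + 7 / 4)) = s j"
      unfolding x_def upole_one_parametrisation(1)[OF s, symmetric] using s by simp
    moreover have "Theta (t j) = pi * s j"
      using t by (simp add: Theta_eq s_def)
    ultimately show ?case
      by (simp add: \<delta>_def right_diff_distrib distrib_left)
  qed
  ultimately show ?thesis
    using landau_o.big.in_cong[OF ev] by blast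
qed

end

section \<open>Limit points of the leading term\<close>

lemma sqrt_3_irrational: "sqrt 3 \<notin> \<rat>"
proof
  assume "sqrt 3 \<in> \<rat>"
  then obtain m n :: nat where n: "n \<noteq> 0" and eq: "\<bar>sqrt 3\<bar> = real m / real n" and "coprime m n"
    by (rule Rats_abs_nat_div_natE)
  have "sqrt 3 * real n = real m"
    using eq n by (simp add: field_simps)
  then have "(sqrt 3 * real n)\<^sup>2 = (real m)\<^sup>2"
    by (rule arg_cong)
  then have "real (3 * n\<^sup>2) = real (m\<^sup>2)"
    by (simp add: power_mult_distrib)
  then have sq: "3 * n\<^sup>2 = m\<^sup>2"
    by (simp only: of_nat_eq_iff)
  have prime: "prime (3 :: nat)"
    by simp
  have "3 dvd m\<^sup>2"
    unfolding sq[symmetric] by simp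
  then have "3 dvd m"
    using prime prime_dvd_power by blast
  then obtain k where "m = 3 * k" ..
  with sq have "n\<^sup>2 = 3 * k\<^sup>2"
    by (simp add: power_mult_distrib)
  then have "3 dvd n\<^sup>2"
    by simp
  then have "3 dvd n"
    using prime prime_dvd_power by blast
  from coprime_common_divisor[OF \<open>coprime m n\<close> \<open>3 dvd m\<close> this] show False
    by simp
qed

lemma irrational_half_sqrt3: "(sqrt 3 + 1) / 2 \<notin> \<rat>"
proof
  assume "(sqrt 3 + 1) / 2 \<in> \<rat>"
  then have "2 * ((sqrt 3 + 1) / 2) - 1 \<in> \<rat>"
    by (intro Rats_diff Rats_mult) auto
  moreover have "2 * ((sqrt 3 + 1) / 2) - 1 = sqrt (3 :: real)"
  proof -
    have "2 * ((q + 1) / 2) - 1 = q" for q :: real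
      by (simp add: field_simps)
    then show ?thesis .
  qed
  ultimately show False
    using sqrt_3_irrational by simp
qed

definition leading :: "nat \<Rightarrow> real" where
  "leading j = 2 * (- 1) ^ (j + 1) * cos (sqrt 3 * pi * hh j)"

text \<open>Absorbing the sign (-1)^(j+1) as a phase pi (j + 1) turns the leading term into a
  continuous function along the orbit of a rotation of the circle, with irrational rotation number
  (sqrt 3 + 1) / 2.\<close>

lemma leading_eq: "leading j = 2 * cos (2 * pi * (real j * ((sqrt 3 + 1) / 2) + (sqrt 3 / 4 + 1 / 2)))"
proof -
  have "2 * pi * (real j * ((sqrt 3 + 1) / 2) + (sqrt 3 / 4 + 1 / 2)) = sqrt 3 * pi * hh j + real (j + 1) * pi"
    by (simp add: hh_def algebra_simps add_divide_distrib)
  then have "2 * cos (2 * pi * (real j * ((sqrt 3 + 1) / 2) + (sqrt 3 / 4 + 1 / 2))) = 2 * cos (sqrt 3 * pi * hh j + real (j + 1) * pi)"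
    by (simp only:)
  also have "\<dots> = 2 * (cos (sqrt 3 * pi * hh j) * (- 1) ^ (j + 1))"
    by (simp only: cos_add cos_npi sin_npi mult_zero_right diff_zero)
  finally show ?thesis
    unfolding leading_def by (simp only: mult_ac)
qed

lemma abs_leading_le: "\<bar>leading j\<bar> \<le> 2"
proof -
  obtain y where "leading j = 2 * cos y"
    using leading_eq by blast
  then show ?thesis
    using abs_cos_le_one[of y] by (simp add: abs_mult)
qed

text \<open>Kronecker's theorem gives one index; shifting the target by \<open>N\<close> steps gives one beyond \<open>N\<close>.\<close>

lemma leading_dense:
  assumes l: "\<bar>l\<bar> \<le> 2" and \<epsilon>: "\<epsilon> > 0"
  shows "\<exists>j>N. \<bar>leading j - l\<bar> < \<epsilon>"
proof -
  define \<theta> :: real where "\<theta> = (sqrt 3 + 1) / 2"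
  define c0 :: real where "c0 = sqrt 3 / 4 + 1 / 2"
  define \<phi> where "\<phi> = arccos (l / 2) / (2 * pi)"
  have \<phi>: "2 * cos (2 * pi * \<phi>) = l"
    using l by (simp add: \<phi>_def cos_arccos abs_le_iff)
  define \<beta> where "\<beta> = \<phi> - c0 - real N * \<theta>"
  have "\<theta> \<notin> \<rat>"
    unfolding \<theta>_def by (rule irrational_half_sqrt3)
  \<comment> \<open>The tolerance \<epsilon> / (4 pi) accounts for the factor 2 of the cosine and
    the factor 2 pi of its argument.\<close>
  moreover have "0 \<le> frac \<beta>" "frac \<beta> \<le> 1" "0 < \<epsilon> / (4 * pi)"
    using frac_lt_1[of \<beta>] \<epsilon> by auto
  ultimately obtain k where k: "k > 0" "\<bar>frac (real k * \<theta>) - frac \<beta>\<bar> < \<epsilon> / (4 * pi)"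
    using Kronecker_approx_1_explicit[of \<theta> "frac \<beta>" "\<epsilon> / (4 * pi)"] by blast
  define n where "n = \<lfloor>real k * \<theta>\<rfloor> - \<lfloor>\<beta>\<rfloor>"
  have d: "real (k + N) * \<theta> + c0 - of_int n - \<phi> = frac (real k * \<theta>) - frac \<beta>"
    by (simp add: n_def frac_def \<beta>_def algebra_simps)
  define y where "y = real (k + N) * \<theta> + c0"
  have "cos (2 * pi * (y - of_int n)) = cos (2 * pi * y - 2 * pi * of_int n)"
    by (simp only: right_diff_distrib)
  also have "\<dots> = cos (2 * pi * y)"
    by (simp add: cos_diff cos_int_2pin sin_int_2pin)
  finally have "leading (k + N) = 2 * cos (2 * pi * (y - of_int n))"
    unfolding leading_eq \<theta>_def[symmetric] c0_def[symmetric] y_def[symmetric] by simp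
  then have "leading (k + N) - l = 2 * (cos (2 * pi * (y - of_int n)) - cos (2 * pi * \<phi>))"
    unfolding \<phi>[symmetric] by (simp only: right_diff_distrib)
  then have "\<bar>leading (k + N) - l\<bar> = 2 * \<bar>cos (2 * pi * (y - of_int n)) - cos (2 * pi * \<phi>)\<bar>"
    by (simp only: abs_mult abs_numeral)
  also have "\<dots> \<le> 2 * \<bar>2 * pi * (y - of_int n) - 2 * pi * \<phi>\<bar>"
    by (intro mult_left_mono abs_cos_diff_le) auto
  also have "2 * pi * (y - of_int n) - 2 * pi * \<phi> = 2 * pi * (frac (real k * \<theta>) - frac \<beta>)"
    unfolding d[symmetric] y_def by (simp only: right_diff_distrib)
  also have "2 * \<bar>2 * pi * (frac (real k * \<theta>) - frac \<beta>)\<bar> = 4 * pi * \<bar>frac (real k * \<theta>) - frac \<beta>\<bar>"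
    by (simp add: abs_mult)
  also have "\<dots> < 4 * pi * (\<epsilon> / (4 * pi))"
    using k(2) by (intro mult_strict_left_mono) auto
  finally have "\<bar>leading (k + N) - l\<bar> < \<epsilon>"
    by simp
  with k(1) show ?thesis
    by (intro exI[of _ "k + N"]) auto
qed

lemma leading_subsequence:
  assumes "\<bar>l\<bar> \<le> 2"
  shows "\<exists>r. strict_mono (r :: nat \<Rightarrow> nat) \<and> (leading \<circ> r) \<longlonglongrightarrow> l"
proof -
  have "\<exists>r. \<forall>n. \<bar>leading (r n) - l\<bar> < inverse (real (Suc n)) \<and> r n < r (Suc n)"
  proof (rule dependent_nat_choice)
    show "\<exists>k. \<bar>leading k - l\<bar> < inverse (real (Suc 0))"
      using leading_dense[OF assms, of 1 0] by auto
    show "\<exists>k'. \<bar>leading k' - l\<bar> < inverse (real (Suc (Suc n))) \<and> k < k'" for k n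
      using leading_dense[OF assms, of "inverse (real (Suc (Suc n)))" k] by (auto simp del: of_nat_Suc)
  qed
  then obtain r where r: "\<And>n. \<bar>leading (r n) - l\<bar> < inverse (real (Suc n))" "\<And>n. r n < r (Suc n)"
    by blast
  have "(\<lambda>n. leading (r n) - l) \<longlonglongrightarrow> 0"
    by (rule Lim_null_comparison[OF always_eventually LIMSEQ_inverse_real_of_nat]) (use r(1) in \<open>auto intro: less_imp_le\<close>)
  then have "(leading \<circ> r) \<longlonglongrightarrow> l"
    by (simp add: o_def LIM_zero_iff)
  then show ?thesis
    using r(2) by (intro exI[of _ r]) (simp add: strict_mono_Suc_iff)
qed

context
  fixes L :: "nat \<Rightarrow> real"
  assumes L: "(\<lambda>j. L j - leading j) \<longlonglongrightarrow> 0"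
begin

lemma subsequence_limit:
  assumes "\<bar>l\<bar> \<le> 2"
  obtains r :: "nat \<Rightarrow> nat" where "strict_mono r" "(L \<circ> r) \<longlonglongrightarrow> l"
proof -
  obtain r :: "nat \<Rightarrow> nat" where r: "strict_mono r" "(leading \<circ> r) \<longlonglongrightarrow> l"
    using leading_subsequence[OF assms] by blast
  have "(\<lambda>n. (L (r n) - leading (r n)) + leading (r n)) \<longlonglongrightarrow> 0 + l"
    using LIMSEQ_subseq_LIMSEQ[OF L r(1)] r(2) by (intro tendsto_add) (simp_all add: o_def)
  then show ?thesis
    using r(1) by (intro that[of r]) (simp_all add: o_def)
qed

lemma limit_points_eq: "limit_points L = {- 2..2}"
proof (intro equalityI subsetI)
  fix l assume "l \<in> limit_points L"
  then obtain r :: "nat \<Rightarrow> nat" where r: "strict_mono r" "(L \<circ> r) \<longlonglongrightarrow> l"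
    by (auto simp: limit_points_def)
  have "(\<lambda>n. L (r n) - (L (r n) - leading (r n))) \<longlonglongrightarrow> l - 0"
    using LIMSEQ_subseq_LIMSEQ[OF L r(1)] r(2) by (intro tendsto_diff) (simp_all add: o_def)
  then have lim: "(\<lambda>n. leading (r n)) \<longlonglongrightarrow> l"
    by simp
  have "\<bar>l\<bar> \<le> 2"
    by (rule tendsto_upperbound[OF tendsto_rabs[OF lim]]) (simp_all add: abs_leading_le)
  then show "l \<in> {- 2..2}"
    by auto
next
  fix l :: real assume "l \<in> {- 2..2}"
  then have "\<bar>l\<bar> \<le> 2"
    by auto
  then show "l \<in> limit_points L"
    unfolding limit_points_def by (elim subsequence_limit) blast
qed

lemma limsup_abs_eq: "limsup (\<lambda>j. ereal \<bar>L j\<bar>) = 2"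
proof (rule antisym)
  have "limsup (\<lambda>j. ereal \<bar>L j\<bar>) \<le> limsup (\<lambda>j. ereal (\<bar>L j - leading j\<bar> + 2))"
  proof (intro Limsup_mono always_eventually allI)
    fix j
    have "\<bar>L j\<bar> \<le> \<bar>L j - leading j\<bar> + 2"
      using abs_leading_le[of j] by linarith
    then show "ereal \<bar>L j\<bar> \<le> ereal (\<bar>L j - leading j\<bar> + 2)"
      by simp
  qed
  also have "\<dots> = 2"
  proof (rule lim_imp_Limsup)
    have "(\<lambda>j. \<bar>L j - leading j\<bar> + 2) \<longlonglongrightarrow> \<bar>0\<bar> + 2"
      by (intro tendsto_intros L)
    then have "(\<lambda>j. ereal (\<bar>L j - leading j\<bar> + 2)) \<longlonglongrightarrow> ereal 2"
      by (intro tendsto_ereal) simp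
    then show "(\<lambda>j. ereal (\<bar>L j - leading j\<bar> + 2)) \<longlonglongrightarrow> 2"
      by simp
  qed simp
  finally show "limsup (\<lambda>j. ereal \<bar>L j\<bar>) \<le> 2" .
  obtain r :: "nat \<Rightarrow> nat" where r: "strict_mono r" "(L \<circ> r) \<longlonglongrightarrow> 2"
    using subsequence_limit[of 2] by auto
  have "(\<lambda>n. ereal \<bar>(L \<circ> r) n\<bar>) \<longlonglongrightarrow> ereal \<bar>2\<bar>"
    by (intro tendsto_ereal tendsto_rabs r(2))
  then have "limsup (\<lambda>n. ereal \<bar>(L \<circ> r) n\<bar>) = ereal \<bar>2\<bar>"
    by (intro lim_imp_Limsup) auto
  then have "2 = limsup ((\<lambda>j. ereal \<bar>L j\<bar>) \<circ> r)"
    by (simp add: o_def)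
  also have "\<dots> \<le> limsup (\<lambda>j. ereal \<bar>L j\<bar>)"
    by (rule limsup_subseq_mono[OF r(1)])
  finally show "2 \<le> limsup (\<lambda>j. ereal \<bar>L j\<bar>)" .
qed

lemma not_tendsto_zero: "\<not> L \<longlonglongrightarrow> 0"
proof
  assume "L \<longlonglongrightarrow> 0"
  obtain r :: "nat \<Rightarrow> nat" where r: "strict_mono r" "(L \<circ> r) \<longlonglongrightarrow> 2"
    using subsequence_limit[of 2] by auto
  from LIMSEQ_unique[OF r(2) LIMSEQ_subseq_LIMSEQ[OF \<open>L \<longlonglongrightarrow> 0\<close> r(1)]] show False
    by simp
qed

lemma bounded_bigo: "L \<in> O(\<lambda>_. 1)"
proof -
  have "(\<lambda>j. L j - leading j) \<in> O(\<lambda>_. 1)"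
    using L by (intro bigoI_tendsto[of _ _ 0]) auto
  moreover have "leading \<in> O(\<lambda>_. 1)"
    by (rule bigoI[of _ 2]) (simp add: abs_leading_le)
  ultimately have "(\<lambda>j. (L j - leading j) + leading j) \<in> O(\<lambda>_. 1)"
    by (rule sum_in_bigo)
  then show ?thesis
    by simp
qed

end

section \<open>Poles of the section of W\<close>

text \<open>When both exponents are multiples of a, the series depends on q only through q^a. This
  is how the denominator at z = - 1 and q = exp (- t / a) becomes V_-(t).\<close>

lemma lambert_rescale:
  fixes q z :: "'a::{real_normed_field,banach}"
  shows "lambert z 1 1 (q ^ a) = lambert z a a q"
  by (simp only: lambert_def lambert_term_def power_mult[symmetric] mult_1)

lemma norm_root_of_unity:
  fixes z :: complex
  assumes "z ^ d = 1" "0 < d"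
  shows "norm z = 1"
proof -
  have "norm z ^ d = norm (z ^ d)"
    by (simp only: norm_power)
  then have "norm z ^ d = 1 ^ d"
    using assms(1) by simp
  then show ?thesis
    by (rule power_eq_imp_eq_base) (use assms(2) in simp_all)
qed

lemma W3_eq_lambert:
  assumes q: "norm q < 1" and a: "0 < a" and d: "0 < d"
  shows "W3 a d q = 1 / of_nat d * (\<Sum>z | z ^ d = 1. lambert z a 1 q / lambert z a a q)"
proof -
  show ?thesis
    unfolding W3_def
  proof (intro arg_cong2[where f = "(*)"] refl sum.cong arg_cong2[where f = "(/)"])
    fix z :: complex assume "z \<in> {z. z ^ d = 1}"
    then have z: "norm z \<le> 1"
      using norm_root_of_unity[OF _ d] by simp
    show "(\<Sum>m. z ^ m * q ^ (a * m + 1) * Phi (q ^ (a * m + 1)) ^ 3) = lambert z a 1 q"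
      "(\<Sum>m. z ^ m * q ^ (a * (m + 1)) * Phi (q ^ (a * (m + 1))) ^ 3) = lambert z a a q"
      using lambert_identity(1)[OF q z a zero_less_one] lambert_identity(1)[OF q z a a]
      by (simp_all only: lambert_def distrib_left mult_1_right)
  qed
qed

lemma holomorphic_lambert:
  assumes "norm z \<le> 1" "0 < a" "0 < b"
  shows "lambert z a b holomorphic_on ball (0 :: complex) 1"
  using lambert_holomorphic[OF assms] by (simp add: lambert_def[abs_def])

text \<open>All summands but one are holomorphic near p; the remaining one has a denominator that
  vanishes at p and a numerator that does not, so a zero of any order yields a pole. The point
  \<beta> witnesses that the denominator is not identically zero, hence its zero at p is
  isolated.\<close>

lemma pole_of_quotient_sum:
  fixes N D :: "'i \<Rightarrow> complex \<Rightarrow> complex"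
  assumes I: "finite I" "i \<in> I" and S: "open S" "connected S" "p \<in> S"
    and N: "\<And>j. j \<in> I \<Longrightarrow> N j holomorphic_on S" and D: "\<And>j. j \<in> I \<Longrightarrow> D j holomorphic_on S"
    and W: "\<And>w. w \<in> S \<Longrightarrow> W w = c * (\<Sum>j\<in>I. N j w / D j w)" and c: "c \<noteq> 0"
    and nz: "\<And>j. j \<in> I \<Longrightarrow> j \<noteq> i \<Longrightarrow> D j p \<noteq> 0"
    and zero: "D i p = 0" "N i p \<noteq> 0" and \<beta>: "\<beta> \<in> S" "D i \<beta> \<noteq> 0"
  shows "isolated_singularity_at W p" "is_pole W p"
proof -
  have "\<exists>r0>0. ball p r0 \<subseteq> S \<and> (\<forall>w\<in>ball p r0 - {p}. D i w \<noteq> 0)"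
    by (rule isolated_zeros[OF D[OF I(2)] S zero(1) \<beta>]) blast
  then obtain r0 where r0: "r0 > 0" "ball p r0 \<subseteq> S" "\<And>w. w \<in> ball p r0 - {p} \<Longrightarrow> D i w \<noteq> 0"
    by blast
  have isCont: "isCont f p" if "f holomorphic_on S" for f
  proof -
    have "\<forall>w\<in>S. isCont f w"
      using holomorphic_on_imp_continuous_on[OF that] by (simp only: continuous_on_eq_continuous_at[OF S(1)])
    then show ?thesis
      using S(3) by (rule bspec)
  qed
  note cont = isCont[OF D]
  have "\<forall>j\<in>I - {i}. \<forall>\<^sub>F w in nhds p. D j w \<noteq> 0"
  proof
    fix j assume "j \<in> I - {i}"
    then show "\<forall>\<^sub>F w in nhds p. D j w \<noteq> 0"
    proof (intro tendsto_imp_eventually_ne)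
      show "(D j \<longlongrightarrow> D j p) (nhds p)"
        using cont[of j] \<open>j \<in> I - {i}\<close> by (simp add: isCont_def tendsto_nhds_iff)
      show "D j p \<noteq> 0"
        using nz[of j] \<open>j \<in> I - {i}\<close> by simp
    qed
  qed
  then have "\<forall>\<^sub>F w in nhds p. \<forall>j\<in>I - {i}. D j w \<noteq> 0"
    using I(1) by (simp add: eventually_ball_finite)
  then obtain r1 where r1: "r1 > 0" "\<And>w. dist w p < r1 \<Longrightarrow> \<forall>j\<in>I - {i}. D j w \<noteq> 0"
    unfolding eventually_nhds_metric by blast
  define r where "r = min r0 r1"
  have r: "r > 0" "ball p r \<subseteq> S"
    and Di: "\<And>w. w \<in> ball p r - {p} \<Longrightarrow> D i w \<noteq> 0"
    and Dj: "\<And>w j. w \<in> ball p r \<Longrightarrow> j \<in> I - {i} \<Longrightarrow> D j w \<noteq> 0"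
  proof -
    show "r > 0" "ball p r \<subseteq> S"
      using r0(1,2) r1(1) by (auto simp: r_def)
    show "D i w \<noteq> 0" if "w \<in> ball p r - {p}" for w
      by (rule r0(3)) (use that in \<open>auto simp: r_def\<close>)
    show "D j w \<noteq> 0" if "w \<in> ball p r" "j \<in> I - {i}" for w j
      by (rule bspec[OF r1(2) that(2)]) (use that(1) in \<open>simp add: r_def dist_commute\<close>)
  qed
  have quotient: "(\<lambda>w. N j w / D j w) holomorphic_on T"
    if "j \<in> I" "T \<subseteq> ball p r" "\<And>w. w \<in> T \<Longrightarrow> D j w \<noteq> 0" for j T
  proof -
    have "T \<subseteq> S"
      using that(2) r(2) by (rule subset_trans)
    show ?thesis
      by (rule holomorphic_on_divide[OF holomorphic_on_subset[OF N[OF that(1)] \<open>T \<subseteq> S\<close>]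
            holomorphic_on_subset[OF D[OF that(1)] \<open>T \<subseteq> S\<close>] that(3)])
  qed
  have Dnz: "D j w \<noteq> 0" if "j \<in> I" "w \<in> ball p r - {p}" for j w
    using Di[OF that(2)] Dj[of w j] that by (cases "j = i") simp_all
  have "(\<lambda>w. c * (\<Sum>j\<in>I. N j w / D j w)) holomorphic_on ball p r - {p}"
    by (intro holomorphic_on_mult holomorphic_on_const holomorphic_on_sum quotient Dnz Diff_subset)
  then have "W holomorphic_on ball p r - {p}"
  proof (rule holomorphic_transform)
    fix w assume "w \<in> ball p r - {p}"
    then have "w \<in> S"
      using r(2) by blast
    from W[OF this] show "c * (\<Sum>j\<in>I. N j w / D j w) = W w"
      by (rule sym)
  qed
  then show "isolated_singularity_at W p"
    unfolding isolated_singularity_at_def using r(1)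
    by (intro exI[of _ r]) (simp add: analytic_on_open open_delete)
  define g where "g = (\<lambda>w. \<Sum>j\<in>I - {i}. N j w / D j w)"
  have "g holomorphic_on ball p r"
    unfolding g_def by (intro holomorphic_on_sum quotient Dj subset_refl) simp_all
  then have "continuous_on (ball p r) g"
    by (rule holomorphic_on_imp_continuous_on)
  then have "\<forall>w\<in>ball p r. isCont g w"
    by (simp only: continuous_on_eq_continuous_at[OF open_ball])
  then have "isCont g p"
    using r(1) by simp
  then have g: "(g \<longlongrightarrow> g p) (at p)"
    by (simp add: isCont_def)
  have Np: "(N i \<longlongrightarrow> N i p) (at p)"
    using isCont[OF N[OF I(2)]] by (simp only: isCont_def)
  have ev: "\<forall>\<^sub>F w in at p. w \<in> ball p r - {p}"
    using r(1) by (intro eventually_at_in_open) auto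
  have "filterlim (D i) (at 0) (at p)"
    unfolding filterlim_at
  proof
    show "\<forall>\<^sub>F w in at p. D i w \<in> UNIV \<and> D i w \<noteq> 0"
      using ev by eventually_elim (use Di in auto)
    show "(D i \<longlongrightarrow> 0) (at p)"
      using cont[OF I(2)] zero(1) by (simp add: isCont_def)
  qed
  then have "filterlim (\<lambda>w. N i w / D i w) at_infinity (at p)"
    using Np zero(2) by (intro filterlim_divide_at_infinity)
  from tendsto_add_filterlim_at_infinity[OF g this]
  have "filterlim (\<lambda>w. g w + N i w / D i w) at_infinity (at p)" .
  from tendsto_mult_filterlim_at_infinity[OF tendsto_const c this]
  have lim: "filterlim (\<lambda>w. c * (g w + N i w / D i w)) at_infinity (at p)" .
  have eq: "\<forall>\<^sub>F w in at p. c * (g w + N i w / D i w) = W w"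
    using ev
  proof eventually_elim
    case (elim w)
    then have "W w = c * (\<Sum>j\<in>I. N j w / D j w)"
      using r(2) by (intro W) auto
    also have "(\<Sum>j\<in>I. N j w / D j w) = N i w / D i w + g w"
      unfolding g_def by (rule sum.remove[OF I])
    finally show ?case
      by (simp only: add.commute)
  qed
  show "is_pole W p"
    unfolding is_pole_def using lim filterlim_cong[OF refl refl eq] by (rule iffD1[rotated])
qed

lemma lambert_minus_one_real_point:
  assumes "0 < a" "0 < t"
  shows "lambert (- 1) a a (of_real (exp (- t / real a))) = complex_of_real (V_minus t)"
proof -
  have "exp (- t / real a) ^ a = exp (- t)"
    unfolding exp_of_nat_mult[symmetric] using assms by simp
  then have pow: "complex_of_real (exp (- t / real a)) ^ a = of_real (exp (- t))"
    by (simp only: of_real_power[symmetric])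
  have "lambert (- 1) a a (complex_of_real (exp (- t / real a))) = lambert (- 1) 1 1 (complex_of_real (exp (- t / real a)) ^ a)"
    by (rule lambert_rescale[symmetric])
  also have "\<dots> = complex_of_real (V_minus t)"
    unfolding pow by (rule V_minus_eq_lambert[OF assms(2), symmetric])
  finally show ?thesis .
qed

context zero_sequence
begin

text \<open>For b = 1 the leading cosine is shifted by pi / a, which lies in (0, pi / 2]. Since
  \<delta> tends to 0, its modulus tends to sin (pi / a) > 0, whereas everything else is small
  relative to the leading amplitude.\<close>

lemma numerator_eventually_nonzero:
  fixes a :: nat
  assumes a: "2 \<le> a"
  shows "\<forall>\<^sub>F j in sequentially. lambert (- 1 :: complex) a 1 (of_real (exp (- (pi / (s j)\<^sup>2) / real a))) \<noteq> 0"
proof -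
  define \<beta> where "\<beta> = real 1 / real a"
  have "0 < a"
    using a by simp
  define \<sigma> where "\<sigma> = sin (pi * \<beta>)"
  have "pi * \<beta> \<le> pi / 2"
    using a by (simp add: \<beta>_def field_simps)
  moreover have "0 < pi * \<beta>"
    using a by (simp add: \<beta>_def)
  ultimately have \<sigma>: "\<sigma> > 0"
    unfolding \<sigma>_def by (intro sin_gt_zero) linarith+
  obtain K where K: "K > 0" and ev: "\<forall>\<^sub>F s in at_top. norm (lambert (- 1 :: complex) a 1 (of_real (exp (- (pi / s\<^sup>2) / real a)))
      - of_real (8 * s\<^sup>2 * (exp (- (pi * Im (upole 1 s))) * cos (pi * Re (upole 1 s) - pi * \<beta>)
             + exp (- (pi * Im (upole 3 s))) * cos (pi * Re (upole 3 s) - 3 * pi * \<beta>))))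
     \<le> K * s\<^sup>2 * exp (- (2 * pi * s))"
    using lambert_minus_one_asymptotics[OF \<open>0 < a\<close> zero_less_one] unfolding \<beta>_def by blast
  have evj: "\<forall>\<^sub>F j in sequentially. norm (lambert (- 1 :: complex) a 1 (of_real (exp (- (pi / (s j)\<^sup>2) / real a)))
      - of_real (8 * (s j)\<^sup>2 * (exp (- (pi * Im (upole 1 (s j)))) * cos (pi * Re (upole 1 (s j)) - pi * \<beta>)
             + exp (- (pi * Im (upole 3 (s j)))) * cos (pi * Re (upole 3 (s j)) - 3 * pi * \<beta>))))
     \<le> K * (s j)\<^sup>2 * exp (- (2 * pi * s j))"
    using filterlim_s ev unfolding filterlim_iff by blast
  \<comment> \<open>Sizes relative to the leading pair: \<open>?e1\<close> is the amplitude of the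
    pair 3, and \<open>?e2\<close> governs the contour remainder.\<close>
  have small: "(\<lambda>j. exp (pi * (Im (upole 1 (s j)) - Im (upole 3 (s j))))) \<longlonglongrightarrow> 0" (is "?e1 \<longlonglongrightarrow> 0")
    and small2: "(\<lambda>j. exp (pi * Im (upole 1 (s j)) - 2 * pi * s j)) \<longlonglongrightarrow> 0" (is "?e2 \<longlonglongrightarrow> 0")
  proof -
    define f1 where "f1 = (\<lambda>j. Im (upole 1 (s j)) - s j)"
    define f3 where "f3 = (\<lambda>j. Im (upole 3 (s j)) - sqrt 3 * s j)"
    have f: "f1 \<longlonglongrightarrow> 0" "f3 \<longlonglongrightarrow> 0"
      using bigo_hh_tendsto_0 upole_bigo(2)[of 1] upole_bigo(2)[of 3] by (simp_all add: f1_def f3_def)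
    have "(\<lambda>j. exp (pi * (f1 j - f3 j)) * exp (- (\<kappa> * pi * s j))) \<longlonglongrightarrow> exp (pi * (0 - 0)) * 0"
    proof (intro tendsto_mult tendsto_exp tendsto_diff tendsto_const f)
      have "((\<lambda>x. exp (- (\<kappa> * pi * x))) \<longlongrightarrow> 0) at_top"
        using \<kappa> by real_asymp
      then show "(\<lambda>j. exp (- (\<kappa> * pi * s j))) \<longlonglongrightarrow> 0"
        using filterlim_s by (rule filterlim_compose)
    qed
    moreover have "exp (pi * (f1 j - f3 j)) * exp (- (\<kappa> * pi * s j)) = ?e1 j" for j
      unfolding exp_add[symmetric] f1_def f3_def \<kappa>_def by (simp add: algebra_simps)
    ultimately show "?e1 \<longlonglongrightarrow> 0"
      by simp
    have "(\<lambda>j. exp (pi * f1 j) * exp (- (pi * s j))) \<longlonglongrightarrow> exp (pi * 0) * 0"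
    proof (intro tendsto_mult tendsto_exp tendsto_const f)
      have "((\<lambda>x. exp (- (pi * x))) \<longlongrightarrow> 0) at_top"
        by real_asymp
      then show "(\<lambda>j. exp (- (pi * s j))) \<longlonglongrightarrow> 0"
        using filterlim_s by (rule filterlim_compose)
    qed
    moreover have "exp (pi * f1 j) * exp (- (pi * s j)) = ?e2 j" for j
      unfolding exp_add[symmetric] f1_def by (simp add: algebra_simps)
    ultimately show "?e2 \<longlonglongrightarrow> 0"
      by simp
  qed
  have "\<delta> \<longlonglongrightarrow> 0"
    by (rule bigo_hh_tendsto_0[OF landau_o.big_trans[OF \<delta>_bigo E_bigo(1)]])
  then have "(\<lambda>j. \<bar>sin (pi * \<delta> j - pi * \<beta>)\<bar>) \<longlonglongrightarrow> \<bar>sin (pi * 0 - pi * \<beta>)\<bar>"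
    by (intro tendsto_intros)
  then have "(\<lambda>j. \<bar>sin (pi * \<delta> j - pi * \<beta>)\<bar>) \<longlonglongrightarrow> \<sigma>"
    using \<sigma> by (simp add: \<sigma>_def)
  from order_tendstoD(1)[OF this, of "\<sigma> / 2"] \<sigma>
  have main: "\<forall>\<^sub>F j in sequentially. \<sigma> / 2 < \<bar>sin (pi * \<delta> j - pi * \<beta>)\<bar>"
    by simp
  have "(\<lambda>j. ?e1 j + K / 8 * ?e2 j) \<longlonglongrightarrow> 0 + K / 8 * 0"
    by (intro tendsto_add tendsto_mult tendsto_const small small2)
  then have "\<forall>\<^sub>F j in sequentially. ?e1 j + K / 8 * ?e2 j < \<sigma> / 2"
    by (rule order_tendstoD(2)) (use \<sigma> in simp)
  with evj main s_window show ?thesis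
  proof eventually_elim
    case (elim j)
    define Y1 Y3 C1 C3 where "Y1 = pi * Im (upole 1 (s j))" and "Y3 = pi * Im (upole 3 (s j))"
      and "C1 = cos (pi * Re (upole 1 (s j)) - pi * \<beta>)" and "C3 = cos (pi * Re (upole 3 (s j)) - 3 * pi * \<beta>)"
    have s: "0 < s j"
      using elim(3) by blast
    have "pi * Re (upole 1 (s j)) - pi * \<beta> = pi * (real j + 1 / 2) + (pi * \<delta> j - pi * \<beta>)"
      by (simp add: \<delta>_def x_def hh_def algebra_simps)
    then have "\<bar>C1\<bar> = \<bar>sin (pi * \<delta> j - pi * \<beta>)\<bar>"
      unfolding C1_def by (simp only: cos_add cos_half_integer sin_half_integer) (simp add: abs_mult)
    then have C1: "\<sigma> / 2 < \<bar>C1\<bar>"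
      using elim(2) by simp
    show ?case
    proof
      assume "lambert (- 1 :: complex) a 1 (of_real (exp (- (pi / (s j)\<^sup>2) / real a))) = 0"
      with elim(1) have "norm (0 - complex_of_real (8 * (s j)\<^sup>2 * (exp (- Y1) * C1 + exp (- Y3) * C3))) \<le> K * (s j)\<^sup>2 * exp (- (2 * pi * s j))"
        unfolding Y1_def Y3_def C1_def C3_def by (simp only:)
      then have "(s j)\<^sup>2 * (8 * \<bar>exp (- Y1) * C1 + exp (- Y3) * C3\<bar>) \<le> (s j)\<^sup>2 * (K * exp (- (2 * pi * s j)))"
        unfolding diff_0 norm_minus_cancel norm_of_real abs_mult by (simp add: mult_ac)
      then have "8 * \<bar>exp (- Y1) * C1 + exp (- Y3) * C3\<bar> \<le> K * exp (- (2 * pi * s j))"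
        using s by (simp only: mult_le_cancel_left_pos zero_less_power)
      then have b1: "\<bar>exp (- Y1) * C1 + exp (- Y3) * C3\<bar> \<le> K / 8 * exp (- (2 * pi * s j))"
        by simp
      have b2: "exp (- Y1) * \<bar>C1\<bar> \<le> \<bar>exp (- Y1) * C1 + exp (- Y3) * C3\<bar> + exp (- Y3) * 1"
      proof -
        have "exp (- Y1) * \<bar>C1\<bar> = \<bar>exp (- Y1) * C1\<bar>" "\<bar>exp (- Y3) * C3\<bar> = exp (- Y3) * \<bar>C3\<bar>"
          by (simp_all add: abs_mult)
        moreover have "exp (- Y3) * \<bar>C3\<bar> \<le> exp (- Y3) * 1"
          by (intro mult_left_mono) (auto simp: C3_def)
        moreover have "\<bar>u\<bar> \<le> \<bar>u + v\<bar> + w" if "\<bar>v\<bar> \<le> w" for u v w :: real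
          using that by linarith
        ultimately show ?thesis
          by (simp only:)
      qed
      have "exp (- Y1) * \<bar>C1\<bar> \<le> K / 8 * exp (- (2 * pi * s j)) + exp (- Y3)"
        by (rule order_trans[OF b2[unfolded mult_1_right] add_right_mono[OF b1]])
      then have "exp Y1 * (exp (- Y1) * \<bar>C1\<bar>) \<le> exp Y1 * (K / 8 * exp (- (2 * pi * s j)) + exp (- Y3))"
        by (rule mult_left_mono) simp
      moreover have "exp Y1 * (exp (- Y1) * \<bar>C1\<bar>) = \<bar>C1\<bar>"
        unfolding mult.assoc[symmetric] exp_add[symmetric] by simp
      moreover have "exp Y1 * (K / 8 * exp (- (2 * pi * s j)) + exp (- Y3)) = K / 8 * exp (Y1 + - (2 * pi * s j)) + exp (Y1 + - Y3)"
        unfolding exp_add distrib_left by (simp only: mult.left_commute)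
      moreover have "exp (Y1 + - (2 * pi * s j)) = ?e2 j" "exp (Y1 + - Y3) = ?e1 j"
        by (simp_all add: Y1_def Y3_def right_diff_distrib)
      ultimately have "\<bar>C1\<bar> \<le> K / 8 * ?e2 j + ?e1 j"
        by (simp only:)
      also have "\<dots> < \<sigma> / 2"
        using elim(4) by (simp only: add.commute)
      finally show False
        using C1 by simp
    qed
  qed
qed

text \<open>Evenness of d makes - 1 one of the roots of unity in the sum. There are finitely many
  others, so for all large j their denominators are simultaneously nonzero at the point in
  question.\<close>

lemma poles:
  assumes a: "2 \<le> a" and d: "2 \<le> d" "even d"
    and uniq: "\<forall>\<^sub>F j in sequentially. unique_zero_in_window j (t j)"
  shows "\<forall>\<^sub>F j in sequentially. isolated_singularity_at (W3 a d) (complex_of_real (exp (- t j / real a))) \<and>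
      is_pole (W3 a d) (complex_of_real (exp (- t j / real a)))"
proof -
  have a0: "0 < a" and d0: "0 < d"
    using a d by auto
  define I where "I = {z :: complex. z ^ d = 1}"
  have I: "finite I" "- 1 \<in> I"
    using finite_roots_unity[of d] d by (simp_all add: I_def)
  have norm1: "norm z = 1" if "z \<in> I" for z
    using that norm_root_of_unity[OF _ d0] by (simp add: I_def)
  have "\<forall>z\<in>I - {- 1}. \<forall>\<^sub>F j in sequentially. lambert z a a (of_real (exp (- (pi / (s j)\<^sup>2) / real a))) \<noteq> 0"
  proof
    fix z assume "z \<in> I - {- 1}"
    then have "\<forall>\<^sub>F s in at_top. lambert z a a (of_real (exp (- (pi / s\<^sup>2) / real a))) \<noteq> 0"
      using norm1 a0 by (intro lambert_eventually_nonzero) auto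
    then show "\<forall>\<^sub>F j in sequentially. lambert z a a (of_real (exp (- (pi / (s j)\<^sup>2) / real a))) \<noteq> 0"
      using filterlim_s unfolding filterlim_iff by blast
  qed
  then have "\<forall>\<^sub>F j in sequentially. \<forall>z\<in>I - {- 1}. lambert z a a (of_real (exp (- (pi / (s j)\<^sup>2) / real a))) \<noteq> 0"
    using I(1) by (simp add: eventually_ball_finite)
  then show ?thesis
    using numerator_eventually_nonzero[OF a] zero s_window uniq
  proof eventually_elim
    case (elim j)
    define p where "p = complex_of_real (exp (- t j / real a))"
    have t: "0 < t j" "t j = pi / (s j)\<^sup>2"
      using elim(4) by blast+
    \<comment> \<open>A second point of the window, different from s j and within 1/4 of h.
      Uniqueness of the zero makes V_- nonzero there, so the denominator for z = - 1 is not
      identically zero.\<close>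
    define u where "u = (if s j = hh j then hh j + 1 / 8 else hh j)"
    have u: "0 < u" "u \<noteq> s j" "\<bar>u - hh j\<bar> < 1 / 4"
      using hh_pos[of j] by (auto simp: u_def)
    define t' where "t' = pi / u\<^sup>2"
    have "0 < t'"
      using u(1) by (simp add: t'_def)
    have su: "sqrt (pi / t') = u"
      using u(1) by (simp add: t'_def)
    then have "t' \<noteq> t j"
      using u(2) by (auto simp: s_def)
    have "pi * \<bar>u - hh j\<bar> < pi * (1 / 4)"
      using u(3) by (intro mult_strict_left_mono) auto
    moreover have "Theta t' - pi * (real j + 1 / 2) = pi * (u - hh j)"
      unfolding Theta_eq[OF \<open>0 < t'\<close>] su by (simp only: hh_def right_diff_distrib)
    ultimately have "in_window j t'"
      unfolding in_window_def by (simp add: abs_mult)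
    with elim(5) \<open>0 < t'\<close> \<open>t' \<noteq> t j\<close> have "V_minus t' \<noteq> 0"
      unfolding unique_zero_in_window_def by blast
    have unit: "complex_of_real (exp (- r / real a)) \<in> ball 0 1" if "0 < r" for r
      using that a0 by simp
    have zero_p: "lambert (- 1) a a p = 0"
      using lambert_minus_one_real_point[OF a0 t(1)] elim(3) by (simp add: p_def)
    have tp: "p = of_real (exp (- (pi / (s j)\<^sup>2) / real a))"
      unfolding p_def t(2) ..
    have hol: "lambert z a 1 holomorphic_on ball 0 1" "lambert z a a holomorphic_on ball 0 1" if "z \<in> I" for z
      using norm1[OF that] a0 by (auto intro!: holomorphic_lambert)
    have W: "W3 a d w = 1 / of_nat d * (\<Sum>z\<in>I. lambert z a 1 w / lambert z a a w)" if "w \<in> ball 0 1" for w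
      unfolding I_def using that by (intro W3_eq_lambert a0 d0) simp
    have nz: "lambert z a a p \<noteq> 0" if "z \<in> I" "z \<noteq> - 1" for z
      using elim(1) that unfolding tp by blast
    have Np: "lambert (- 1) a 1 p \<noteq> 0"
      using elim(2) unfolding tp .
    have \<beta>: "lambert (- 1) a a (of_real (exp (- t' / real a))) \<noteq> (0 :: complex)"
      unfolding lambert_minus_one_real_point[OF a0 \<open>0 < t'\<close>] using \<open>V_minus t' \<noteq> 0\<close> by simp
    have c: "1 / of_nat d \<noteq> (0 :: complex)"
      using d0 by simp
    have p: "p \<in> ball 0 1"
      unfolding p_def by (rule unit[OF t(1)])
    note pole = pole_of_quotient_sum[where N = "\<lambda>z. lambert z a 1" and D = "\<lambda>z. lambert z a a",
        OF I open_ball connected_ball p hol W c nz zero_p Np unit[OF \<open>0 < t'\<close>] \<beta>]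
    have "isolated_singularity_at (W3 a d) p"
      by (rule pole(1))
    moreover have "is_pole (W3 a d) p"
      by (rule pole(2))
    ultimately show ?case
      unfolding p_def by (rule conjI)
  qed
qed

end

theorem theorem5p2:
  fixes t :: "nat \<Rightarrow> real"
  assumes t: "\<forall>\<^sub>F j in sequentially. unique_zero_in_window j (t j)"
  defines "L \<equiv> \<lambda>j. (t j - t_star j) * hh j ^ 3 * exp ((sqrt 3 - 1) * pi * hh j)"
  shows
    "(\<lambda>j. t j - t_star j) \<in> O(\<lambda>j. 1 / hh j ^ 3 * exp (- ((sqrt 3 - 1) * pi * hh j))) \<and>
     (\<lambda>j. L j - 2 * (- 1) ^ (j + 1) * cos (sqrt 3 * pi * hh j)) \<in> O(\<lambda>j. 1 / hh j) \<and>
     limit_points L = {- 2..2} \<and>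
     limsup (\<lambda>j. ereal (\<bar>t j - t_star j\<bar> * hh j ^ 3 * exp ((sqrt 3 - 1) * pi * hh j))) = 2 \<and>
     (\<forall>c > (sqrt 3 - 1) * pi.
        (\<lambda>j. t j - t_star j) \<notin> O(\<lambda>j. 1 / hh j ^ 3 * exp (- (c * hh j)))) \<and>
     (\<lambda>j. Theta (t j) - pi * (hh j + 7 / (16 * hh j))) \<in> O(\<lambda>j. 1 / hh j ^ 3) \<and>
     (\<forall>a d. 2 \<le> a \<and> 2 \<le> d \<and> even d \<longrightarrow>
        (\<forall>\<^sub>F j in sequentially.
           isolated_singularity_at (W3 a d) (complex_of_real (exp (- t j / real a))) \<and>
           is_pole (W3 a d) (complex_of_real (exp (- t j / real a)))))"
proof -
  have zero: "\<forall>\<^sub>F j in sequentially. t j > 0 \<and> V_minus (t j) = 0 \<and> in_window j (t j)"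
    using t by eventually_elim (auto simp: unique_zero_in_window_def)
  interpret Z: zero_sequence t "\<lambda>j. sqrt (pi / t j)"
    by (rule zero_sequence.intro) (rule zero, rule reflexive)
  have L_refined: "(\<lambda>j. L j - 2 * (- 1) ^ (j + 1) * cos (sqrt 3 * pi * hh j)) \<in> O(\<lambda>j. 1 / hh j)"
    using Z.L_refined unfolding Z.L_def L_def .
  then have lim: "(\<lambda>j. L j - leading j) \<longlonglongrightarrow> 0"
    unfolding leading_def by (rule bigo_hh_tendsto_0)
  have diff_eq: "t j - t_star j = L j * (1 / hh j ^ 3 * exp (- ((sqrt 3 - 1) * pi * hh j)))" for j
    using hh_pos[of j] by (simp add: L_def exp_minus)
  have P1: "(\<lambda>j. t j - t_star j) \<in> O(\<lambda>j. 1 / hh j ^ 3 * exp (- ((sqrt 3 - 1) * pi * hh j)))"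
  proof -
    have "(\<lambda>j. L j * (1 / hh j ^ 3 * exp (- ((sqrt 3 - 1) * pi * hh j))))
        \<in> O(\<lambda>j. 1 * (1 / hh j ^ 3 * exp (- ((sqrt 3 - 1) * pi * hh j))))"
      by (intro landau_o.big.mult bounded_bigo[OF lim] landau_o.big_refl)
    then show ?thesis
      unfolding diff_eq[symmetric] mult_1 .
  qed
  have P4: "limsup (\<lambda>j. ereal (\<bar>t j - t_star j\<bar> * hh j ^ 3 * exp ((sqrt 3 - 1) * pi * hh j))) = 2"
  proof -
    have "\<bar>t j - t_star j\<bar> * hh j ^ 3 * exp ((sqrt 3 - 1) * pi * hh j) = \<bar>L j\<bar>" for j
      using hh_pos[of j] by (simp add: L_def abs_mult)
    then show ?thesis
      using limsup_abs_eq[OF lim] by (simp only:)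
  qed
  \<comment> \<open>A faster rate would give L = O(exp (- e h)) with e > 0, so L would tend to 0,
    although 2 is one of its limit points.\<close>
  have P5: "(\<lambda>j. t j - t_star j) \<notin> O(\<lambda>j. 1 / hh j ^ 3 * exp (- (c * hh j)))" if c: "c > (sqrt 3 - 1) * pi" for c
  proof
    define e where "e = c - (sqrt 3 - 1) * pi"
    have "e > 0"
      using c by (simp add: e_def)
    assume "(\<lambda>j. t j - t_star j) \<in> O(\<lambda>j. 1 / hh j ^ 3 * exp (- (c * hh j)))"
    then have "(\<lambda>j. (t j - t_star j) * (hh j ^ 3 * exp ((sqrt 3 - 1) * pi * hh j)))
        \<in> O(\<lambda>j. 1 / hh j ^ 3 * exp (- (c * hh j)) * (hh j ^ 3 * exp ((sqrt 3 - 1) * pi * hh j)))"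
      by (intro landau_o.big.mult landau_o.big_refl)
    moreover have "1 / hh j ^ 3 * exp (- (c * hh j)) * (hh j ^ 3 * exp ((sqrt 3 - 1) * pi * hh j)) = exp (- (e * hh j))" for j
    proof -
      have "exp (- (e * hh j)) = exp (- (c * hh j)) * exp ((sqrt 3 - 1) * pi * hh j)"
        unfolding exp_add[symmetric] by (simp add: e_def algebra_simps)
      then show ?thesis
        using hh_pos[of j] by simp
    qed
    ultimately have "L \<in> O(\<lambda>j. exp (- (e * hh j)))"
      by (simp only: L_def mult.assoc)
    moreover have "(\<lambda>j. exp (- (e * hh j))) \<in> O(\<lambda>j. 1 / hh j)"
      unfolding hh_def using \<open>e > 0\<close> by real_asymp
    ultimately have "L \<longlonglongrightarrow> 0"
      by (intro bigo_hh_tendsto_0) (rule landau_o.big_trans)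
    with not_tendsto_zero[OF lim] show False ..
  qed
  have P7: "\<forall>\<^sub>F j in sequentially.
           isolated_singularity_at (W3 a d) (complex_of_real (exp (- t j / real a))) \<and>
           is_pole (W3 a d) (complex_of_real (exp (- t j / real a)))" if "2 \<le> a \<and> 2 \<le> d \<and> even d" for a d
    using that by (intro Z.poles t) simp_all
  show ?thesis
    using P1 L_refined limit_points_eq[OF lim] P4 P5 Z.Theta_refined P7 by blast
qed

end
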